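(* Let $a=(100\sqrt{7}+200\sqrt{3})^{1/6}(342+78\sqrt{21})^{1/12}$. The following evaluations hold: $$r_{3,21}=20^{-1/2}\left\{\sqrt{358+78\sqrt{21}}+\sqrt{342+78\sqrt{21}}\right\}^{1/4} a,$$ $$r_{3,3/7}=20^{-1/2}\left\{\sqrt{358+78\sqrt{21}}-\sqrt{342+78\sqrt{21}}\right\}^{1/4} a,$$ $$r'_{3,21}=2^{-11/24}3^{1/8}(\sqrt{7}+\sqrt{3})^{1/12}\left\{\sqrt{11+\sqrt{21}}+\sqrt{3+\sqrt{21}}\right\}^{1/4},$$ $$r'_{3,3/7}=2^{-11/24}3^{1/8}(\sqrt{7}+\sqrt{3})^{1/12}\left\{\sqrt{11+\sqrt{21}}-\sqrt{3+\sqrt{21}}\right\}^{1/4},$$ $$r_{7,9}=\frac{\sqrt{34+6\sqrt{21}}+\sqrt{18+6\sqrt{21}}}{4},$$ $$r'_{7,9}=2^{-3/4}\left\{\sqrt{11+\sqrt{21}}+\sqrt{3+\sqrt{21}}\right\}^{1/2}.$$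
   Context: For $|x|<1$, $f(-x):=\sum_{m=-\infty}^{\infty}(-1)^m x^{m(3m-1)/2}$; thus $f(x)=\sum_{m=-\infty}^{\infty}(-1)^m(-x)^{m(3m-1)/2}$. For positive real $k,n$, $$r_{k,n}:=\frac{f(-q)}{k^{1/4}q^{(k-1)/24}f(-q^k)}\ \text{ with } q=e^{-2\pi\sqrt{n/k}},\qquad r'_{k,n}:=\frac{f(q)}{k^{1/4}q^{(k-1)/24}f(q^k)}\ \text{ with } q=e^{-\pi\sqrt{n/k}}.$$ All roots and fractional powers of positive reals are the positive real ones. *)

theory Defs
  imports "HOL-Analysis.Analysis"
begin

text \<open>
  Ramanujan's theta function f, meant for arguments of absolute value less than 1.
  The pentagonal exponent m (3m - 1) / 2 is a nonnegative integer for every integer m,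
  so the integer division is exact and nat does not truncate. The series over all integers
  converges absolutely.
\<close>
definition theta_f :: "real \<Rightarrow> real" where
  "theta_f x = (\<Sum>\<^sub>\<infinity>m::int. (-1) powi m * (-x) ^ nat (m * (3 * m - 1) div 2))"

text \<open>The parameters k and n below are meant to be positive.\<close>

definition ram_r :: "real \<Rightarrow> real \<Rightarrow> real" where
  "ram_r k n = (let q = exp (- 2 * pi * sqrt (n / k))
            in theta_f (- q) / (k powr (1/4) * q powr ((k - 1) / 24) * theta_f (- (q powr k))))"

definition ram_r' :: "real \<Rightarrow> real \<Rightarrow> real" where
  "ram_r' k n = (let q = exp (- pi * sqrt (n / k))
             in theta_f q / (k powr (1/4) * q powr ((k - 1) / 24) * theta_f (q powr k)))"

end

theory Submission
  imports Defs "HOL-Probability.Characteristic_Functions"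
begin

text \<open>
  Write \<open>\<eta>(s)\<close> for the Dedekind function at \<open>i s\<close> and \<open>\<eta>'(s)\<close> for its modulus at \<open>(1 + i s) / 2\<close>.
  By \<open>\<eta>(1/s) = sqrt s * \<eta>(s)\<close> all six values are quotients of \<open>\<eta>\<close> and \<open>\<eta>'\<close> at \<open>sqrt 7\<close>, \<open>3 * sqrt 7\<close> and
  \<open>sqrt 7 / 3\<close>. The degree 7 equation for \<open>u(s) = \<eta>'(s) / \<eta>(s)\<close> gives \<open>u(sqrt 7) = sqrt 2\<close>. The degree 3
  equation then makes \<open>u\<^sup>3 / (2 * sqrt 2)\<close> at the two other points a root of \<open>w\<^sup>4 - 8 w\<^sup>3 + w + 1\<close>, which
  splits over \<open>sqrt 21\<close>. Finally the level 9 identity, which expresses \<open>\<eta>(3s)\<^sup>1\<^sup>2 / \<eta>(9s)\<^sup>1\<^sup>2\<close> by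
  \<open>\<eta>(s)\<^sup>3 / \<eta>(9s)\<^sup>3\<close>, and its twin for \<open>\<eta>'\<close> give a quadratic equation for \<open>(\<eta>(sqrt 7 / 3) / \<eta>(3 * sqrt 7))\<^sup>3\<close>.
\<close>

section \<open>The Jacobi triple product\<close>

text \<open>The degree 7 equation closes because it is used at 1 / sqrt 7: inversion exchanges this
  point with sqrt 7, so a relation between two points becomes an equation at one. The degree 3
  equation links sqrt 7 with 3 * sqrt 7 and sqrt 7 / 3 with sqrt 7; the common point is why both
  unknowns satisfy one quartic. Algebra alone does not tell which positive root belongs to which
  point, nor which root of the final quadratic is meant; crude bounds on the product for f decide
  this. Inversion is the only modular input: it is proved for \<eta> by Poisson summation and passes
  to \<eta>' through a product relation. Everything else is an identity of q-series, obtained from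
  the Jacobi triple product or from bijections between lattice points. The series are complex
  because the level 9 identity multiplies q by cube roots of unity.\<close>

lemma tannery_has_sum:
  fixes f :: "nat \<Rightarrow> 'a \<Rightarrow> 'b::banach"
  assumes lim: "\<And>n. (\<lambda>N. f N n) \<longlonglongrightarrow> g n"
    and bound: "\<And>N n. norm (f N n) \<le> M n"
    and M: "M summable_on UNIV"
    and S: "\<And>N. (f N has_sum S N) UNIV"
  shows "S \<longlonglongrightarrow> infsum g UNIV" "g summable_on UNIV"
proof -
  have bg: "norm (g n) \<le> M n" for n
    by (rule tendsto_upperbound[OF tendsto_norm[OF lim]]) (auto simp: bound)
  have "(\<lambda>n. norm (g n)) summable_on UNIV"
    by (rule Infinite_Sum.abs_summable_on_comparison_test'[OF M bg])
  thus g: "g summable_on UNIV" by (rule abs_summable_summable)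
  \<comment> \<open>The majorant makes the finite partial sums converge uniformly in
    \<open>N\<close>, which justifies exchanging the limit in \<open>N\<close> with the sum.\<close>
  have u: "uniform_limit UNIV (\<lambda>X y. \<Sum>x\<in>X. f y x) (\<lambda>y. \<Sum>\<^sub>\<infinity>x\<in>UNIV. f y x) (finite_subsets_at_top UNIV)"
    by (rule Weierstrass_m_test_general[OF bound M])
  have "(\<lambda>N. \<Sum>\<^sub>\<infinity>x\<in>UNIV. f N x) \<longlonglongrightarrow> infsum g UNIV"
  proof (rule swap_uniform_limit'[OF _ _ u])
    show "\<forall>\<^sub>F X in finite_subsets_at_top UNIV. (\<lambda>N. \<Sum>x\<in>X. f N x) \<longlonglongrightarrow> (\<Sum>x\<in>X. g x)"
      by (intro always_eventually allI tendsto_sum lim)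
    show "(sum g \<longlongrightarrow> infsum g UNIV) (finite_subsets_at_top UNIV)"
      using g by (rule infsum_tendsto)
  qed auto
  thus "S \<longlonglongrightarrow> infsum g UNIV" by (simp add: infsumI[OF S])
qed

definition tri :: "int \<Rightarrow> int" where "tri n = n * (n - 1) div 2"

lemma tri_eq: "2 * tri n = n * (n - 1)"
proof -
  have "even (n * (n - 1))" by auto
  thus ?thesis unfolding tri_def by simp
qed

lemma tri_eqI: "2 * k = n * (n - 1) \<Longrightarrow> tri n = k"
  using tri_eq[of n] by simp

lemma tri_Suc: "tri (n + 1) = tri n + n"
  by (rule tri_eqI) (use tri_eq[of n] in \<open>simp add: algebra_simps\<close>)

lemma tri_reflect: "tri (1 - n) = tri n"
  by (rule tri_eqI) (use tri_eq[of n] in \<open>simp add: algebra_simps\<close>)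

text \<open>For n >= 0 consecutive terms have the ratio \<open>r ^ n * c\<close>, which tends to 0.
  The other half follows by the reflection n -> 1 - n, which fixes \<open>tri\<close> and replaces
  \<open>c\<close> by \<open>1 / c\<close>.\<close>

lemma summable_on_tri:
  fixes r c :: real
  assumes r: "0 < r" "r < 1" and c: "c > 0"
  shows "(\<lambda>n. r powi tri n * c powi n) summable_on UNIV"
proof -
  have nat: "(\<lambda>n. r powi tri n * c powi n) summable_on {0..}" if c: "c > 0" for c :: real
  proof -
    have "(\<lambda>n. r ^ n * c) \<longlonglongrightarrow> 0 * c" using r by (intro tendsto_intros LIMSEQ_power_zero) auto
    hence "eventually (\<lambda>n. r ^ n * c < 1/2) sequentially" by (rule order_tendstoD) auto
    then obtain N where N: "\<And>n. n \<ge> N \<Longrightarrow> r ^ n * c < 1/2" by (auto simp: eventually_sequentially)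
    have "summable (\<lambda>n. r powi tri (int n) * c powi int n)"
    proof (rule summable_ratio_test[of "1/2" N])
      fix n assume "n \<ge> N"
      have e: "r powi tri (int (Suc n)) * c powi int (Suc n) = (r ^ n * c) * (r powi tri (int n) * c powi int n)"
        using r tri_Suc[of "int n"] by (simp add: power_int_add add.commute)
      show "norm (r powi tri (int (Suc n)) * c powi int (Suc n)) \<le> 1/2 * norm (r powi tri (int n) * c powi int n)"
        unfolding e norm_mult using N[OF \<open>n \<ge> N\<close>] r c
        by (intro mult_right_mono) (auto simp: abs_mult)
    qed auto
    hence "(\<lambda>n. r powi tri (int n) * c powi int n) summable_on UNIV"
      using r c by (intro summable_nonneg_imp_summable_on) auto
    thus ?thesis
      by (subst summable_on_reindex_bij_witness[of "{0..}" int nat UNIV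
            "\<lambda>n. r powi tri (int n) * c powi int n"]) auto
  qed
  have "(\<lambda>n. (r powi tri n * (1/c) powi n) * c) summable_on {1..}"
    by (rule summable_on_subset[OF summable_on_cmult_left[OF nat]]) (use c in auto)
  also have "?this \<longleftrightarrow> (\<lambda>n. r powi tri n * c powi n) summable_on {..0}"
    by (rule summable_on_reindex_bij_witness[of _ "\<lambda>n. 1 - n" "\<lambda>n. 1 - n"])
       (use c in \<open>auto simp: tri_reflect power_int_diff power_int_divide_distrib\<close>)
  finally have "(\<lambda>n. r powi tri n * c powi n) summable_on ({..0} \<union> {0..})"
    by (intro summable_on_union nat c)
  also have "{..0} \<union> {0..} = (UNIV :: int set)" by auto
  finally show ?thesis .
qed

text \<open>The finite product (q; q)_N, whose limit \<open>eul\<close> is Euler's function; the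
  pentagonal number theorem later identifies \<open>eul q\<close> with f(-q).\<close>

definition qpoch :: "complex \<Rightarrow> nat \<Rightarrow> complex" where
  "qpoch q N = (\<Prod>k<N. 1 - q ^ Suc k)"

definition eul :: "complex \<Rightarrow> complex" where
  "eul q = prodinf (\<lambda>k. 1 - q ^ Suc k)"

lemma qpoch_0 [simp]: "qpoch q 0 = 1" and qpoch_Suc: "qpoch q (Suc N) = qpoch q N * (1 - q ^ Suc N)"
  by (auto simp: qpoch_def)

lemma one_minus_power_nz: "norm q < 1 \<Longrightarrow> 1 - q ^ Suc k \<noteq> (0::complex)"
proof
  assume "norm q < 1" "1 - q ^ Suc k = 0"
  hence "norm (q ^ Suc k) = 1" by (metis eq_iff_diff_eq_0 norm_one)
  moreover have "norm (q ^ Suc k) < 1" using power_less_one_iff[of "norm q" "Suc k"] \<open>norm q < 1\<close>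
    by (simp add: norm_power del: power_Suc)
  ultimately show False by simp
qed

lemma qpoch_nz: "norm q < 1 \<Longrightarrow> qpoch q N \<noteq> 0"
  using one_minus_power_nz by (auto simp: qpoch_def)

lemma convergent_prod_eul: "norm q < 1 \<Longrightarrow> convergent_prod (\<lambda>k. 1 - q ^ Suc k :: complex)"
  by (intro abs_convergent_prod_imp_convergent_prod summable_imp_abs_convergent_prod)
     (auto simp: norm_mult norm_power intro!: summable_mult summable_geometric)

lemma qpoch_LIMSEQ: "norm q < 1 \<Longrightarrow> qpoch q \<longlonglongrightarrow> eul q"
  using convergent_prod_LIMSEQ[OF convergent_prod_eul, of q]
  unfolding eul_def qpoch_def lessThan_Suc_atMost[symmetric]
  by (subst (asm) filterlim_sequentially_Suc)

lemma eul_nz: "norm q < 1 \<Longrightarrow> eul q \<noteq> 0"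
  unfolding eul_def by (rule prodinf_nonzero[OF convergent_prod_eul one_minus_power_nz])

text \<open>The Gaussian binomial coefficient. The value 0 beyond \<open>M\<close> lets the q-Pascal
  rule below hold at \<open>j = M\<close> as well.\<close>

definition gauss_binom :: "complex \<Rightarrow> nat \<Rightarrow> nat \<Rightarrow> complex" where
  "gauss_binom q M j = (if j \<le> M then qpoch q M / (qpoch q j * qpoch q (M - j)) else 0)"

lemma gauss_binom_rec:
  assumes "norm q < 1" "j \<le> M"
  shows "gauss_binom q (Suc M) (Suc j) = gauss_binom q M (Suc j) + q ^ (M - j) * gauss_binom q M j"
proof (cases "j = M")
  case True
  thus ?thesis using qpoch_nz[OF assms(1)] by (simp add: gauss_binom_def)
next
  case False
  then obtain b where b: "M = j + Suc b" using assms(2)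
    by (metis less_iff_Suc_add le_neq_implies_less add_Suc_right)
  have nz: "qpoch q j \<noteq> 0" "qpoch q b \<noteq> 0" "1 - q ^ Suc j \<noteq> 0" "1 - q ^ Suc b \<noteq> 0"
    using qpoch_nz[OF assms(1)] one_minus_power_nz[OF assms(1)] by blast+
  have e: "q ^ Suc (j + Suc b) = q ^ Suc j * q ^ Suc b" by (simp add: power_add)
  have "gauss_binom q (Suc M) (Suc j) = qpoch q M * (1 - q ^ Suc j * q ^ Suc b) / (qpoch q j * (1 - q ^ Suc j) * (qpoch q b * (1 - q ^ Suc b)))"
    by (simp only: gauss_binom_def b qpoch_Suc e) (simp add: qpoch_Suc)
  moreover have "gauss_binom q M (Suc j) = qpoch q M / (qpoch q j * (1 - q ^ Suc j) * qpoch q b)"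
    by (simp add: gauss_binom_def b) (simp add: qpoch_Suc)
  moreover have "gauss_binom q M j = qpoch q M / (qpoch q j * (qpoch q b * (1 - q ^ Suc b)))"
    by (simp add: gauss_binom_def b) (simp add: qpoch_Suc)
  moreover have "M - j = Suc b" by (simp add: b)
  ultimately show ?thesis using nz by (simp only:) (simp add: divide_simps del: power_Suc, simp add: algebra_simps)
qed

text \<open>Rothe's q-binomial theorem. The induction adds the last factor 1 - x q^M, so
  \<open>x\<close> is not rescaled and the q-Pascal rule matches coefficients directly.\<close>

lemma gauss_binomial:
  assumes q: "norm q < 1" "q \<noteq> 0"
  shows "(\<Prod>k<M. 1 - x * q ^ k) = (\<Sum>j\<le>M. (-1) ^ j * gauss_binom q M j * q powi tri (int j) * x ^ j)"
proof (induction M)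
  case 0
  show ?case by (simp add: gauss_binom_def tri_def)
next
  case (Suc M)
  define c where "c M j = (-1) ^ j * gauss_binom q M j * q powi tri (int j) * x ^ j" for M j
  have rec: "c (Suc M) (Suc j) = c M (Suc j) - x * q ^ M * c M j" if "j \<le> M" for j
  proof -
    have t: "q powi tri (int (Suc j)) = q powi tri (int j) * q ^ j"
      using tri_Suc[of "int j"] q by (simp add: power_int_add add.commute)
    have "q ^ (M - j) * q ^ j = q ^ M" using that by (simp flip: power_add)
    thus ?thesis unfolding c_def gauss_binom_rec[OF q(1) that] t by (simp add: algebra_simps)
  qed
  have c0: "c (Suc M) 0 = c M 0" using qpoch_nz[OF q(1)] by (simp add: c_def gauss_binom_def)
  have "(\<Sum>j\<le>Suc M. c (Suc M) j) = c M 0 + (\<Sum>j\<le>M. c M (Suc j)) - x * q ^ M * (\<Sum>j\<le>M. c M j)"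
    unfolding sum.atMost_Suc_shift c0
    by (simp add: rec sum_subtractf sum_distrib_left algebra_simps)
  also have "c M 0 + (\<Sum>j\<le>M. c M (Suc j)) = (\<Sum>j\<le>Suc M. c M j)"
    unfolding sum.atMost_Suc_shift ..
  also have "\<dots> = (\<Sum>j\<le>M. c M j)" by (simp add: c_def gauss_binom_def)
  finally show ?case using Suc.IH by (simp add: c_def algebra_simps)
qed

text \<open>The coefficients of the finite triple product, extended by 0 so that all
  \<open>N\<close> share the integers as index set, as dominated convergence requires.\<close>

definition centred_binom :: "complex \<Rightarrow> nat \<Rightarrow> int \<Rightarrow> complex" where
  "centred_binom q N n = (if \<bar>n\<bar> \<le> int N then gauss_binom q (2 * N) (nat (int N + n)) else 0)"

lemma prod_inverse_tri:
  assumes "q \<noteq> 0"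
  shows "(\<Prod>k<N. q powi (- int k - 1)) = (q::complex) powi (- tri (int N + 1))"
proof (induction N)
  case (Suc N)
  have "- tri (int (Suc N) + 1) = - tri (int N + 1) + (- int N - 1)"
    using tri_Suc[of "int N + 1"] by simp
  thus ?case using Suc assms by (simp add: power_int_add[symmetric])
qed (simp add: tri_def)

text \<open>Put x = z q^(-N) in the q-binomial theorem with 2 N factors. The last N factors are 1 -
  z q^k. The first N, read backwards, are 1 - q^(k+1) / z up to a monomial, which cancels when the
  summation index is shifted by N.\<close>

lemma finite_jacobi:
  assumes q: "norm q < 1" "q \<noteq> 0" and z: "z \<noteq> 0"
  shows "(\<Prod>k<N. (1 - z * q ^ k) * (1 - q ^ Suc k / z))
           = (\<Sum>n\<in>{-int N..int N}. (-1) powi n * centred_binom q N n * q powi tri n * z powi n)"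
proof -
  define x where "x = z * q powi (- int N)"
  have split: "(\<Prod>k<N + M. f k) = (\<Prod>k<N. f k) * (\<Prod>k<M. f (N + k))" for f :: "nat \<Rightarrow> complex" and M
    by (induction M) (auto simp: algebra_simps)
  have "(\<Prod>k<N. 1 - x * q ^ k) = (\<Prod>k<N. 1 - x * q ^ (N - Suc k))"
    by (rule prod.nat_diff_reindex[symmetric])
  also have "\<dots> = (\<Prod>k<N. (- z) * q powi (- int k - 1) * (1 - q ^ Suc k / z))"
  proof (intro prod.cong refl)
    fix k assume k: "k \<in> {..<N}"
    have "q powi (- int N) * q ^ (N - Suc k) = q powi (- int N + int (N - Suc k))"
      using q by (subst power_int_add) auto
    also have "- int N + int (N - Suc k) = - int k - 1" using k by auto
    finally have "x * q ^ (N - Suc k) = z * q powi (- int k - 1)" by (simp add: x_def)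
    moreover have "q powi (- int k - 1) * q ^ Suc k = 1"
    proof -
      have "q powi (- int k - 1) * q powi (int (Suc k)) = q powi 0"
        by (subst power_int_add[symmetric]) (use q in auto)
      thus ?thesis by (simp only: power_int_of_nat power_int_0_right)
    qed
    moreover have "(- z) * u * (1 - v / z) = u * v - z * u" for u v
      using z by (simp add: field_simps)
    ultimately show "1 - x * q ^ (N - Suc k) = (- z) * q powi (- int k - 1) * (1 - q ^ Suc k / z)"
      by (simp only:)
  qed
  also have "\<dots> = (- z) ^ N * q powi (- tri (int N + 1)) * (\<Prod>k<N. 1 - q ^ Suc k / z)"
    by (simp only: prod.distrib prod_constant card_lessThan prod_inverse_tri[OF q(2)])
  finally have P1: "(\<Prod>k<N. 1 - x * q ^ k) = \<dots>" .
  have P2: "1 - x * q ^ (N + k) = 1 - z * q ^ k" for k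
    using q by (simp add: x_def power_add power_int_minus)
  have "(- z) ^ N * q powi (- tri (int N + 1)) * (\<Prod>k<N. (1 - z * q ^ k) * (1 - q ^ Suc k / z))
        = (\<Prod>k<N + N. 1 - x * q ^ k)"
    by (simp only: split P1 P2 prod.distrib mult_ac)
  also have "\<dots> = (\<Sum>j\<le>2 * N. (-1) ^ j * gauss_binom q (2 * N) j * q powi tri (int j) * x ^ j)"
    by (simp only: gauss_binomial[OF q] mult_2)
  also have "\<dots> = (\<Sum>n\<in>{-int N..int N}. (- z) ^ N * q powi (- tri (int N + 1)) *
                    ((-1) powi n * centred_binom q N n * q powi tri n * z powi n))"
  proof (rule sum.reindex_bij_witness[of _ "\<lambda>n. nat (int N + n)" "\<lambda>j. int j - int N"], goal_cases)
    case (5 j)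
    define n where "n = int j - int N"
    have j: "int j = int N + n" by (simp add: n_def)
    have "centred_binom q N n = gauss_binom q (2 * N) j" using 5 by (auto simp: centred_binom_def n_def)
    moreover have "(-1) ^ j = (-1) ^ N * ((-1) powi n :: complex)"
      by (simp flip: power_int_of_nat add: j power_int_add)
    moreover have "q powi tri (int j) * x ^ j = q powi (- tri (int N + 1)) * q powi tri n * (z ^ N * z powi n)"
    proof -
      have "x ^ j = z powi int j * q powi (- int N * int j)"
        unfolding x_def power_mult_distrib
        by (simp only: power_int_of_nat[symmetric] power_int_mult[symmetric])
      also have "z powi int j = z ^ N * z powi n" using z by (simp add: j power_int_add)
      finally have "q powi tri (int j) * x ^ j = q powi (tri (int j) + (- int N * int j)) * (z ^ N * z powi n)"
        using q by (subst power_int_add) auto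
      also have "tri (int j) + (- int N * int j) = - tri (int N + 1) + tri n"
      proof -
        have "2 * (tri (int j) + (- int N * int j)) = 2 * (- tri (int N + 1) + tri n)"
          using tri_eq[of "int j"] tri_eq[of n] tri_eq[of "int N + 1"] unfolding j
          by (simp add: algebra_simps)
        thus ?thesis by simp
      qed
      also have "q powi (- tri (int N + 1) + tri n) = q powi (- tri (int N + 1)) * q powi tri n"
        using q by (subst power_int_add) auto
      finally show ?thesis by simp
    qed
    ultimately show ?case unfolding n_def[symmetric] by (simp add: power_minus[of z] mult_ac)
  qed auto
  also have "\<dots> = (- z) ^ N * q powi (- tri (int N + 1)) *
                  (\<Sum>n\<in>{-int N..int N}. (-1) powi n * centred_binom q N n * q powi tri n * z powi n)"
    by (simp only: sum_distrib_left)
  finally show ?thesis using q z by simp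
qed

lemma centred_binom_tendsto:
  assumes q: "norm q < 1"
  shows "(\<lambda>N. centred_binom q N n) \<longlonglongrightarrow> 1 / eul q"
proof -
  have f: "filterlim (\<lambda>N. nat (int N + m)) at_top sequentially" for m
    by (rule filterlim_at_top_mono[OF filterlim_minus_const_nat_at_top[of "nat (-m)"]])
       (auto intro!: always_eventually)
  have "(\<lambda>N. qpoch q (2 * N) / (qpoch q (nat (int N + n)) * qpoch q (nat (int N + (-n))))) \<longlonglongrightarrow> eul q / (eul q * eul q)"
    by (intro tendsto_divide tendsto_mult filterlim_compose[OF qpoch_LIMSEQ[OF q]] f
          filterlim_subseq) (auto simp: eul_nz[OF q] strict_mono_def)
  moreover have "eventually (\<lambda>N. qpoch q (2 * N) / (qpoch q (nat (int N + n)) * qpoch q (nat (int N + (-n)))) = centred_binom q N n) sequentially"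
    using eventually_ge_at_top[of "nat \<bar>n\<bar>"]
  proof eventually_elim
    case (elim N)
    hence "nat (int N + n) \<le> 2 * N" "2 * N - nat (int N + n) = nat (int N + - n)" "\<bar>n\<bar> \<le> int N" by auto
    thus ?case by (simp add: centred_binom_def gauss_binom_def)
  qed
  ultimately show ?thesis using eul_nz[OF q] by (simp add: Lim_transform_eventually)
qed

text \<open>\<open>qpoch\<close> converges to a nonzero limit, so it and its inverse are bounded.
  Uniformity in both indices supplies the majorant for the passage to the limit.\<close>

lemma centred_binom_bounded:
  assumes q: "norm q < 1"
  obtains K where "K > 0" "\<And>N n. norm (centred_binom q N n) \<le> K"
proof -
  obtain C where C: "C > 0" "\<And>N. norm (qpoch q N) \<le> C"
    using convergent_imp_Bseq[OF convergentI[OF qpoch_LIMSEQ[OF q]]] by (auto elim: BseqE)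
  obtain D where D: "D > 0" "\<And>N. norm (inverse (qpoch q N)) \<le> D"
    using convergent_imp_Bseq[OF convergentI[OF tendsto_inverse[OF qpoch_LIMSEQ[OF q] eul_nz[OF q]]]]
    by (auto elim: BseqE)
  show ?thesis
  proof (rule that[of "C * (D * D)"])
    show "norm (centred_binom q N n) \<le> C * (D * D)" for N n
    proof (cases "centred_binom q N n = 0")
      case False
      then obtain M a b where "centred_binom q N n = qpoch q M * (inverse (qpoch q a) * inverse (qpoch q b))"
        by (auto simp: centred_binom_def gauss_binom_def divide_inverse split: if_splits)
      thus ?thesis using C D by (auto simp only: norm_mult intro!: mult_mono) auto
    qed (use C D in auto)
  qed (use C D in auto)
qed

text \<open>The coefficients \<open>a\<close> are arbitrary because the limit is taken twice: for
  the triple product and, with an extra factor n, for its derivative at z = 1.\<close>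

lemma centred_binom_limit:
  assumes q: "norm q < 1" "q \<noteq> 0"
    and a: "(\<lambda>n. norm (a n :: complex)) summable_on UNIV"
    and S: "\<And>N. (\<Sum>n\<in>{-int N..int N}. centred_binom q N n * a n) = S N"
  shows "(\<lambda>N. S N * eul q) \<longlonglongrightarrow> infsum a UNIV" "a summable_on UNIV"
proof -
  obtain K where K: "K > 0" "\<And>N n. norm (centred_binom q N n) \<le> K" using centred_binom_bounded[OF q(1)] by blast
  have M: "(\<lambda>n. K * norm (a n)) summable_on UNIV" using a by (rule summable_on_cmult_right)
  have hs: "((\<lambda>n. centred_binom q N n * a n) has_sum S N) UNIV" for N
  proof (rule has_sum_finite_neutralI[of "{-int N..int N}"])
    show "\<And>x. x \<in> UNIV - {- int N..int N} \<Longrightarrow> centred_binom q N x * a x = 0" by (auto simp: centred_binom_def)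
  qed (auto simp: S)
  have lim: "(\<lambda>N. centred_binom q N n * a n) \<longlonglongrightarrow> 1 / eul q * a n" for n
    by (intro tendsto_intros centred_binom_tendsto q)
  have "S \<longlonglongrightarrow> (\<Sum>\<^sub>\<infinity>n. 1 / eul q * a n)"
    by (rule tannery_has_sum(1)[OF lim _ M hs]) (auto simp: norm_mult intro!: mult_right_mono K)
  moreover show a': "a summable_on UNIV" using a by (rule abs_summable_summable)
  ultimately have "S \<longlonglongrightarrow> 1 / eul q * infsum a UNIV" by (simp only: infsum_cmult_right)
  hence "(\<lambda>N. S N * eul q) \<longlonglongrightarrow> 1 / eul q * infsum a UNIV * eul q" by (intro tendsto_intros)
  thus "(\<lambda>N. S N * eul q) \<longlonglongrightarrow> infsum a UNIV" using eul_nz[OF q(1)] by simp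
qed

lemma field_differentiable_prod:
  fixes f :: "nat \<Rightarrow> complex \<Rightarrow> complex"
  assumes "\<And>k. k < N \<Longrightarrow> f k field_differentiable (at z)"
  shows "(\<lambda>z. \<Prod>k<N. f k z) field_differentiable (at z)"
  using assms by (induction N) (auto intro!: field_differentiable_mult)

lemma norm_powi: "norm ((x::complex) powi n) = norm x powi n"
  by (rule norm_power_int)

lemma abs_summable_jacobi:
  assumes q: "norm q < 1" "q \<noteq> 0" and z: "z \<noteq> (0::complex)"
  shows "(\<lambda>n. norm ((-1) powi n * q powi tri n * z powi n)) summable_on UNIV"
  using summable_on_tri[of "norm q" "norm z"] q z by (simp add: norm_mult norm_powi)

text \<open>Stated with finite products because the specialisations below are compared factor by
  factor before the limit; the case z = 1, where the limit is 0, is used as well.\<close>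

theorem jacobi_triple:
  fixes q z :: complex
  assumes q: "norm q < 1" "q \<noteq> 0" and z: "z \<noteq> 0"
  shows "(\<lambda>N. \<Prod>k<N. (1 - z * q ^ k) * (1 - q ^ Suc k / z) * (1 - q ^ Suc k))
            \<longlonglongrightarrow> (\<Sum>\<^sub>\<infinity>n. (-1) powi n * q powi tri n * z powi n)"
proof -
  define P where "P N = (\<Prod>k<N. (1 - z * q ^ k) * (1 - q ^ Suc k / z))" for N
  have "(\<lambda>N. P N * eul q) \<longlonglongrightarrow> (\<Sum>\<^sub>\<infinity>n. (-1) powi n * q powi tri n * z powi n)"
    by (rule centred_binom_limit(1)[OF q abs_summable_jacobi[OF q z]])
       (simp add: P_def finite_jacobi[OF q z] mult_ac del: power_Suc)
  \<comment> \<open>This quotient tends to 1; multiplying by it replaces the constant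
    \<open>eul q\<close> by the third family of factors.\<close>
  moreover have "(\<lambda>N. qpoch q N / eul q) \<longlonglongrightarrow> eul q / eul q"
    by (intro tendsto_intros qpoch_LIMSEQ q eul_nz)
  ultimately have "(\<lambda>N. (P N * eul q) * (qpoch q N / eul q)) \<longlonglongrightarrow>
      (\<Sum>\<^sub>\<infinity>n. (-1) powi n * q powi tri n * z powi n) * (eul q / eul q)"
    by (rule tendsto_mult)
  thus ?thesis using eul_nz[OF q(1)] by (simp add: P_def qpoch_def prod.distrib[symmetric] del: power_Suc)
qed

text \<open>This is the derivative at \<open>z = 1\<close> of the finite triple product, taken before the limit \<open>N \<rightarrow> \<infinity>\<close>.\<close>

theorem jacobi_cube:
  fixes q :: complex
  assumes q: "norm q < 1" "q \<noteq> 0"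
  shows "((\<lambda>n. (-1) powi n * of_int (1 - 2 * n) * q powi tri n) has_sum 2 * eul q ^ 3) UNIV"
proof -
  have sq: "(\<lambda>n. norm ((-1) powi n * q powi tri n :: complex)) summable_on UNIV"
    using abs_summable_jacobi[OF q, of 1] by simp
  \<comment> \<open>At z = 1 the factor k = 0 vanishes, so the unweighted series is 0. Adding it at
    the end turns the weight -2 n into 1 - 2 n.\<close>
  have "(\<lambda>N. \<Prod>k<N. (1 - 1 * q ^ k) * (1 - q ^ Suc k / 1) * (1 - q ^ Suc k))
            \<longlonglongrightarrow> (\<Sum>\<^sub>\<infinity>n. (-1) powi n * q powi tri n * 1 powi n)"
    by (rule jacobi_triple[OF q]) auto
  moreover have "eventually (\<lambda>N. (\<Prod>k<N. (1 - 1 * q ^ k) * (1 - q ^ Suc k / 1) * (1 - q ^ Suc k)) = 0) sequentially"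
    using eventually_gt_at_top[of 0] by eventually_elim (auto intro!: bexI[of _ 0])
  ultimately have "(\<Sum>\<^sub>\<infinity>n. (-1) powi n * q powi tri n * 1 powi n) = 0"
    by (rule LIMSEQ_unique[OF _ tendsto_eventually])
  hence z: "(\<Sum>\<^sub>\<infinity>n. (-1) powi n * q powi tri n) = 0" by simp
  define a where "a n = (-1) powi n * of_int n * q powi tri n" for n
  have an: "(\<lambda>n. norm (a n)) summable_on UNIV"
  proof (rule summable_on_comparison_test)
    show "(\<lambda>n. norm q powi tri n * 2 powi n + norm q powi tri n * (1/2) powi n) summable_on UNIV"
      using q by (intro summable_on_add summable_on_tri) auto
    fix n :: int
    \<comment> \<open>This crude bound replaces the weight n by two geometric factors, to which
      \<open>summable_on_tri\<close> applies with c = 2 and c = 1/2.\<close>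
    have "real_of_int \<bar>n\<bar> \<le> 2 powi n + (1/2) powi n"
    proof (cases "n \<ge> 0")
      case True
      then obtain m where "n = int m" by (metis nonneg_int_cases)
      moreover have "real m \<le> 2 ^ m" using less_exp[of m] by (metis less_imp_le of_nat_le_iff of_nat_numeral of_nat_power)
      ultimately show ?thesis by (simp add: add_increasing2)
    next
      case False
      then obtain m where "n = - int m" by (metis nonneg_int_cases neg_0_le_iff_le add.inverse_inverse linear)
      moreover have "real m \<le> 2 ^ m" using less_exp[of m] by (metis less_imp_le of_nat_le_iff of_nat_numeral of_nat_power)
      ultimately show ?thesis by (simp add: power_int_minus power_one_over add_increasing)
    qed
    hence "\<bar>real_of_int n\<bar> * norm q powi tri n \<le> (2 powi n + (1/2) powi n) * norm q powi tri n"
      by (intro mult_right_mono) auto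
    thus "norm (a n) \<le> norm q powi tri n * 2 powi n + norm q powi tri n * (1/2) powi n"
      by (simp add: a_def norm_mult norm_powi algebra_simps)
  qed auto
  define S where "S N = (\<Sum>n\<in>{-int N..int N}. centred_binom q N n * a n)" for N
  have S: "S (Suc N) = - (qpoch q N * qpoch q (Suc N))" for N
  proof -
    \<comment> \<open>The finite product without its factor 1 - z. The derivative of (1 - z) R(z) at
      1 is -R(1), so the derivative of \<open>R\<close> need not be computed.\<close>
    define R where "R z = (\<Prod>k<N. 1 - z * q ^ Suc k) * (\<Prod>k<Suc N. 1 - q ^ Suc k / z)" for z
    have "((\<lambda>z. (1 - z) * R z) has_field_derivative (- R 1)) (at 1)"
    proof -
      have "R field_differentiable at 1"
        unfolding R_def
        by (intro field_differentiable_mult field_differentiable_prod derivative_intros) auto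
      then obtain D where D: "(R has_field_derivative D) (at 1)" by (auto simp: field_differentiable_def)
      have "((\<lambda>z. 1 - z) has_field_derivative - 1) (at (1::complex))"
        by (auto intro!: derivative_eq_intros)
      from DERIV_mult[OF this D] show ?thesis by simp
    qed
    moreover have "(\<Prod>k<Suc N. (1 - z * q ^ k) * (1 - q ^ Suc k / z)) = (1 - z) * R z" for z
      unfolding prod.distrib R_def by (subst prod.lessThan_Suc_shift) (simp del: power_Suc)
    hence eq: "(1 - z) * R z = (\<Sum>n\<in>{-int (Suc N)..int (Suc N)}. (-1) powi n * centred_binom q (Suc N) n * q powi tri n * z powi n)"
      if "z \<noteq> 0" for z using finite_jacobi[OF q that, of "Suc N"] by simp
    have "((\<lambda>z. \<Sum>n\<in>{-int (Suc N)..int (Suc N)}. (-1) powi n * centred_binom q (Suc N) n * q powi tri n * z powi n) has_field_derivative S (Suc N)) (at 1)"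
      unfolding S_def a_def
      by (intro DERIV_sum) (auto intro!: derivative_eq_intros)
    hence "((\<lambda>z. (1 - z) * R z) has_field_derivative S (Suc N)) (at 1)"
      by (rule DERIV_cong_ev[THEN iffD1, rotated -1])
         (auto simp: eq intro!: eventually_mono[OF t1_space_nhds[of 1 0]])
    ultimately have "S (Suc N) = - R 1" by (rule DERIV_unique[symmetric])
    thus ?thesis by (simp add: R_def qpoch_def)
  qed
  have "(\<lambda>N. S N * eul q) \<longlonglongrightarrow> infsum a UNIV" by (rule centred_binom_limit(1)[OF q an]) (simp add: S_def)
  hence "(\<lambda>N. S (Suc N) * eul q) \<longlonglongrightarrow> infsum a UNIV" by (subst filterlim_sequentially_Suc)
  moreover have "(\<lambda>N. S (Suc N) * eul q) \<longlonglongrightarrow> - (eul q * eul q) * eul q" unfolding S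
    by (intro tendsto_intros qpoch_LIMSEQ q) (subst filterlim_sequentially_Suc, rule qpoch_LIMSEQ[OF q(1)])
  ultimately have ia: "infsum a UNIV = - (eul q ^ 3)"
    using LIMSEQ_unique by (fastforce simp: power3_eq_cube)
  have "(a has_sum - (eul q ^ 3)) UNIV"
    using ia abs_summable_summable[OF an] has_sum_infsum by metis
  moreover have "((\<lambda>n. (-1) powi n * q powi tri n) has_sum 0) UNIV"
    using z abs_summable_summable[OF sq] has_sum_infsum by metis
  ultimately have "((\<lambda>n. (-1) powi n * q powi tri n + (- 2) * a n) has_sum (0 + (- 2) * (- (eul q ^ 3)))) UNIV"
    by (intro has_sum_add has_sum_cmult_right)
  thus ?thesis by (simp add: a_def algebra_simps)
qed

section \<open>Product and dissection identities for the Euler function\<close>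

lemma minus_one_powi: "(-1) powi k = (if even k then 1 else - 1 :: 'a :: field)"
proof (cases "even k")
  case True
  then obtain j where "k = 2 * j" by auto
  thus ?thesis by (simp add: power_int_mult)
next
  case False
  then obtain j where "k = 2 * j + 1" by (auto elim: oddE)
  thus ?thesis by (simp add: power_int_add power_int_mult)
qed

lemma minus_powi: "(- x) powi k = (if even k then 1 else - 1) * (x :: 'a :: field) powi k"
  using power_int_mult_distrib[of "-1" x k] by (simp add: minus_one_powi split: if_splits)

lemma power_powi: "(x ^ k) powi n = (x :: 'a :: field) powi (int k * n)"
  by (simp only: power_int_mult power_int_of_nat)

lemma power_lt_1: "norm q < 1 \<Longrightarrow> m > 0 \<Longrightarrow> norm (q ^ m :: complex) < 1"
  using power_less_one_iff[of "norm q" m] by (simp add: norm_power)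

definition pent :: "int \<Rightarrow> int" where "pent n = 3 * tri n + n"

lemma pent_eq: "2 * pent n = n * (3 * n - 1)"
  using tri_eq[of n] by (simp add: pent_def algebra_simps)

text \<open>The triple product with q^3 for q and z = q: its three families of factors have the
  exponents congruent to 1, 2 and 0 modulo 3 and together exhaust \<open>eul q\<close>.\<close>

lemma eul_pent:
  fixes q :: complex
  assumes q: "norm q < 1" "q \<noteq> 0"
  shows "((\<lambda>n. (-1) powi n * q powi pent n) has_sum eul q) UNIV"
    and "(\<lambda>n. norm ((-1) powi n * q powi pent n)) summable_on UNIV"
proof -
  have q3: "norm (q ^ 3) < 1" "q ^ 3 \<noteq> 0" by (rule power_lt_1[OF q(1)], simp) (use q(2) in simp)
  have e: "(-1) powi n * (q ^ 3) powi tri n * q powi n = (-1) powi n * q powi pent n" for n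
    using q by (simp add: pent_def power_int_add power_powi)
  have s: "(\<lambda>n. norm ((-1) powi n * q powi pent n)) summable_on UNIV"
    using abs_summable_jacobi[OF q3 q(2)] unfolding e .
  have p: "(\<Prod>k<N. (1 - q * (q ^ 3) ^ k) * (1 - (q ^ 3) ^ Suc k / q) * (1 - (q ^ 3) ^ Suc k)) = qpoch q (3 * N)" for N
  proof (induction N)
    case (Suc N)
    have a: "3 * Suc N = Suc (Suc (Suc (3 * N)))" by simp
    have "q ^ Suc (3 * N) = q * (q ^ 3) ^ N" by (simp add: power_mult)
    moreover have "q ^ Suc (Suc (3 * N)) = (q ^ 3) ^ Suc N / q"
      using q(2) by (simp add: power_mult power3_eq_cube)
    moreover have "q ^ Suc (Suc (Suc (3 * N))) = (q ^ 3) ^ Suc N"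
      by (simp add: power_mult power3_eq_cube)
    ultimately show ?case using Suc.IH unfolding a qpoch_Suc prod.lessThan_Suc by (simp only: mult_ac)
  qed simp
  have "(\<lambda>N. qpoch q (3 * N)) \<longlonglongrightarrow> (\<Sum>\<^sub>\<infinity>n. (-1) powi n * q powi pent n)"
    using jacobi_triple[OF q3 q(2)] unfolding e p .
  moreover have "(\<lambda>N. qpoch q (3 * N)) \<longlonglongrightarrow> eul q"
    by (rule filterlim_compose[OF qpoch_LIMSEQ[OF q(1)]]) (auto intro!: filterlim_subseq simp: strict_mono_def)
  ultimately have "(\<Sum>\<^sub>\<infinity>n. (-1) powi n * q powi pent n) = eul q" by (rule LIMSEQ_unique)
  thus "((\<lambda>n. (-1) powi n * q powi pent n) has_sum eul q) UNIV"
    using has_sum_infsum[OF abs_summable_summable[OF s]] by simp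
  show "(\<lambda>n. norm ((-1) powi n * q powi pent n)) summable_on UNIV" by (rule s)
qed

section \<open>The theta series phi and psi as products\<close>

definition phi :: "complex \<Rightarrow> complex" where "phi q = (\<Sum>\<^sub>\<infinity>n. q powi (n * n))"
text \<open>Twice Ramanujan's \<open>\<psi>\<close>, since the sum runs over all integers.\<close>

definition psi2 :: "complex \<Rightarrow> complex" where "psi2 q = (\<Sum>\<^sub>\<infinity>n. q powi tri n)"

lemma powi_square:
  assumes "q \<noteq> (0::complex)"
  shows "q powi (n * n) = (q\<^sup>2) powi tri n * q powi n"
proof -
  have "n * n = 2 * tri n + n" unfolding tri_eq by (simp add: algebra_simps)
  thus ?thesis using assms by (simp add: power_int_add power_powi)
qed

lemma phi_abs_summable:
  fixes q :: complex
  assumes q: "norm q < 1" "q \<noteq> 0"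
  shows "(\<lambda>n. norm (q powi (n * n))) summable_on UNIV"
proof -
  have q2: "norm (q\<^sup>2) < 1" "q\<^sup>2 \<noteq> 0" by (rule power_lt_1[OF q(1)], simp) (use q(2) in simp)
  have "norm ((-1) powi n * (q\<^sup>2) powi tri n * q powi n) = norm (q powi (n * n))" for n
    unfolding powi_square[OF q(2)] by (simp add: norm_mult norm_powi)
  thus ?thesis using abs_summable_jacobi[OF q2 q(2)] by simp
qed

lemma phi_has_sum: "norm q < 1 \<Longrightarrow> q \<noteq> 0 \<Longrightarrow> ((\<lambda>n. q powi (n * n)) has_sum phi q) UNIV"
  unfolding phi_def by (rule has_sum_infsum[OF abs_summable_summable[OF phi_abs_summable]])

lemma psi2_abs_summable:
  "norm (q::complex) < 1 \<Longrightarrow> q \<noteq> 0 \<Longrightarrow> (\<lambda>n. norm (q powi tri n)) summable_on UNIV"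
  using abs_summable_jacobi[of q 1] by (simp add: norm_mult norm_powi)

lemma psi2_has_sum: "norm q < 1 \<Longrightarrow> q \<noteq> 0 \<Longrightarrow> ((\<lambda>n. q powi tri n) has_sum psi2 q) UNIV"
  unfolding psi2_def by (rule has_sum_infsum[OF abs_summable_summable[OF psi2_abs_summable]])

text \<open>Gauss's product for phi(-q). In the triple product with q^2 and z = q both families
  containing z run over the odd exponents; a second copy of the even ones completes the square of
  the full product.\<close>

lemma phi_minus_eul:
  fixes q :: complex
  assumes q: "norm q < 1" "q \<noteq> 0"
  shows "phi (- q) * eul (q\<^sup>2) = eul q ^ 2"
proof -
  have q2: "norm (q\<^sup>2) < 1" "q\<^sup>2 \<noteq> 0" by (rule power_lt_1[OF q(1)], simp) (use q(2) in simp)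
  have e: "(-1) powi n * (q\<^sup>2) powi tri n * q powi n = (- q) powi (n * n)" for n
    using powi_square[OF q(2), of n] by (simp add: minus_one_powi minus_powi[of q])
  define P where "P N = (\<Prod>k<N. (1 - q * (q\<^sup>2) ^ k) * (1 - (q\<^sup>2) ^ Suc k / q) * (1 - (q\<^sup>2) ^ Suc k))" for N
  have p: "P N * qpoch (q\<^sup>2) N = qpoch q (2 * N) ^ 2" for N
  proof (induction N)
    case (Suc N)
    have a: "2 * Suc N = Suc (Suc (2 * N))" by simp
    define x where "x = q ^ Suc (2 * N)"
    define y where "y = q ^ Suc (Suc (2 * N))"
    have "q * (q\<^sup>2) ^ N = x" by (simp add: x_def power_mult)
    moreover have "(q\<^sup>2) ^ Suc N / q = x" using q by (simp add: x_def power_mult power2_eq_square)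
    moreover have "(q\<^sup>2) ^ Suc N = y" by (simp add: y_def power_mult power2_eq_square)
    ultimately have "P (Suc N) * qpoch (q\<^sup>2) (Suc N) = (P N * qpoch (q\<^sup>2) N) * ((1 - x) * (1 - y))\<^sup>2"
      unfolding P_def qpoch_Suc prod.lessThan_Suc by (simp only: power2_eq_square mult_ac)
    thus ?case unfolding Suc.IH a qpoch_Suc x_def[symmetric] y_def[symmetric]
      by (simp only: power2_eq_square mult_ac)
  qed (simp add: P_def)
  have "(\<lambda>N. P N * qpoch (q\<^sup>2) N) \<longlonglongrightarrow> phi (- q) * eul (q\<^sup>2)"
    using tendsto_mult[OF jacobi_triple[OF q2 q(2)] qpoch_LIMSEQ[OF q2(1)]] unfolding e phi_def P_def .
  moreover have "(\<lambda>N. qpoch q (2 * N) ^ 2) \<longlonglongrightarrow> eul q ^ 2"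
    by (intro tendsto_intros filterlim_compose[OF qpoch_LIMSEQ[OF q(1)]])
       (auto intro!: filterlim_subseq simp: strict_mono_def)
  ultimately show ?thesis unfolding p by (rule LIMSEQ_unique)
qed

lemma psi2_eul:
  assumes q: "norm q < 1" "q \<noteq> 0"
  shows "psi2 q * eul q = 2 * eul (q\<^sup>2) ^ 2"
proof -
  have q2: "norm (q\<^sup>2) < 1" "q\<^sup>2 \<noteq> 0" by (rule power_lt_1[OF q(1)], simp) (use q(2) in simp)
  have e: "(-1) powi n * q powi tri n * (-1) powi n = q powi tri n" for n
    by (simp add: minus_one_powi)
  define P where "P N = (\<Prod>k<N. (1 - (-1) * q ^ k) * (1 - q ^ Suc k / (-1)) * (1 - q ^ Suc k))" for N
  \<comment> \<open>At z = -1 the first family starts with 1 + q^0 = 2 and stops before 1 + q^N.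
    Supplying that factor, which tends to 1, makes the identity exact for every
    \<open>N\<close>.\<close>
  have p: "P N * qpoch q N * (1 + q ^ N) = 2 * qpoch (q\<^sup>2) N ^ 2" for N
  proof (induction N)
    case (Suc N)
    have a: "(q\<^sup>2) ^ Suc N = q ^ Suc N * q ^ Suc N" by (simp add: power2_eq_square power_mult_distrib)
    have "P (Suc N) * qpoch q (Suc N) * (1 + q ^ Suc N) =
          (P N * qpoch q N * (1 + q ^ N)) * ((1 + q ^ Suc N) * (1 - q ^ Suc N)) ^ 2"
      unfolding P_def qpoch_Suc prod.lessThan_Suc by (simp add: power2_eq_square mult_ac del: power_Suc)
    also have "(1 + q ^ Suc N) * (1 - q ^ Suc N) = 1 - q ^ Suc N * q ^ Suc N"
      by (simp add: algebra_simps del: power_Suc)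
    also have "(P N * qpoch q N * (1 + q ^ N)) * (1 - q ^ Suc N * q ^ Suc N) ^ 2 = 2 * qpoch (q\<^sup>2) (Suc N) ^ 2"
      unfolding Suc.IH qpoch_Suc a power_mult_distrib by (simp only: mult.assoc)
    finally show ?case .
  qed (simp add: P_def)
  have "(\<lambda>N. P N * qpoch q N * (1 + q ^ N)) \<longlonglongrightarrow> psi2 q * eul q * (1 + 0)"
    using jacobi_triple[OF q, of "-1"] unfolding P_def psi2_def e
    by (intro tendsto_mult tendsto_add qpoch_LIMSEQ q LIMSEQ_power_zero tendsto_const) auto
  moreover have "(\<lambda>N. 2 * qpoch (q\<^sup>2) N ^ 2) \<longlonglongrightarrow> 2 * eul (q\<^sup>2) ^ 2"
    by (intro tendsto_intros qpoch_LIMSEQ q2)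
  ultimately show ?thesis unfolding p by (metis LIMSEQ_unique add_0_right mult_1_right)
qed

text \<open>For odd exponents the factors of \<open>eul q\<close> and \<open>eul (- q)\<close>
  combine as (1 - x) (1 + x) = 1 - x^2; for even ones they coincide. This is Weber's relation f f1
  f2 = sqrt 2 as a q-series identity.\<close>

lemma eul_minus:
  fixes q :: complex
  assumes q: "norm q < 1"
  shows "eul q * eul (- q) * eul (q ^ 4) = eul (q\<^sup>2) ^ 3"
proof -
  have p: "qpoch q (2 * N) * qpoch (- q) (2 * N) * qpoch (q ^ 4) N = qpoch (q\<^sup>2) (2 * N) * qpoch (q\<^sup>2) N ^ 2" for N
  proof (induction N)
    case (Suc N)
    have a: "2 * Suc N = Suc (Suc (2 * N))" by simp
    define x where "x = q ^ Suc (2 * N)"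
    define y where "y = q ^ Suc (Suc (2 * N))"
    have "(- q) ^ Suc (2 * N) = - x" "(- q) ^ Suc (Suc (2 * N)) = y" by (simp_all add: x_def y_def)
    moreover have "(q ^ 4) ^ Suc N = y * y" "(q\<^sup>2) ^ Suc (2 * N) = x * x" "(q\<^sup>2) ^ Suc (Suc (2 * N)) = y * y"
      "(q\<^sup>2) ^ Suc N = y"
      unfolding x_def y_def power_mult[symmetric] power_add[symmetric]
      by (rule arg_cong[of _ _ "\<lambda>n. q ^ n"], simp)+
    ultimately have "qpoch q (2 * Suc N) * qpoch (- q) (2 * Suc N) * qpoch (q ^ 4) (Suc N) =
       (qpoch q (2 * N) * qpoch (- q) (2 * N) * qpoch (q ^ 4) N) * ((1 - x) * (1 + x) * (1 - y) ^ 2 * (1 - y * y))"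
      "qpoch (q\<^sup>2) (2 * Suc N) * qpoch (q\<^sup>2) (Suc N) ^ 2 = (qpoch (q\<^sup>2) (2 * N) * qpoch (q\<^sup>2) N ^ 2) * ((1 - x * x) * (1 - y * y) * (1 - y) ^ 2)"
      unfolding a qpoch_Suc x_def[symmetric] y_def[symmetric] by (simp_all add: power2_eq_square mult_ac)
    moreover have "(1 - x) * (1 + x) * (1 - y) ^ 2 * (1 - y * y) = (1 - x * x) * (1 - y * y) * (1 - y) ^ 2"
      by (simp add: algebra_simps)
    ultimately show ?case using Suc.IH by simp
  qed simp
  have "(\<lambda>N. qpoch q (2 * N) * qpoch (- q) (2 * N) * qpoch (q ^ 4) N) \<longlonglongrightarrow> eul q * eul (- q) * eul (q ^ 4)"
    using q by (intro tendsto_intros qpoch_LIMSEQ filterlim_compose[OF qpoch_LIMSEQ] power_lt_1)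
               (auto intro!: filterlim_subseq simp: strict_mono_def)
  moreover have "(\<lambda>N. qpoch (q\<^sup>2) (2 * N) * qpoch (q\<^sup>2) N ^ 2) \<longlonglongrightarrow> eul (q\<^sup>2) * eul (q\<^sup>2) ^ 2"
    using q by (intro tendsto_intros qpoch_LIMSEQ filterlim_compose[OF qpoch_LIMSEQ] power_lt_1)
               (auto intro!: filterlim_subseq simp: strict_mono_def)
  ultimately have "eul q * eul (- q) * eul (q ^ 4) = eul (q\<^sup>2) * eul (q\<^sup>2) ^ 2"
    unfolding p by (rule LIMSEQ_unique)
  thus ?thesis by (simp add: power2_eq_square power3_eq_cube)
qed

section \<open>Products over the cube roots of unity\<close>

definition omega3 :: complex where "omega3 = cis (2 * pi / 3)"

lemma omega3: "omega3 ^ 3 = 1" "1 + omega3 + omega3\<^sup>2 = 0" "norm omega3 = 1"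
proof -
  show c: "omega3 ^ 3 = 1" unfolding omega3_def Complex.DeMoivre by simp
  have "omega3 \<noteq> 1" 
  proof
    assume "omega3 = 1"
    hence "cos (2 * pi / 3) = 1" by (simp add: omega3_def complex_eq_iff)
    thus False by (simp add: cos_120)
  qed
  moreover have "(omega3 - 1) * (1 + omega3 + omega3\<^sup>2) = omega3 ^ 3 - 1"
    by (simp add: algebra_simps power2_eq_square power3_eq_cube)
  ultimately show "1 + omega3 + omega3\<^sup>2 = 0" using c by simp
  show "norm omega3 = 1" by (simp add: omega3_def)
qed

text \<open>Over the three cube roots the factors with exponent prime to 3 multiply to 1 - x^3.
  Exponents divisible by 3 give plain cubes, and \<open>eul (q ^ 9)\<close> supplies the factors of
  \<open>eul (q ^ 3)\<close> still missing.\<close>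

lemma eul_cubic_product:
  fixes q :: complex
  assumes q: "norm q < 1"
  shows "eul q * eul (omega3 * q) * eul (omega3\<^sup>2 * q) * eul (q ^ 9) = eul (q ^ 3) ^ 4"
proof -
  have cub: "(1 - x) * (1 - omega3 * x) * (1 - omega3\<^sup>2 * x) = 1 - x ^ 3" for x
  proof -
    have "(1 - x) * (1 - omega3 * x) * (1 - omega3\<^sup>2 * x) =
          1 - (1 + omega3 + omega3\<^sup>2) * x + omega3 * (1 + omega3 + omega3\<^sup>2) * x\<^sup>2 - omega3 ^ 3 * x ^ 3"
      by (simp add: algebra_simps power2_eq_square power3_eq_cube)
    thus ?thesis unfolding omega3 by simp
  qed
  have p: "qpoch q (3 * N) * qpoch (omega3 * q) (3 * N) * qpoch (omega3\<^sup>2 * q) (3 * N) * qpoch (q ^ 9) N = qpoch (q ^ 3) (3 * N) * qpoch (q ^ 3) N ^ 3" for N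
  proof (induction N)
    case (Suc N)
    have a: "3 * Suc N = Suc (Suc (Suc (3 * N)))" by simp
    define x where "x = q ^ Suc (3 * N)"
    define y where "y = q ^ Suc (Suc (3 * N))"
    define z where "z = q ^ Suc (Suc (Suc (3 * N)))"
    have w: "omega3 ^ (3 * N) = 1" by (simp add: power_mult omega3)
    have w2: "(omega3\<^sup>2) ^ (3 * N) = 1" using w by (metis power_mult mult.commute power_one)
    have w4: "omega3 ^ 4 = omega3" using omega3(1) by (simp add: eval_nat_numeral)
    have w': "omega3 ^ Suc (3 * N) = omega3" "omega3 ^ Suc (Suc (3 * N)) = omega3\<^sup>2" "omega3 ^ Suc (Suc (Suc (3 * N))) = 1"
      "(omega3\<^sup>2) ^ Suc (3 * N) = omega3\<^sup>2" "(omega3\<^sup>2) ^ Suc (Suc (3 * N)) = omega3" "(omega3\<^sup>2) ^ Suc (Suc (Suc (3 * N))) = 1"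
      using w w2 omega3(1) w4 by (simp_all add: power2_eq_square eval_nat_numeral mult.assoc)
    have e: "(omega3 * q) ^ Suc (3 * N) = omega3 * x" "(omega3 * q) ^ Suc (Suc (3 * N)) = omega3\<^sup>2 * y" "(omega3 * q) ^ Suc (Suc (Suc (3 * N))) = z"
      "(omega3\<^sup>2 * q) ^ Suc (3 * N) = omega3\<^sup>2 * x" "(omega3\<^sup>2 * q) ^ Suc (Suc (3 * N)) = omega3 * y" "(omega3\<^sup>2 * q) ^ Suc (Suc (Suc (3 * N))) = z"
      unfolding power_mult_distrib w' x_def y_def z_def by simp_all
    have "(q ^ 9) ^ Suc N = z ^ 3" "(q ^ 3) ^ Suc (3 * N) = x ^ 3" "(q ^ 3) ^ Suc (Suc (3 * N)) = y ^ 3"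
      "(q ^ 3) ^ Suc (Suc (Suc (3 * N))) = z ^ 3" "(q ^ 3) ^ Suc N = z"
      unfolding x_def y_def z_def power_mult[symmetric]
      by (rule arg_cong[of _ _ "\<lambda>n. q ^ n"], simp)+
    hence s: "qpoch q (3 * Suc N) = qpoch q (3 * N) * ((1 - x) * (1 - y) * (1 - z))"
      "qpoch (omega3 * q) (3 * Suc N) = qpoch (omega3 * q) (3 * N) * ((1 - omega3 * x) * (1 - omega3\<^sup>2 * y) * (1 - z))"
      "qpoch (omega3\<^sup>2 * q) (3 * Suc N) = qpoch (omega3\<^sup>2 * q) (3 * N) * ((1 - omega3\<^sup>2 * x) * (1 - omega3 * y) * (1 - z))"
      "qpoch (q ^ 9) (Suc N) = qpoch (q ^ 9) N * (1 - z ^ 3)"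
      "qpoch (q ^ 3) (3 * Suc N) = qpoch (q ^ 3) (3 * N) * ((1 - x ^ 3) * (1 - y ^ 3) * (1 - z ^ 3))"
      "qpoch (q ^ 3) (Suc N) = qpoch (q ^ 3) N * (1 - z)"
      unfolding a qpoch_Suc e by (simp_all only: x_def[symmetric] y_def[symmetric] z_def[symmetric] mult.assoc)
    have "qpoch q (3 * Suc N) * qpoch (omega3 * q) (3 * Suc N) * qpoch (omega3\<^sup>2 * q) (3 * Suc N) * qpoch (q ^ 9) (Suc N) =
       (qpoch q (3 * N) * qpoch (omega3 * q) (3 * N) * qpoch (omega3\<^sup>2 * q) (3 * N) * qpoch (q ^ 9) N) *
         (((1 - x) * (1 - omega3 * x) * (1 - omega3\<^sup>2 * x)) * ((1 - y) * (1 - omega3 * y) * (1 - omega3\<^sup>2 * y)) * (1 - z) ^ 3 * (1 - z ^ 3))"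
      unfolding s power3_eq_cube by (simp only: mult_ac)
    moreover have "qpoch (q ^ 3) (3 * Suc N) * qpoch (q ^ 3) (Suc N) ^ 3 =
       (qpoch (q ^ 3) (3 * N) * qpoch (q ^ 3) N ^ 3) * ((1 - x ^ 3) * (1 - y ^ 3) * (1 - z) ^ 3 * (1 - z ^ 3))"
      unfolding s power_mult_distrib by (simp only: mult_ac)
    ultimately show ?case using Suc.IH unfolding cub by (simp only:)
  qed simp
  have n: "norm (omega3 * q) < 1" "norm (omega3\<^sup>2 * q) < 1" using q omega3(3) by (simp_all add: norm_mult norm_power)
  have "(\<lambda>N. qpoch q (3 * N) * qpoch (omega3 * q) (3 * N) * qpoch (omega3\<^sup>2 * q) (3 * N) * qpoch (q ^ 9) N) \<longlonglongrightarrow>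
        eul q * eul (omega3 * q) * eul (omega3\<^sup>2 * q) * eul (q ^ 9)"
    using q n by (intro tendsto_intros qpoch_LIMSEQ filterlim_compose[OF qpoch_LIMSEQ] power_lt_1)
               (auto intro!: filterlim_subseq simp: strict_mono_def)
  moreover have "(\<lambda>N. qpoch (q ^ 3) (3 * N) * qpoch (q ^ 3) N ^ 3) \<longlonglongrightarrow> eul (q ^ 3) * eul (q ^ 3) ^ 3"
    using q by (intro tendsto_intros qpoch_LIMSEQ filterlim_compose[OF qpoch_LIMSEQ] power_lt_1)
               (auto intro!: filterlim_subseq simp: strict_mono_def)
  ultimately have "eul q * eul (omega3 * q) * eul (omega3\<^sup>2 * q) * eul (q ^ 9) = eul (q ^ 3) * eul (q ^ 3) ^ 3"
    unfolding p by (rule LIMSEQ_unique)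
  thus ?thesis by (simp add: eval_nat_numeral)
qed

text \<open>The terms of Jacobi's series with n = 3 j - 1 have exponent 9 tri(j) + 1 and weight 3 (1
  - 2 j), so they form -3 q times the series at q^9. The remaining exponents are divisible by
  3.\<close>

lemma eul_cube_dissect:
  fixes q :: complex
  assumes q: "norm q < 1" "q \<noteq> 0"
  shows "((\<lambda>n. (-1) powi n * of_int (1 - 2 * n) * q powi tri n) has_sum 2 * (eul q ^ 3 + 3 * q * eul (q ^ 9) ^ 3)) {n. n mod 3 \<noteq> 2}"
proof -
  have q9: "norm (q ^ 9) < 1" "q ^ 9 \<noteq> 0" by (rule power_lt_1[OF q(1)], simp) (use q(2) in simp)
  define c where "c n = (-1) powi n * of_int (1 - 2 * n) * q powi tri n" for n
  have "((\<lambda>n. (- 3 * q) * ((-1) powi n * of_int (1 - 2 * n) * (q ^ 9) powi tri n)) has_sum (- 3 * q) * (2 * eul (q ^ 9) ^ 3)) UNIV"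
    by (intro has_sum_cmult_right jacobi_cube q9)
  also have "?this \<longleftrightarrow> (c has_sum (- 3 * q) * (2 * eul (q ^ 9) ^ 3)) {n. n mod 3 = 2}"
  proof (rule has_sum_reindex_bij_witness[of _ "\<lambda>n. (n + 1) div 3" "\<lambda>j. 3 * j - 1"])
    fix j :: int
    have "tri (3 * j - 1) = 9 * tri j + 1"
      by (rule tri_eqI) (use tri_eq[of j] in \<open>simp add: algebra_simps\<close>)
    hence "q powi tri (3 * j - 1) = (q ^ 9) powi tri j * q"
      using q by (simp add: power_int_add power_powi)
    thus "c (3 * j - 1) = (- 3 * q) * ((-1) powi j * of_int (1 - 2 * j) * (q ^ 9) powi tri j)"
      unfolding c_def by (simp add: minus_one_powi algebra_simps)
  qed (auto, presburger+)
  finally have 1: "(c has_sum (- 3 * q) * (2 * eul (q ^ 9) ^ 3)) {n. n mod 3 = 2}" .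
  have 2: "(c has_sum 2 * eul q ^ 3) UNIV" unfolding c_def by (rule jacobi_cube[OF q])
  have s: "c summable_on {n. n mod 3 \<noteq> 2}"
    by (rule summable_on_subset_banach[OF has_sum_imp_summable[OF 2]]) auto
  have "(c has_sum ((- 3 * q) * (2 * eul (q ^ 9) ^ 3) + infsum c {n. n mod 3 \<noteq> 2})) ({n. n mod 3 = 2} \<union> {n. n mod 3 \<noteq> 2})"
    by (intro has_sum_Un_disjoint 1 has_sum_infsum s) auto
  also have "{n. n mod 3 = 2} \<union> {n. n mod 3 \<noteq> 2} = (UNIV :: int set)" by auto
  finally have "(- 3 * q) * (2 * eul (q ^ 9) ^ 3) + infsum c {n. n mod 3 \<noteq> 2} = 2 * eul q ^ 3"
    using 2 by (rule has_sum_unique)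
  hence "infsum c {n. n mod 3 \<noteq> 2} = 2 * (eul q ^ 3 + 3 * q * eul (q ^ 9) ^ 3)"
    by (simp add: algebra_simps)
  thus ?thesis using has_sum_infsum[OF s] unfolding c_def by simp
qed

text \<open>The first bracket on the right is invariant under \<open>q \<mapsto> omega3 * q\<close> by the dissection above.\<close>

lemma eul_level9:
  fixes q :: complex
  assumes q: "norm q < 1" "q \<noteq> 0"
  shows "eul (q ^ 3) ^ 12 = eul (q ^ 9) ^ 3 * ((eul q ^ 3 + 3 * q * eul (q ^ 9) ^ 3) ^ 3 - 27 * q ^ 3 * eul (q ^ 9) ^ 9)"
proof -
  define A where "A q = eul q ^ 3 + 3 * q * eul (q ^ 9) ^ 3" for q
  have w0: "omega3 \<noteq> 0" using omega3(1) by auto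
  have inv: "A (w * q) = A q" if w: "w ^ 3 = 1" "norm w = 1" for w
  proof -
    have wq: "norm (w * q) < 1" "w * q \<noteq> 0" using q w by (auto simp: norm_mult)
    have "(w * q) powi tri n = q powi tri n" if "n mod 3 \<noteq> 2" for n
    proof -
      have "n mod 3 = 0 \<or> n mod 3 = 1" using that by presburger
      hence "3 dvd n \<or> 3 dvd (n - 1)" by presburger
      hence "3 dvd 2 * tri n" unfolding tri_eq by auto
      hence "3 dvd tri n" by presburger
      then obtain k where "tri n = 3 * k" by auto
      thus ?thesis using w(1) by (simp add: power_int_mult power_mult_distrib)
    qed
    hence "((\<lambda>n. (-1) powi n * of_int (1 - 2 * n) * q powi tri n) has_sum 2 * A (w * q)) {n. n mod 3 \<noteq> 2}"
      using eul_cube_dissect[OF wq] unfolding A_def by (subst has_sum_cong) auto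
    hence "2 * A (w * q) = 2 * A q" using eul_cube_dissect[OF q] unfolding A_def by (rule has_sum_unique)
    thus ?thesis by simp
  qed
  have w9: "omega3 ^ 9 = 1" "omega3 ^ 18 = 1" using omega3(1) power_mult[of omega3 3 3] power_mult[of omega3 3 6] by simp_all
  define B where "B = eul (q ^ 9) ^ 3"
  have w2: "(omega3\<^sup>2) ^ 3 = 1" using omega3(1) power_mult[of omega3 3 2] power_mult[of omega3 2 3] by simp
  have e0: "eul q ^ 3 = A q - 3 * q * B" by (simp add: A_def B_def)
  have e1: "eul (omega3 * q) ^ 3 = A q - 3 * omega3 * q * B"
    using inv[OF omega3(1,3)] unfolding A_def[of "omega3 * q"] by (simp add: B_def power_mult_distrib w9 algebra_simps)
  have e2: "eul (omega3\<^sup>2 * q) ^ 3 = A q - 3 * omega3\<^sup>2 * q * B"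
    using inv[OF w2] omega3(3) unfolding A_def[of "omega3\<^sup>2 * q"]
    by (simp add: B_def power_mult_distrib w9 algebra_simps norm_power flip: power_mult)
  have "eul (q ^ 3) ^ 12 = (eul q * eul (omega3 * q) * eul (omega3\<^sup>2 * q) * eul (q ^ 9)) ^ 3"
    unfolding eul_cubic_product[OF q(1)] by (simp flip: power_mult)
  also have "\<dots> = B * (eul q ^ 3 * eul (omega3 * q) ^ 3 * eul (omega3\<^sup>2 * q) ^ 3)"
    by (simp add: power_mult_distrib B_def)
  \<comment> \<open>The product of A - 3 w q B over the cube roots w of 1; both middle coefficients
    contain 1 + omega3 + omega3^2 and vanish.\<close>
  also have "\<dots> = B * (A q ^ 3 - (1 + omega3 + omega3\<^sup>2) * 3 * q * B * A q ^ 2 + omega3 * (1 + omega3 + omega3\<^sup>2) * 9 * q\<^sup>2 * B\<^sup>2 * A q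
                     - omega3 ^ 3 * 27 * q ^ 3 * B ^ 3)"
    unfolding e0 e1 e2 by (simp add: algebra_simps power2_eq_square power3_eq_cube)
  also have "\<dots> = B * (A q ^ 3 - 27 * q ^ 3 * B ^ 3)" unfolding omega3 by simp
  finally show ?thesis unfolding A_def B_def by (simp flip: power_mult)
qed

section \<open>Theta functions of binary quadratic forms\<close>

lemma has_sum_lattice_product:
  fixes f g :: "int \<Rightarrow> complex"
  assumes f: "(f has_sum F) UNIV" "(\<lambda>n. norm (f n)) summable_on UNIV"
    and g: "(g has_sum G) UNIV" "(\<lambda>n. norm (g n)) summable_on UNIV"
  shows "((\<lambda>(x, y). f x * g y) has_sum F * G) UNIV"
proof -
  have "(\<lambda>p. norm (case p of (x, y) \<Rightarrow> f x * g y)) summable_on UNIV \<times> UNIV"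
    by (rule Infinite_Sum.abs_summable_on_Sigma_iff[THEN iffD2])
       (use f(2) g(2) in \<open>auto simp: norm_mult infsum_cmult_right' abs_mult infsum_nonneg
              intro!: summable_on_cmult_right summable_on_cmult_left\<close>)
  hence s: "(\<lambda>(x, y). f x * g y) summable_on UNIV \<times> UNIV" by (rule abs_summable_summable)
  have "((\<lambda>(x, y). f x * g y) has_sum F * G) (UNIV \<times> UNIV)"
    by (rule has_sum_SigmaI[where g = "\<lambda>x. f x * G"])
       (use s f g in \<open>auto intro!: has_sum_cmult_right has_sum_cmult_left\<close>)
  thus ?thesis by simp
qed

text \<open>Each residue class of a linear form is parametrised by all integer pairs, so that
  comparing classes becomes an affine bijection of the full lattice.\<close>

lemma infsum_congruence_class:
  fixes F :: "int \<times> int \<Rightarrow> complex"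
  assumes "0 \<le> r" "r < M"
  shows "infsum F {(m, n). (m + c * n) mod M = r} = infsum (\<lambda>(k, n). F (r + M * k - c * n, n)) UNIV"
proof (rule infsum_reindex_bij_witness[of _ "\<lambda>(k, n). (r + M * k - c * n, n)" "\<lambda>(m, n). ((m + c * n) div M, n)"], goal_cases)
  case (1 p)
  thus ?case using mult_div_mod_eq[of M "fst p + c * snd p"] by (auto simp: algebra_simps)
next
  case (5 p)
  thus ?case using mult_div_mod_eq[of M "fst p + c * snd p"] by (auto simp: algebra_simps)
qed (use assms in auto)

lemma phi_dissect:
  assumes q: "norm q < 1" "q \<noteq> (0::complex)"
  shows "phi q = phi (q ^ 4) + q * psi2 (q ^ 8)"
proof -
  have q4: "norm (q ^ 4) < 1" "q ^ 4 \<noteq> 0" by (rule power_lt_1[OF q(1)], simp) (use q(2) in simp)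
  have q8: "norm (q ^ 8) < 1" "q ^ 8 \<noteq> 0" by (rule power_lt_1[OF q(1)], simp) (use q(2) in simp)
  have "((\<lambda>m. q powi (m * m)) has_sum phi (q ^ 4)) {n. even n} \<longleftrightarrow> ((\<lambda>n. (q ^ 4) powi (n * n)) has_sum phi (q ^ 4)) UNIV"
    by (rule has_sum_reindex_bij_witness[of _ "\<lambda>n. 2 * n" "\<lambda>n. n div 2"]) (auto simp: power_powi)
  hence 1: "((\<lambda>m. q powi (m * m)) has_sum phi (q ^ 4)) {n. even n}" using phi_has_sum[OF q4] by simp
  have "((\<lambda>m. q powi (m * m)) has_sum q * psi2 (q ^ 8)) {n. odd n} \<longleftrightarrow> ((\<lambda>n. q * (q ^ 8) powi tri n) has_sum q * psi2 (q ^ 8)) UNIV"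
  proof (rule has_sum_reindex_bij_witness[of _ "\<lambda>n. 2 * n - 1" "\<lambda>n. (n + 1) div 2"])
    fix n :: int assume "n \<in> {n. odd n}"
    then obtain k where k: "n = 2 * k + 1" by (auto elim: oddE)
    have "n * n = 1 + 8 * tri (k + 1)" using tri_eq[of "k + 1"] by (simp add: k algebra_simps)
    thus "q * (q ^ 8) powi tri ((n + 1) div 2) = q powi (n * n)"
      using q by (simp add: k power_powi power_int_add add.commute[of 1 k])
  qed (auto; presburger)+
  hence 2: "((\<lambda>m. q powi (m * m)) has_sum q * psi2 (q ^ 8)) {n. odd n}"
    using has_sum_cmult_right[OF psi2_has_sum[OF q8], of q] by simp
  have "((\<lambda>m. q powi (m * m)) has_sum (phi (q ^ 4) + q * psi2 (q ^ 8))) ({n. even n} \<union> {n. odd n})"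
    by (rule has_sum_Un_disjoint[OF 1 2]) auto
  also have "{n. even n} \<union> {n. odd n} = (UNIV :: int set)" by auto
  finally show ?thesis using phi_has_sum[OF q] by (rule has_sum_unique[symmetric])
qed

text \<open>On the left the points with x + y odd cancel. On the others x = a + b and y = a - b give
  x^2 + y^2 = 2 (a^2 + b^2).\<close>

lemma phi_parallelogram:
  assumes q: "norm q < 1" "q \<noteq> (0::complex)"
  shows "phi q ^ 2 + phi (- q) ^ 2 = 2 * phi (q\<^sup>2) ^ 2"
proof -
  have q2: "norm (q\<^sup>2) < 1" "q\<^sup>2 \<noteq> 0" by (rule power_lt_1[OF q(1)], simp) (use q(2) in simp)
  have mq: "norm (- q) < 1" "- q \<noteq> 0" using q by auto
  let ?F = "\<lambda>(x, y). q powi (x * x) * q powi (y * y)"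
  have "((\<lambda>p. ?F p + (case p of (x, y) \<Rightarrow> (- q) powi (x * x) * (- q) powi (y * y)))
          has_sum (phi q * phi q + phi (- q) * phi (- q))) UNIV"
    by (intro has_sum_add has_sum_lattice_product phi_has_sum phi_abs_summable q mq)
  also have "?this \<longleftrightarrow> ((\<lambda>p. 2 * ?F p) has_sum (phi q * phi q + phi (- q) * phi (- q))) {(x, y). even (x + y)}"
    by (rule has_sum_cong_neutral) (auto simp: minus_powi[of q] split: if_splits)
  also have "\<dots> \<longleftrightarrow> ((\<lambda>p. 2 * (case p of (a, b) \<Rightarrow> (q\<^sup>2) powi (a * a) * (q\<^sup>2) powi (b * b)))
       has_sum (phi q * phi q + phi (- q) * phi (- q))) UNIV"
  proof (rule has_sum_reindex_bij_witness[of _ "\<lambda>(a, b). (a + b, a - b)" "\<lambda>(x, y). ((x + y) div 2, (x - y) div 2)"], goal_cases)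
    case (5 p)
    obtain x y where p1: "p = (x, y)" by (cases p)
    with 5 have "even (x + y)" by simp
    then obtain k where p: "x + y = 2 * k" by (elim evenE)
    note p = p1 p
    hence x: "x = 2 * k - y" by simp
    have "x * x + y * y = 2 * (k * k) + 2 * ((k - y) * (k - y))" by (simp add: x algebra_simps)
    hence "q powi (x * x) * q powi (y * y) = (q\<^sup>2) powi (k * k) * (q\<^sup>2) powi ((k - y) * (k - y))"
      using q by (simp add: power_powi power_int_add[symmetric])
    moreover have "(x + y) div 2 = k" "(x - y) div 2 = k - y" by (auto simp: x)
    ultimately show ?case by (simp add: p)
  qed (auto; presburger)+
  finally have 1: "((\<lambda>p. 2 * (case p of (a, b) \<Rightarrow> (q\<^sup>2) powi (a * a) * (q\<^sup>2) powi (b * b)))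
       has_sum (phi q * phi q + phi (- q) * phi (- q))) UNIV" .
  have "((\<lambda>p. 2 * (case p of (a, b) \<Rightarrow> (q\<^sup>2) powi (a * a) * (q\<^sup>2) powi (b * b)))
       has_sum (2 * (phi (q\<^sup>2) * phi (q\<^sup>2)))) UNIV"
    by (intro has_sum_cmult_right has_sum_lattice_product phi_has_sum phi_abs_summable q2)
  from has_sum_unique[OF 1 this] show ?thesis by (simp add: power2_eq_square)
qed

text \<open>The left side is twice the sum of q^(x^2 + 3 y^2) over x + y odd. The exponents on the
  right are ((2 m - 1)^2 + 3 (2 n - 1)^2) / 4. Multiplying (2 m - 1 + (2 n - 1) sqrt(-3)) / 2 by the
  sixth root of unity (1 - sqrt(-3)) / 2 and conjugating carries the points with m + n even onto
  those with x + y odd; the points with m + n odd contribute the same by n -> 1 - n.\<close>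

lemma phi_psi_cubic:
  assumes q: "norm q < 1" "q \<noteq> (0::complex)"
  shows "phi q * phi (q ^ 3) - phi (- q) * phi (- (q ^ 3)) = q * psi2 (q\<^sup>2) * psi2 (q ^ 6)"
proof -
  have q2: "norm (q\<^sup>2) < 1" "q\<^sup>2 \<noteq> 0" by (rule power_lt_1[OF q(1)], simp) (use q(2) in simp)
  have q3: "norm (q ^ 3) < 1" "q ^ 3 \<noteq> 0" by (rule power_lt_1[OF q(1)], simp) (use q(2) in simp)
  have q6: "norm (q ^ 6) < 1" "q ^ 6 \<noteq> 0" by (rule power_lt_1[OF q(1)], simp) (use q(2) in simp)
  have mq: "norm (- q) < 1" "- q \<noteq> 0" "norm (- (q ^ 3)) < 1" "- (q ^ 3) \<noteq> 0" using q q3 by auto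
  define L where "L = phi q * phi (q ^ 3) - phi (- q) * phi (- (q ^ 3))"
  let ?F = "\<lambda>(x, y). q powi (x * x) * (q ^ 3) powi (y * y)"
  have "((\<lambda>p. ?F p + - (case p of (x, y) \<Rightarrow> (- q) powi (x * x) * (- (q ^ 3)) powi (y * y)))
          has_sum L) UNIV"
    unfolding L_def diff_conv_add_uminus
    by (intro has_sum_add has_sum_uminusI has_sum_lattice_product phi_has_sum phi_abs_summable q mq q3)
  also have "?this \<longleftrightarrow> ((\<lambda>p. 2 * ?F p) has_sum L) {(x, y). odd (x + y)}"
    by (rule has_sum_cong_neutral) (auto simp: minus_powi[of q] minus_powi[of "q ^ 3"] split: if_splits)
  finally have L: "((\<lambda>p. 2 * ?F p) has_sum L) {(x, y). odd (x + y)}" .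
  let ?G = "\<lambda>(m, n). q * ((q\<^sup>2) powi tri m * (q ^ 6) powi tri n)"
  have G: "(?G has_sum q * (psi2 (q\<^sup>2) * psi2 (q ^ 6))) UNIV"
    using has_sum_cmult_right[OF has_sum_lattice_product[OF psi2_has_sum[OF q2] psi2_abs_summable[OF q2] psi2_has_sum[OF q6] psi2_abs_summable[OF q6]], of q]
    unfolding case_prod_unfold .
  have s: "?G summable_on A" for A
    by (rule summable_on_subset_banach[OF has_sum_imp_summable[OF G]]) auto
  define E where "E = infsum ?G {(m, n). even (m + n)}"
  have E1: "(?G has_sum E) {(m, n). even (m + n)}" unfolding E_def by (rule has_sum_infsum[OF s])
  have "(?G has_sum E) {(m, n). even (m + n)} \<longleftrightarrow> (?G has_sum E) {(m, n). odd (m + n)}"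
    by (rule has_sum_reindex_bij_witness[of _ "\<lambda>(m, n). (m, 1 - n)" "\<lambda>(m, n). (m, 1 - n)"])
       (auto simp: tri_reflect)
  hence E2: "(?G has_sum E) {(m, n). odd (m + n)}" using E1 by simp
  have "(?G has_sum (E + E)) ({(m, n). even (m + n)} \<union> {(m, n). odd (m + n)})"
    by (rule has_sum_Un_disjoint[OF E1 E2]) auto
  also have "{(m, n). even (m + n)} \<union> {(m, n). odd (m + n)} = (UNIV :: (int \<times> int) set)" by auto
  finally have EE: "E + E = q * (psi2 (q\<^sup>2) * psi2 (q ^ 6))" using G by (rule has_sum_unique)
  have "E = infsum ?G {(m, n). (m + 1 * n) mod 2 = 0}" unfolding E_def by (simp add: even_iff_mod_2_eq_zero)
  also have "\<dots> = infsum ?F {(x, y). (x + 1 * y) mod 2 = 1}"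
    unfolding infsum_congruence_class[of 0 2, simplified] infsum_congruence_class[of 1 2, simplified]
  proof (rule infsum_reindex_bij_witness[of _ "\<lambda>(k, y). (k + 1, k - y + 1)" "\<lambda>(k, n). (k - 1, k - n)"], goal_cases)
    case (5 p)
    obtain k n where p: "p = (k, n)" by (cases p)
    define x y where "x = 2 * k - 1 - (k - n)" and "y = k - n"
    have "2 * (x * x + 3 * (y * y)) = 2 * (1 + 2 * tri (2 * k - n) + 6 * tri n)"
      using tri_eq[of "2 * k - n"] tri_eq[of n] by (simp add: x_def y_def algebra_simps)
    hence "x * x + 3 * (y * y) = 1 + 2 * tri (2 * k - n) + 6 * tri n" by (simp only: mult_cancel_left) simp
    hence "q powi (x * x) * (q ^ 3) powi (y * y) = q * ((q\<^sup>2) powi tri (2 * k - n) * (q ^ 6) powi tri n)"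
      using q by (simp add: power_powi power_int_add[symmetric]) (simp add: power_int_add)
    moreover have "1 + 2 * (k - 1) - 1 * (k - n) = x" "k - n = y" by (simp_all add: x_def y_def)
    ultimately show ?case by (simp add: p del: diff_add_cancel)
  qed auto
  also have "{(x, y). (x + 1 * y) mod 2 = 1} = {(x, y). odd (x + y :: int)}" unfolding odd_iff_mod_2_eq_one by simp
  finally have "E = infsum ?F {(x, y). odd (x + y)}" .
  moreover have "?F summable_on {(x, y). odd (x + y)}"
    using has_sum_imp_summable[OF has_sum_cmult_right[OF L, of "1/2"]] by (simp add: case_prod_unfold)
  ultimately have "(?F has_sum E) {(x, y). odd (x + y)}" by simp
  hence "((\<lambda>p. 2 * ?F p) has_sum 2 * E) {(x, y). odd (x + y)}" by (rule has_sum_cmult_right)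
  from has_sum_unique[OF L this] show ?thesis using EE unfolding L_def by (simp add: mult.assoc)
qed

lemma even_pent: "even (pent n) \<longleftrightarrow> n mod 4 = 0 \<or> n mod 4 = 3"
proof -
  define k where "k = n div 4"
  have "n mod 4 = 0 \<or> n mod 4 = 1 \<or> n mod 4 = 2 \<or> n mod 4 = 3" by presburger
  then consider "n = 4 * k" | "n = 4 * k + 1" | "n = 4 * k + 2" | "n = 4 * k + 3"
    unfolding k_def by (metis add.right_neutral mult_div_mod_eq)
  thus ?thesis
  proof cases
    case 1
    have "pent n = 2 * (k * (12 * k - 1))" using pent_eq[of n] by (simp add: 1 algebra_simps)
    thus ?thesis by (simp add: 1)
  next
    case 2
    have "pent n = (4 * k + 1) * (6 * k + 1)" using pent_eq[of n] by (simp add: 2 algebra_simps)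
    thus ?thesis by (simp add: 2)
  next
    case 3
    have "pent n = (2 * k + 1) * (12 * k + 5)" using pent_eq[of n] by (simp add: 3 algebra_simps)
    thus ?thesis by (simp add: 3)
  next
    case 4
    have "pent n = (4 * k + 3) * (6 * k + 4)" using pent_eq[of n] by (simp add: 4 algebra_simps)
    thus ?thesis by (simp add: 4)
  qed
qed

text \<open>
  With \<open>x = 6 * m - 1\<close> and \<open>y = 6 * n - 1\<close> the exponents are \<open>(x\<^sup>2 + 7 * y\<^sup>2 - 8) / 24\<close>. Let \<open>\<alpha>\<close> and \<open>\<beta>\<close> be the
  conjugate primes above 2 in the integers of \<open>\<rat>(sqrt (-7))\<close>. Up to sign, terms with exponent 1 modulo 4 arise
  from those of the right-hand side by multiplying \<open>x + y * sqrt (-7)\<close> by \<open>2 * \<alpha> / \<beta>\<close> or \<open>2 * \<beta> / \<alpha>\<close>, while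
  multiplication by \<open>(\<alpha> / \<beta>)\<^sup>2\<close> pairs off the terms with exponent 3 modulo 4 with opposite signs.
\<close>

lemma eul_septic:
  assumes q: "norm q < 1" "q \<noteq> (0::complex)"
  shows "eul (- q) * eul (- (q ^ 7)) - eul q * eul (q ^ 7) = 2 * q * eul (q ^ 4) * eul (q ^ 28)"
proof -
  have q4: "norm (q ^ 4) < 1" "q ^ 4 \<noteq> 0" by (rule power_lt_1[OF q(1)], simp) (use q(2) in simp)
  have q7: "norm (q ^ 7) < 1" "q ^ 7 \<noteq> 0" by (rule power_lt_1[OF q(1)], simp) (use q(2) in simp)
  have q28: "norm (q ^ 28) < 1" "q ^ 28 \<noteq> 0" by (rule power_lt_1[OF q(1)], simp) (use q(2) in simp)
  have mq: "norm (- q) < 1" "- q \<noteq> 0" "norm (- (q ^ 7)) < 1" "- (q ^ 7) \<noteq> 0" using q q7 by auto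
  define s :: "int \<Rightarrow> complex" where "s k = (-1) powi k" for k
  have s: "s k = (if even k then 1 else -1)" for k by (simp add: s_def minus_one_powi)
  define F where "F = (\<lambda>(m, n). s (m + n) * q powi (pent m + 7 * pent n))"
  define G where "G = (\<lambda>(m, n). s (m + n) * q powi (1 + 4 * (pent m + 7 * pent n)))"
  have prod: "((\<lambda>(m, n). s m * a powi pent m * (s n * b powi pent n)) has_sum eul a * eul b) UNIV"
    if "norm a < 1" "a \<noteq> 0" "norm b < 1" "b \<noteq> 0" for a b
    unfolding s_def by (intro has_sum_lattice_product eul_pent that)
  define L where "L = eul (- q) * eul (- (q ^ 7)) - eul q * eul (q ^ 7)"
  have "((\<lambda>p. (case p of (m, n) \<Rightarrow> s m * (- q) powi pent m * (s n * (- (q ^ 7)) powi pent n))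
       + - (case p of (m, n) \<Rightarrow> s m * q powi pent m * (s n * (q ^ 7) powi pent n)))
        has_sum L) UNIV"
    unfolding L_def diff_conv_add_uminus
    by (intro has_sum_add has_sum_uminusI prod q q7 mq)
  also have "?this \<longleftrightarrow> ((\<lambda>p. - 2 * F p) has_sum L)
      {(m, n). odd (pent m + 7 * pent n)}"
    unfolding F_def using q
    by (intro has_sum_cong_neutral)
       (auto simp: minus_powi[of q] minus_powi[of "q ^ 7"] s power_int_add power_powi split: if_splits)
  finally have L: "((\<lambda>p. - 2 * F p) has_sum L)
      {(m, n). odd (pent m + 7 * pent n)}" .
  have Feq: "F = (\<lambda>(m, n). s m * q powi pent m * (s n * (q ^ 7) powi pent n))"
    using q by (auto simp: F_def s power_int_add power_powi fun_eq_iff)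
  have sF: "F summable_on A" for A
    unfolding Feq by (rule summable_on_subset_banach[OF has_sum_imp_summable[OF prod[OF q q7]]]) auto
  have Geq: "G = (\<lambda>p. q * (case p of (m, n) \<Rightarrow> s m * (q ^ 4) powi pent m * (s n * (q ^ 28) powi pent n)))"
    using q by (auto simp: G_def s power_int_add power_powi fun_eq_iff)
  have G: "(G has_sum q * (eul (q ^ 4) * eul (q ^ 28))) UNIV"
    unfolding Geq by (intro has_sum_cmult_right prod q4 q28)
  have sG: "G summable_on A" for A
    by (rule summable_on_subset_banach[OF has_sum_imp_summable[OF G]]) auto
  have cancel2: "x = y" if "2 * x = 2 * y" for x y :: int using that by simp
  \<comment> \<open>The even and the odd half of the right-hand lattice (\<open>A1\<close> and
    \<open>A2\<close>) each give one class on the left. The minus sign meets the factor - 2 in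
    \<open>L\<close>.\<close>
  have A1: "infsum (\<lambda>p. - G p) {(a, b). (a + 1 * b) mod 2 = 0} = infsum F {(m, n). (m + (- 3) * n) mod 8 = 1}"
    unfolding infsum_congruence_class[of 0 2, simplified] infsum_congruence_class[of 1 8, simplified]
  proof (rule infsum_reindex_bij_witness[of _ "\<lambda>(k, n). (- 2 * k - n, - k)" "\<lambda>(k, b). (- b, 2 * b - k)"], goal_cases)
    case (5 p)
    obtain k b where p: "p = (k, b)" by (cases p)
    have "pent (1 - 3 * k - 2 * b) + 7 * pent (2 * b - k) = 1 + 4 * (pent (2 * k - b) + 7 * pent b)"
      by (rule cancel2) (use pent_eq[of "1 - 3 * k - 2 * b"] pent_eq[of "2 * b - k"] pent_eq[of "2 * k - b"] pent_eq[of b]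
        in \<open>simp add: algebra_simps\<close>)
    moreover have "1 + 8 * (- b) - (- 3) * (2 * b - k) = 1 - 3 * k - 2 * b" by simp
    ultimately show ?case by (simp add: p F_def G_def s)
  qed auto
  have A2: "infsum (\<lambda>p. - G p) {(a, b). (a + 1 * b) mod 2 = 1} = infsum F {(m, n). (m + 3 * n) mod 8 = 2}"
    unfolding infsum_congruence_class[of 1 2, simplified] infsum_congruence_class[of 2 8, simplified]
  proof (rule infsum_reindex_bij_witness[of _ "\<lambda>(k, n). (k - n, - k)" "\<lambda>(k, b). (- b, - k - b)"], goal_cases)
    case (5 p)
    obtain k b where p: "p = (k, b)" by (cases p)
    have "pent (2 + 3 * k - 5 * b) + 7 * pent (- k - b) = 1 + 4 * (pent (1 + 2 * k - b) + 7 * pent b)"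
      by (rule cancel2) (use pent_eq[of "2 + 3 * k - 5 * b"] pent_eq[of "- k - b"] pent_eq[of "1 + 2 * k - b"] pent_eq[of b]
        in \<open>simp add: algebra_simps\<close>)
    moreover have "2 + 8 * (- b) - 3 * (- k - b) = 2 + 3 * k - 5 * b" by simp
    ultimately show ?case by (simp add: p F_def G_def s)
  qed auto
  have B: "infsum (\<lambda>p. - F p) {(m, n). (m + 3 * n) mod 8 = 6} = infsum F {(m, n). (m + (- 3) * n) mod 8 = 5}"
    unfolding infsum_congruence_class[of 6 8, simplified] infsum_congruence_class[of 5 8, simplified]
  proof (rule infsum_reindex_bij_witness[of _ "\<lambda>(k, n). (k, n + 3 * k + 2)" "\<lambda>(k, n). (k, n - 3 * k - 2)"], goal_cases)
    case (5 p)
    obtain k n where p: "p = (k, n)" by (cases p)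
    have "pent (3 * n - 1 - k) + 7 * pent (n - 3 * k - 2) = pent (6 + 8 * k - 3 * n) + 7 * pent n"
      by (rule cancel2) (use pent_eq[of "3 * n - 1 - k"] pent_eq[of "n - 3 * k - 2"] pent_eq[of "6 + 8 * k - 3 * n"] pent_eq[of n]
        in \<open>simp add: algebra_simps\<close>)
    moreover have "5 + 8 * k - (- 3) * (n - 3 * k - 2) = 3 * n - 1 - k" by simp
    ultimately show ?case by (simp add: p F_def s)
  qed auto
  have un: "{(m, n). odd (pent m + 7 * pent n)} =
     ({(m, n). (m + (- 3) * n) mod 8 = 1} \<union> {(m, n). (m + 3 * n) mod 8 = 2}) \<union>
     ({(m, n). (m + 3 * n) mod 8 = 6} \<union> {(m, n). (m + (- 3) * n) mod 8 = 5})"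
  proof -
    have "odd (pent m + 7 * pent n) \<longleftrightarrow>
      ((m + (- 3) * n) mod 8 = 1 \<or> (m + 3 * n) mod 8 = 2) \<or> ((m + 3 * n) mod 8 = 6 \<or> (m + (- 3) * n) mod 8 = 5)" for m n
    proof -
      have par: "odd (pent m + 7 * pent n) \<longleftrightarrow> (even (pent m) \<noteq> even (pent n))" by presburger
      have m4: "m mod 4 = m mod 8 mod 4" "n mod 4 = n mod 8 mod 4" by (simp_all add: mod_mod_cancel)
      have m8: "(m + (- 3) * n) mod 8 = (m mod 8 + (- 3) * (n mod 8)) mod 8"
        "(m + 3 * n) mod 8 = (m mod 8 + 3 * (n mod 8)) mod 8" by (intro mod_add_cong mod_mult_cong; simp)+
      \<comment> \<open>The parity of \<open>pent\<close> depends on residues modulo 4 and the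
        linear forms are taken modulo 8, so 64 pairs of residues decide the claim.\<close>
      have cases: "\<forall>i\<in>{0, 1, 2, 3, 4, 5, 6, 7 :: int}. \<forall>j\<in>{0, 1, 2, 3, 4, 5, 6, 7 :: int}.
          ((i mod 4 = 0 \<or> i mod 4 = 3) \<noteq> (j mod 4 = 0 \<or> j mod 4 = 3)) \<longleftrightarrow>
          (((i + (- 3) * j) mod 8 = 1 \<or> (i + 3 * j) mod 8 = 2) \<or>
           ((i + 3 * j) mod 8 = 6 \<or> (i + (- 3) * j) mod 8 = 5))"
        by simp
      have "k mod 8 \<in> {0, 1, 2, 3, 4, 5, 6, 7}" for k :: int by simp presburger
      note c = bspec[OF bspec[OF cases this[of m]] this[of n]]
      show ?thesis unfolding par even_pent m4 m8 by (rule c)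
    qed
    thus ?thesis by auto
  qed
  have "infsum F {(m, n). odd (pent m + 7 * pent n)} =
      (infsum F {(m, n). (m + (- 3) * n) mod 8 = 1} + infsum F {(m, n). (m + 3 * n) mod 8 = 2}) +
      (infsum F {(m, n). (m + 3 * n) mod 8 = 6} + infsum F {(m, n). (m + (- 3) * n) mod 8 = 5})"
    unfolding un
    by (subst infsum_Un_disjoint[OF sF sF]; (subst infsum_Un_disjoint[OF sF sF])?;
        (subst infsum_Un_disjoint[OF sF sF])?; (auto; presburger)?)
  also have "\<dots> = - (infsum G {(a, b). (a + 1 * b) mod 2 = 0} + infsum G {(a, b). (a + 1 * b) mod 2 = 1})"
    unfolding A1[symmetric] A2[symmetric] B[symmetric] by (simp add: infsum_uminus)
  also have "infsum G {(a, b). (a + 1 * b) mod 2 = 0} + infsum G {(a, b). (a + 1 * b) mod 2 = 1} =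
      infsum G ({(a, b). (a + 1 * b) mod 2 = 0} \<union> {(a, b). (a + 1 * b) mod 2 = 1})"
    by (rule infsum_Un_disjoint[symmetric, OF sG sG]) auto
  also have "{(a, b). (a + 1 * b) mod 2 = 0} \<union> {(a, b). (a + 1 * b) mod 2 = 1} = (UNIV :: (int \<times> int) set)" by auto
  also have "infsum G UNIV = q * (eul (q ^ 4) * eul (q ^ 28))" using G by (rule infsumI)
  finally have "(F has_sum - (q * (eul (q ^ 4) * eul (q ^ 28)))) {(m, n). odd (pent m + 7 * pent n)}"
    using has_sum_infsum[OF sF] by metis
  hence "((\<lambda>p. - 2 * F p) has_sum - 2 * - (q * (eul (q ^ 4) * eul (q ^ 28)))) {(m, n). odd (pent m + 7 * pent n)}"
    by (rule has_sum_cmult_right)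
  from has_sum_unique[OF L this] show ?thesis by (simp add: L_def)
qed

section \<open>Fourier series and Gaussian integrals\<close>

text \<open>Polynomials in cos(2 pi x) separate the points of [0, 1/2], so by Stone-Weierstrass and
  the symmetry they approximate \<open>h\<close> uniformly on [0, 1]. As \<open>h\<close> is
  orthogonal to all of them, the integral of h^2 is at most e times that of |h| for every e >
  0.\<close>

lemma cosine_fourier_unique:
  fixes h :: "real \<Rightarrow> real"
  assumes cont: "continuous_on {0..1} h"
    and sym: "\<And>x. x \<in> {0..1} \<Longrightarrow> h (1 - x) = h x"
    and coeff: "\<And>k::int. integral {0..1} (\<lambda>x. h x * cos (2 * pi * k * x)) = 0"
    and x: "x \<in> {0..1}"
  shows "h x = 0"
proof -
  define c where "c x = cos (2 * pi * x)" for x :: real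
  have contc: "continuous_on A c" for A unfolding c_def by (intro continuous_intros)
  \<comment> \<open>Multiplication by cos(2 pi x) moves the frequency k to k + 1 and k - 1; integer
    \<open>k\<close> avoids a boundary case at 0.\<close>
  have pw: "integral {0..1} (\<lambda>x. h x * (c x ^ n * cos (2 * pi * k * x))) = 0" for n and k :: int
  proof (induction n arbitrary: k)
    case 0
    show ?case using coeff[of k] by simp
  next
    case (Suc n)
    define f where "f k x = h x * (c x ^ n * cos (2 * pi * real_of_int k * x))" for k x
    have f: "(f k has_integral 0) {0..1}" for k
    proof -
      have "f k integrable_on {0..1}" unfolding f_def
        by (intro integrable_continuous_real continuous_intros cont contc)
      thus ?thesis using Suc.IH[of k] unfolding f_def[symmetric] by (metis has_integral_integral)
    qed
    have e: "h x * (c x ^ Suc n * cos (2 * pi * real_of_int k * x)) = 1/2 * f (k + 1) x + 1/2 * f (k - 1) x" for x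
    proof -
      have "2 * pi * real_of_int (k + 1) * x = 2 * pi * k * x + 2 * pi * x"
        "2 * pi * real_of_int (k - 1) * x = 2 * pi * k * x - 2 * pi * x" by (simp_all add: algebra_simps)
      hence s: "cos (2 * pi * real_of_int (k + 1) * x) + cos (2 * pi * real_of_int (k - 1) * x) = 2 * (c x * cos (2 * pi * k * x))"
        by (simp only: cos_add cos_diff c_def) (simp add: mult.commute)
      have "h x * (c x ^ Suc n * cos (2 * pi * k * x)) = 1/2 * (h x * (c x ^ n * (2 * (c x * cos (2 * pi * k * x)))))" by simp
      thus ?thesis unfolding s[symmetric] f_def by (simp only: distrib_left)
    qed
    have "((\<lambda>x. 1/2 * f (k + 1) x + 1/2 * f (k - 1) x) has_integral (1/2 * 0 + 1/2 * 0)) {0..1}"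
      by (intro has_integral_add has_integral_mult_right f)
    thus ?case unfolding e by (simp add: integral_unique)
  qed
  have poly0: "integral {0..1} (\<lambda>x. h x * poly p (c x)) = 0" for p :: "real poly"
  proof (induction p)
    case 0
    show ?case by simp
  next
    case (pCons a p)
    have "integral {0..1} (\<lambda>x. h x * (c x ^ m * poly p (c x))) = 0" for m
    proof (induction p arbitrary: m)
      case (pCons a p)
      have "(\<lambda>x. h x * (c x ^ m * poly (pCons a p) (c x))) =
         (\<lambda>x. a * (h x * c x ^ m) + h x * (c x ^ Suc m * poly p (c x)))" by (auto simp: algebra_simps fun_eq_iff)
      moreover have "integral {0..1} (\<lambda>x. h x * c x ^ m) = 0" using pw[of m 0] by simp
      moreover have "(\<lambda>x. a * (h x * c x ^ m)) integrable_on {0..1}"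
        "(\<lambda>x. h x * (c x ^ Suc m * poly p (c x))) integrable_on {0..1}"
        by (intro integrable_continuous_real continuous_intros cont contc)+
      ultimately show ?case using pCons.IH[of "Suc m"]
        by (simp add: Henstock_Kurzweil_Integration.integral_add del: power_Suc)
    qed simp
    from this[of 1] have "integral {0..1} (\<lambda>x. h x * (c x * poly p (c x))) = 0" by simp
    moreover have "integral {0..1} h = 0" using coeff[of 0] by simp
    moreover have "(\<lambda>x. a * h x) integrable_on {0..1}" "(\<lambda>x. h x * (c x * poly p (c x))) integrable_on {0..1}"
      by (intro integrable_continuous_real continuous_intros cont contc)+
    moreover have "(\<lambda>x. h x * poly (pCons a p) (c x)) = (\<lambda>x. a * h x + h x * (c x * poly p (c x)))"
      by (auto simp: algebra_simps fun_eq_iff)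
    ultimately show ?case by (simp add: Henstock_Kurzweil_Integration.integral_add)
  qed
  have approx: "\<exists>p. \<forall>x\<in>{0..1}. \<bar>h x - poly p (c x)\<bar> < e" if e: "e > 0" for e
  proof -
    have "\<exists>g. (\<exists>p. g = (\<lambda>x. poly p (c x))) \<and> (\<forall>x\<in>{0..1/2}. \<bar>h x - g x\<bar> < e)"
    proof (rule Stone_Weierstrass_HOL)
      show "\<exists>p. (\<lambda>x. a) = (\<lambda>x. poly p (c x))" for a by (rule exI[of _ "[:a:]"]) simp
      show "continuous_on {0..1/2} f" if "\<exists>p. f = (\<lambda>x. poly p (c x))" for f
        using that by (auto intro!: continuous_intros contc)
      show "\<exists>p. (\<lambda>x. f x + g x) = (\<lambda>x. poly p (c x))"
        if "(\<exists>p. f = (\<lambda>x. poly p (c x))) \<and> (\<exists>p. g = (\<lambda>x. poly p (c x)))" for f g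
      proof -
        from that obtain p q where "f = (\<lambda>x. poly p (c x))" "g = (\<lambda>x. poly q (c x))" by blast
        thus ?thesis by (intro exI[of _ "p + q"]) simp
      qed
      show "\<exists>p. (\<lambda>x. f x * g x) = (\<lambda>x. poly p (c x))"
        if "(\<exists>p. f = (\<lambda>x. poly p (c x))) \<and> (\<exists>p. g = (\<lambda>x. poly p (c x)))" for f g
      proof -
        from that obtain p q where "f = (\<lambda>x. poly p (c x))" "g = (\<lambda>x. poly q (c x))" by blast
        thus ?thesis by (intro exI[of _ "p * q"]) simp
      qed
      show "\<exists>f. (\<exists>p. f = (\<lambda>x. poly p (c x))) \<and> f x \<noteq> f y" if "x \<in> {0..1/2} \<and> y \<in> {0..1/2} \<and> x \<noteq> y" for x y
      proof (rule exI[of _ c], rule conjI)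
        show "\<exists>p. c = (\<lambda>x. poly p (c x))" by (rule exI[of _ "[:0, 1:]"]) simp
        show "c x \<noteq> c y"
        proof
          assume "c x = c y"
          hence "2 * pi * x = 2 * pi * y" unfolding c_def
            by (rule cos_inj_pi[rotated -1]) (use that in \<open>auto simp: field_simps\<close>)
          thus False using that by simp
        qed
      qed
      show "continuous_on {0..1/2} h" by (rule continuous_on_subset[OF cont]) auto
    qed (use e in auto)
    then obtain p where p: "\<forall>x\<in>{0..1/2}. \<bar>h x - poly p (c x)\<bar> < e" by blast
    have "\<bar>h x - poly p (c x)\<bar> < e" if x: "x \<in> {0..1}" for x
    proof (cases "x \<le> 1/2")
      case False
      have "c (1 - x) = c x" by (simp add: c_def algebra_simps cos_diff)
      thus ?thesis using bspec[OF p, of "1 - x"] sym[OF x] False x by simp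
    qed (use bspec[OF p, of x] x in auto)
    thus ?thesis by blast
  qed
  define M where "M = integral {0..1} (\<lambda>x. \<bar>h x\<bar>)"
  have ih2: "(\<lambda>x. h x * h x) integrable_on {0..1}"
    by (intro integrable_continuous_real continuous_intros cont)
  have small: "integral {0..1} (\<lambda>x. h x * h x) \<le> e * M" if e: "e > 0" for e
  proof -
    obtain p where p: "\<And>x. x \<in> {0..1} \<Longrightarrow> \<bar>h x - poly p (c x)\<bar> < e" using approx[OF e] by blast
    have ip: "(\<lambda>x. h x * poly p (c x)) integrable_on {0..1}"
      by (intro integrable_continuous_real continuous_intros cont contc)
    have "integral {0..1} (\<lambda>x. h x * h x) = integral {0..1} (\<lambda>x. h x * h x - h x * poly p (c x))"
      using poly0[of p] ip ih2 by (simp add: Henstock_Kurzweil_Integration.integral_diff)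
    also have "\<dots> \<le> integral {0..1} (\<lambda>x. e * \<bar>h x\<bar>)"
    proof (rule integral_le)
      show "(\<lambda>x. h x * h x - h x * poly p (c x)) integrable_on {0..1}"
        by (rule integrable_diff[OF ih2 ip])
      show "(\<lambda>x. e * \<bar>h x\<bar>) integrable_on {0..1}"
        by (intro integrable_continuous_real continuous_intros cont)
      fix x :: real assume x: "x \<in> {0..1}"
      have "h x * h x - h x * poly p (c x) \<le> \<bar>h x - poly p (c x)\<bar> * \<bar>h x\<bar>"
        by (metis abs_ge_self abs_mult mult.commute right_diff_distrib)
      also have "\<dots> \<le> e * \<bar>h x\<bar>" using p[OF x] by (intro mult_right_mono) auto
      finally show "h x * h x - h x * poly p (c x) \<le> e * \<bar>h x\<bar>" .
    qed
    finally show ?thesis by (simp add: M_def)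
  qed
  have "M \<ge> 0" unfolding M_def
    by (intro Henstock_Kurzweil_Integration.integral_nonneg integrable_continuous_real continuous_intros cont) auto
  have "integral {0..1} (\<lambda>x. h x * h x) \<le> 0"
  proof (rule field_le_epsilon)
    fix e :: real assume "e > 0"
    have "integral {0..1} (\<lambda>x. h x * h x) \<le> (e / (M + 1)) * M" using \<open>M \<ge> 0\<close> \<open>e > 0\<close> by (intro small) simp
    also have "\<dots> \<le> 0 + e" using \<open>M \<ge> 0\<close> \<open>e > 0\<close> by (simp add: field_simps)
    finally show "integral {0..1} (\<lambda>x. h x * h x) \<le> 0 + e" .
  qed
  moreover have "integral {0..1} (\<lambda>x. h x * h x) \<ge> 0"
    by (intro Henstock_Kurzweil_Integration.integral_nonneg ih2) auto
  ultimately have "integral {0..1} (\<lambda>x. h x * h x) = 0" by simp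
  hence "\<forall>x\<in>{0..1}. h x * h x = 0"
    by (subst (asm) integral_eq_0_iff) (auto intro!: continuous_intros cont)
  thus ?thesis using x by auto
qed


text \<open>The Fourier transform of a Gaussian, read off from the characteristic function of the
  standard normal distribution after scaling by sqrt(2 pi t).\<close>

lemma has_bochner_integral_gaussian_cos:
  fixes t k :: real
  assumes t: "t > 0"
  shows "has_bochner_integral lborel (\<lambda>y. exp (- pi * t * y\<^sup>2) * cos (2 * pi * k * y)) (exp (- pi * k\<^sup>2 / t) / sqrt t)"
proof -
  interpret real_distribution std_normal_distribution by (rule real_dist_normal_dist)
  define u where "u = 2 * pi * k / sqrt (2 * pi * t)"
  have "integrable std_normal_distribution (\<lambda>x. iexp (u * x))" by (rule integrable_iexp) auto
  hence i: "has_bochner_integral std_normal_distribution (\<lambda>x. iexp (u * x)) (complex_of_real (exp (- u\<^sup>2 / 2)))"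
    using fun_cong[OF char_std_normal_distribution, of u] by (simp add: has_bochner_integral_iff char_def)
  have "has_bochner_integral std_normal_distribution (\<lambda>x. cos (u * x)) (exp (- u\<^sup>2 / 2))"
    using has_bochner_integral_Re[OF i] by (simp add: Re_exp)
  hence "has_bochner_integral lborel (\<lambda>x. std_normal_density x * cos (u * x)) (exp (- u\<^sup>2 / 2))"
    by (simp add: has_bochner_integral_iff integrable_real_density integral_real_density)
  moreover define c where "c = sqrt (2 * pi * t)"
  have c: "c > 0" "c\<^sup>2 = 2 * pi * t" using t by (auto simp: c_def)
  ultimately have "has_bochner_integral lborel (\<lambda>y. std_normal_density (0 + c * y) * cos (u * (0 + c * y))) (exp (- u\<^sup>2 / 2) /\<^sub>R \<bar>c\<bar>)"
    by (subst (asm) lborel_has_bochner_integral_real_affine_iff[of c _ _ 0]) auto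
  hence "has_bochner_integral lborel (\<lambda>y. sqrt (2 * pi) * (std_normal_density (0 + c * y) * cos (u * (0 + c * y)))) (sqrt (2 * pi) * (exp (- u\<^sup>2 / 2) /\<^sub>R \<bar>c\<bar>))"
    by (intro has_bochner_integral_mult_right) simp_all
  moreover have "sqrt (2 * pi) * (std_normal_density (0 + c * y) * cos (u * (0 + c * y))) = exp (- pi * t * y\<^sup>2) * cos (2 * pi * k * y)" for y
  proof -
    have "u * c = 2 * pi * k" using c by (simp add: u_def c_def[symmetric])
    hence A: "u * (c * y) = 2 * pi * k * y" by (metis mult.assoc)
    have B: "- (c * y)\<^sup>2 / 2 = - pi * t * y\<^sup>2" using c by (simp add: power_mult_distrib)
    have "sqrt (2 * pi) * (std_normal_density (0 + c * y) * cos (u * (0 + c * y))) = exp (- (c * y)\<^sup>2 / 2) * cos (u * (c * y))"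
      by (simp add: std_normal_density_def)
    thus ?thesis unfolding A B .
  qed
  ultimately have "has_bochner_integral lborel (\<lambda>y. exp (- pi * t * y\<^sup>2) * cos (2 * pi * k * y)) (sqrt (2 * pi) * (exp (- u\<^sup>2 / 2) /\<^sub>R \<bar>c\<bar>))"
    by (simp only:)
  moreover have "sqrt (2 * pi) * (exp (- u\<^sup>2 / 2) /\<^sub>R \<bar>c\<bar>) = exp (- pi * k\<^sup>2 / t) / sqrt t"
  proof -
    have "u\<^sup>2 = (2 * pi * k)\<^sup>2 / (2 * pi * t)" using t by (simp add: u_def power_divide)
    also have "\<dots> = 2 * (pi * k\<^sup>2 / t)" using t by (simp add: power2_eq_square)
    finally have u: "- u\<^sup>2 / 2 = - pi * k\<^sup>2 / t" by simp
    have "c = sqrt (2 * pi) * sqrt t" by (simp add: c_def real_sqrt_mult)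
    thus ?thesis unfolding u using c t by (simp add: divide_inverse)
  qed
  ultimately show ?thesis by (simp only:)
qed

text \<open>The intervals are half-open because the unit intervals [n, n + 1] with -N <= n < N tile
  exactly [-N, N].\<close>

lemma int_intervals_at_top:
  "filterlim (\<lambda>N. {-int N..<int N}) (finite_subsets_at_top UNIV) sequentially"
  unfolding filterlim_iff eventually_finite_subsets_at_top
proof (intro allI impI, elim exE conjE)
  fix P :: "int set \<Rightarrow> bool" and X :: "int set"
  assume X: "finite X" "\<forall>Y. finite Y \<and> X \<subseteq> Y \<and> Y \<subseteq> UNIV \<longrightarrow> P Y"
  have "finite ((\<lambda>x. nat \<bar>x\<bar>) ` X)" using X by auto
  then obtain M where "\<And>x. x \<in> X \<Longrightarrow> nat \<bar>x\<bar> \<le> M" by (auto simp: finite_nat_set_iff_bounded_le)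
  hence "X \<subseteq> {-int N..<int N}" if "N \<ge> Suc M" for N using that by fastforce
  thus "\<forall>\<^sub>F N in sequentially. P {-int N..<int N}"
    using X(2) by (intro eventually_sequentiallyI[of "Suc M"]) auto
qed

text \<open>The unfolding step of Poisson summation: the partial sums are integrals over [-N, N],
  which converge to the integral over the line by dominated convergence.\<close>

lemma has_sum_unit_interval_integrals:
  fixes g :: "real \<Rightarrow> real"
  assumes g: "has_bochner_integral lborel g I" and cont: "continuous_on UNIV g"
    and hs: "((\<lambda>n. integral {0..1} (\<lambda>x. g (of_int n + x))) has_sum S) UNIV"
  shows "S = I"
proof -
  have contA: "continuous_on A g" for A by (rule continuous_on_subset[OF cont]) auto
  have ig: "g integrable_on {a..b}" for a b by (intro integrable_continuous_real contA)
  have shift: "integral {0..1} (\<lambda>x. g (of_int n + x)) = integral {of_int n..of_int n + 1} g" for n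
    using integral_shift[of 0 "of_int n" 1 g] contA by (simp add: o_def add.commute)
  have sum: "(\<Sum>n\<in>{-int N..<int N}. integral {0..1} (\<lambda>x. g (of_int n + x))) = integral {- real N..real N} g" for N
  proof (induction N)
    case (Suc N)
    have "{-int (Suc N)..<int (Suc N)} = insert (- int N - 1) (insert (int N) {-int N..<int N})" by auto
    hence "(\<Sum>n\<in>{-int (Suc N)..<int (Suc N)}. integral {0..1} (\<lambda>x. g (of_int n + x))) =
       integral {- real N - 1..- real N} g + (integral {real N..real N + 1} g + integral {- real N..real N} g)"
      using Suc.IH shift[of "int N"] shift[of "- int N - 1"] by simp
    also have "integral {real N..real N + 1} g + integral {- real N..real N} g = integral {- real N..real N + 1} g"
      using Henstock_Kurzweil_Integration.integral_combine[of "- real N" "real N" "real N + 1" g] ig by simp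
    also have "integral {- real N - 1..- real N} g + integral {- real N..real N + 1} g = integral {- real N - 1..real N + 1} g"
      using Henstock_Kurzweil_Integration.integral_combine[of "- real N - 1" "- real N" "real N + 1" g] ig by simp
    finally have "(\<Sum>n\<in>{-int (Suc N)..<int (Suc N)}. integral {0..1} (\<lambda>x. g (of_int n + x))) =
       integral {- real N - 1..real N + 1} g" .
    moreover have "- real (Suc N) = - real N - 1" "real (Suc N) = real N + 1" by simp_all
    ultimately show ?case by (simp only:)
  qed simp
  have "(\<lambda>N. \<Sum>n\<in>{-int N..<int N}. integral {0..1} (\<lambda>x. g (of_int n + x))) \<longlonglongrightarrow> S"
    using hs unfolding has_sum_def by (rule filterlim_compose[OF _ int_intervals_at_top])
  hence 1: "(\<lambda>N. integral {- real N..real N} g) \<longlonglongrightarrow> S" unfolding sum .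
  have int: "integrable lborel g" using g by (simp add: has_bochner_integral_iff)
  have si: "set_integrable lborel {- real N..real N} g" for N
    unfolding set_integrable_def using int by (intro integrable_mult_indicator) auto
  have "(\<lambda>N. LINT x|lborel. indicator {- real N..real N} x *\<^sub>R g x) \<longlonglongrightarrow> (LINT x|lborel. g x)"
  proof (rule integral_dominated_convergence[where w = "\<lambda>x. \<bar>g x\<bar>"])
    show "AE x in lborel. (\<lambda>N. indicator {- real N..real N} x *\<^sub>R g x) \<longlonglongrightarrow> g x"
    proof (rule AE_I2, rule tendsto_eventually)
      fix x :: real
      obtain M where "\<bar>x\<bar> \<le> real M" using real_arch_simple by blast
      thus "\<forall>\<^sub>F N in sequentially. indicator {- real N..real N} x *\<^sub>R g x = g x"
        by (intro eventually_sequentiallyI[of M]) (auto simp: indicator_def)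
    qed
    show "AE x in lborel. norm (indicator {- real N..real N} x *\<^sub>R g x) \<le> \<bar>g x\<bar>" for N
      by (rule AE_I2) (simp add: indicator_def)
    show "(\<lambda>x. indicator {- real N..real N} x *\<^sub>R g x) \<in> borel_measurable lborel" for N
      using si[of N] unfolding set_integrable_def by (rule borel_measurable_integrable)
    show "g \<in> borel_measurable lborel" using int by (rule borel_measurable_integrable)
    show "integrable lborel (\<lambda>x. \<bar>g x\<bar>)" using int by simp
  qed
  hence "(\<lambda>N. integral {- real N..real N} g) \<longlonglongrightarrow> I"
    using set_borel_integral_eq_integral(2)[OF si] g
    by (simp add: set_lebesgue_integral_def has_bochner_integral_iff)
  with 1 show ?thesis by (rule LIMSEQ_unique)
qed

section \<open>Poisson summation and the inversion of the eta function\<close>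

lemma gaussian_summable:
  assumes "t > 0"
  shows "(\<lambda>n::int. exp (- pi * t * (of_int n)\<^sup>2)) summable_on UNIV"
proof -
  define q where "q = complex_of_real (exp (- pi * t))"
  have "norm q = exp (- pi * t)" by (simp add: q_def)
  moreover have "exp (- pi * t) < 1" using assms by simp
  moreover have "q \<noteq> 0" by (simp add: q_def)
  ultimately have "(\<lambda>n. exp (- pi * t) powi (n * n)) summable_on UNIV"
    using phi_abs_summable[of q] by (simp add: norm_powi)
  moreover have "exp (- pi * t) powi (n * n) = exp (- pi * t * (of_int n)\<^sup>2)" for n
    by (subst exp_power_int) (simp add: power2_eq_square mult_ac)
  ultimately show ?thesis by simp
qed

lemma
  fixes f :: "int \<Rightarrow> real \<Rightarrow> real"
  assumes cont: "\<And>n. continuous_on {0..1} (f n)"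
    and bound: "\<And>n x. x \<in> {0..1} \<Longrightarrow> \<bar>f n x\<bar> \<le> M n" and M: "M summable_on UNIV"
  shows has_sum_integral_unit:
      "((\<lambda>n. integral {0..1} (f n)) has_sum integral {0..1} (\<lambda>x. \<Sum>\<^sub>\<infinity>n. f n x)) UNIV" (is ?A)
    and continuous_on_infsum_unit: "continuous_on {0..1} (\<lambda>x. \<Sum>\<^sub>\<infinity>n. f n x)" (is ?B)
    and summable_on_unit: "x \<in> {0..1} \<Longrightarrow> (\<lambda>n. f n x) summable_on UNIV"
proof -
  have u: "uniform_limit {0..1} (\<lambda>X x. \<Sum>n\<in>X. f n x) (\<lambda>x. \<Sum>\<^sub>\<infinity>n\<in>UNIV. f n x) (finite_subsets_at_top UNIV)"
    by (rule Weierstrass_m_test_general[OF _ M]) (use bound in auto)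
  have c: "continuous_on {0..1} (\<lambda>x. \<Sum>n\<in>X. f n x)" for X by (intro continuous_on_sum cont)
  show ?B by (rule uniform_limit_theorem[OF _ u]) (auto intro!: always_eventually c)
  obtain I J where IJ: "\<And>X. ((\<lambda>x. \<Sum>n\<in>X. f n x) has_integral I X) {0..1}"
     "((\<lambda>x. \<Sum>\<^sub>\<infinity>n. f n x) has_integral J) {0..1}" "(I \<longlongrightarrow> J) (finite_subsets_at_top UNIV)"
    using uniform_limit_integral[OF u c] by (metis finite_subsets_at_top_neq_bot)
  have "I X = (\<Sum>n\<in>X. integral {0..1} (f n))" if "finite X" for X
    using integral_unique[OF IJ(1)[of X]] Henstock_Kurzweil_Integration.integral_sum[OF that, of f "{0..1}"]
      integrable_continuous_real[OF cont] by simp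
  hence "((\<lambda>X. \<Sum>n\<in>X. integral {0..1} (f n)) \<longlongrightarrow> J) (finite_subsets_at_top UNIV)"
    by (intro Lim_transform_eventually[OF IJ(3)] eventually_finite_subsets_at_top_weakI) auto
  thus ?A unfolding has_sum_def using integral_unique[OF IJ(2)] by simp
  show "(\<lambda>n. f n x) summable_on UNIV" if "x \<in> {0..1}"
    by (rule abs_summable_summable, rule Infinite_Sum.abs_summable_on_comparison_test'[OF M]) (use bound that in auto)
qed

lemma integral_cos_unit: "integral {0..1} (\<lambda>x. cos (2 * pi * of_int m * x)) = (if m = 0 then 1 else 0)"
proof (cases "m = 0")
  case False
  have "((\<lambda>x. cos (2 * pi * of_int m * x)) has_integral
     sin (2 * pi * of_int m * 1) / (2 * pi * of_int m) - sin (2 * pi * of_int m * 0) / (2 * pi * of_int m)) {0..1}"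
    by (rule fundamental_theorem_of_calculus)
       (use False in \<open>auto intro!: derivative_eq_intros simp flip: has_real_derivative_iff_has_vector_derivative\<close>)
  moreover have "sin (2 * pi * of_int m) = 0" using sin_npi_int[of "2 * m"] by (simp add: mult_ac)
  ultimately show ?thesis using False by (simp add: integral_unique)
qed simp

lemma integral_cos_cos_unit:
  "integral {0..1} (\<lambda>x. cos (2 * pi * of_int n * x) * cos (2 * pi * of_int k * x)) =
     (if n = k then 1/2 else 0) + (if n = - k then 1/2 else 0)"
proof -
  have i: "(\<lambda>x. 1/2 * cos (2 * pi * of_int m * x)) integrable_on {0..1}" for m
    by (intro integrable_continuous_real continuous_intros)
  have "cos (2 * pi * of_int n * x) * cos (2 * pi * of_int k * x) =
    1/2 * cos (2 * pi * of_int (n - k) * x) + 1/2 * cos (2 * pi * of_int (n + k) * x)" for x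
    unfolding cos_times_cos by (simp add: algebra_simps)
  hence "integral {0..1} (\<lambda>x. cos (2 * pi * of_int n * x) * cos (2 * pi * of_int k * x)) =
    integral {0..1} (\<lambda>x. 1/2 * cos (2 * pi * of_int (n - k) * x)) + integral {0..1} (\<lambda>x. 1/2 * cos (2 * pi * of_int (n + k) * x))"
    by (simp only: Henstock_Kurzweil_Integration.integral_add[OF i i])
  moreover have "integral {0..1} (\<lambda>x. 1/2 * cos (2 * pi * of_int m * x)) = (if m = 0 then 1/2 else 0)" for m
    by (subst integral_mult_right, subst integral_cos_unit) simp
  ultimately show ?thesis by (simp only: eq_neg_iff_add_eq_0 right_minus_eq)
qed

text \<open>Both sides are continuous in \<open>x\<close>, symmetric under x -> 1 - x, and have the
  same cosine coefficients: on the left by unfolding to a Gaussian integral, on the right by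
  orthogonality. \<open>cosine_fourier_unique\<close> makes them equal.\<close>

theorem poisson_gaussian:
  assumes t: "t > 0" and x: "x \<in> {0..1}"
  shows "(\<Sum>\<^sub>\<infinity>n::int. exp (- pi * t * (of_int n + x)\<^sup>2)) =
         (\<Sum>\<^sub>\<infinity>n::int. exp (- pi * (of_int n)\<^sup>2 / t) * cos (2 * pi * of_int n * x)) / sqrt t"
proof -
  define g where "g y = exp (- pi * t * y\<^sup>2)" for y :: real
  define a where "a n = exp (- pi * (of_int n)\<^sup>2 / t)" for n :: int
  \<comment> \<open>For x in [0, 1] the point n + x lies between n and n + 1, and \<open>g\<close>
    decreases with distance from 0, so one of the two end values dominates. Taking their sum avoids
    the choice.\<close>
  define M where "M n = g (of_int n) + g (of_int (n + 1))" for n :: int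
  define F where "F x = (\<Sum>\<^sub>\<infinity>n::int. g (of_int n + x))" for x
  define D where "D x = (\<Sum>\<^sub>\<infinity>n::int. a n * cos (2 * pi * of_int n * x))" for x
  have gs: "(\<lambda>n::int. g (of_int n)) summable_on UNIV"
    unfolding g_def by (rule gaussian_summable[OF t])
  have gs1: "(\<lambda>n::int. g (of_int (n + 1))) summable_on UNIV"
    by (subst summable_on_reindex_bij_witness[of UNIV "\<lambda>n. n - 1" "\<lambda>n. n + 1" UNIV "\<lambda>n. g (of_int n)"]) (auto simp: gs)
  have M: "M summable_on UNIV" unfolding M_def by (intro summable_on_add gs gs1)
  have as: "a summable_on UNIV"
    using gaussian_summable[of "1 / t"] t unfolding a_def by simp
  have contg: "continuous_on A (\<lambda>x. g (c + x))" for A c unfolding g_def by (intro continuous_intros)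
  have gle: "g y \<le> g z" if "\<bar>z\<bar> \<le> \<bar>y\<bar>" for y z
    using that t unfolding g_def by (simp add: abs_le_square_iff)
  have gpos: "g y > 0" for y by (simp add: g_def)
  have gM: "\<bar>g (of_int n + x)\<bar> \<le> M n" if "x \<in> {0..1}" for n x
  proof (cases "n \<ge> 0")
    case True
    hence "g (of_int n + x) \<le> g (of_int n)" using that by (intro gle) auto
    thus ?thesis using gpos[of "of_int n + x"] gpos[of "of_int (n + 1)"] by (simp add: M_def)
  next
    case False
    hence "real_of_int n + 1 \<le> 0" by linarith
    hence "g (of_int n + x) \<le> g (of_int (n + 1))" using that by (intro gle) auto
    thus ?thesis using gpos[of "of_int n + x"] gpos[of "of_int n"] by (simp add: M_def)
  qed
  have contF: "continuous_on {0..1} F" unfolding F_def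
    by (rule continuous_on_infsum_unit[OF contg gM M])
  have aD: "\<bar>a n * cos y\<bar> \<le> a n" for n y
    using mult_left_le[of "\<bar>cos y\<bar>" "a n"] by (simp add: abs_mult a_def)
  have contD: "continuous_on {0..1} D" unfolding D_def
    by (rule continuous_on_infsum_unit[OF _ aD as]) (intro continuous_intros)
  have coeffF: "integral {0..1} (\<lambda>x. F x * cos (2 * pi * of_int k * x)) = a k / sqrt t" for k :: int
  proof (rule has_sum_unit_interval_integrals)
    let ?G = "\<lambda>y. g y * cos (2 * pi * of_int k * y)"
    show "has_bochner_integral lborel ?G (a k / sqrt t)"
      unfolding g_def a_def by (rule has_bochner_integral_gaussian_cos[OF t])
    show "continuous_on UNIV ?G" unfolding g_def by (intro continuous_intros)
    have per: "cos (2 * pi * of_int k * (of_int n + x)) = cos (2 * pi * of_int k * x)" for n x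
    proof -
      have "2 * pi * of_int k * (of_int n + x) = 2 * pi * of_int k * x + 2 * pi * of_int (k * n)"
        by (simp add: algebra_simps)
      thus ?thesis using cos_int_2pin[of "k * n"] sin_int_2pin[of "k * n"] by (simp only: cos_add)
    qed
    have "((\<lambda>n. integral {0..1} (\<lambda>x. g (of_int n + x) * cos (2 * pi * of_int k * x))) has_sum
       integral {0..1} (\<lambda>x. \<Sum>\<^sub>\<infinity>n::int. g (of_int n + x) * cos (2 * pi * of_int k * x))) UNIV"
    proof (rule has_sum_integral_unit[OF _ _ M])
      show "continuous_on {0..1} (\<lambda>x. g (of_int n + x) * cos (2 * pi * of_int k * x))" for n
        by (intro continuous_intros contg)
      show "\<bar>g (of_int n + x) * cos (2 * pi * of_int k * x)\<bar> \<le> M n" if "x \<in> {0..1}" for n x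
        using mult_left_le[of "\<bar>cos (2 * pi * of_int k * x)\<bar>" "\<bar>g (of_int n + x)\<bar>"] gM[OF that, of n]
        by (simp add: abs_mult)
    qed
    thus "((\<lambda>n. integral {0..1} (\<lambda>x. ?G (of_int n + x))) has_sum integral {0..1} (\<lambda>x. F x * cos (2 * pi * of_int k * x))) UNIV"
      unfolding per F_def by (simp add: infsum_cmult_left')
  qed
  have coeffD: "integral {0..1} (\<lambda>x. D x * cos (2 * pi * of_int k * x)) = a k" for k :: int
  proof -
    have "((\<lambda>n. integral {0..1} (\<lambda>x. a n * cos (2 * pi * of_int n * x) * cos (2 * pi * of_int k * x))) has_sum
       integral {0..1} (\<lambda>x. \<Sum>\<^sub>\<infinity>n. a n * cos (2 * pi * of_int n * x) * cos (2 * pi * of_int k * x))) UNIV"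
    proof (rule has_sum_integral_unit[OF _ _ as])
      show "continuous_on {0..1} (\<lambda>x. a n * cos (2 * pi * of_int n * x) * cos (2 * pi * of_int k * x))" for n
        by (intro continuous_intros)
      show "\<bar>a n * cos (2 * pi * of_int n * x) * cos (2 * pi * of_int k * x)\<bar> \<le> a n" for n x
        using mult_left_le[of "\<bar>cos (2 * pi * of_int k * x)\<bar>" "\<bar>a n * cos (2 * pi * of_int n * x)\<bar>"]
          aD[of n "2 * pi * of_int n * x"] by (simp only: abs_mult) (simp add: abs_mult)
    qed
    moreover have "integral {0..1} (\<lambda>x. a n * cos (2 * pi * of_int n * x) * cos (2 * pi * of_int k * x)) =
       a n * ((if n = k then 1/2 else 0) + (if n = - k then 1/2 else 0))" for n
      unfolding mult.assoc integral_cos_cos_unit[symmetric] by (subst integral_mult_right) simp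
    ultimately have "((\<lambda>n. a n * ((if n = k then 1/2 else 0) + (if n = - k then 1/2 else 0))) has_sum
       integral {0..1} (\<lambda>x. D x * cos (2 * pi * of_int k * x))) UNIV"
      unfolding D_def by (simp add: infsum_cmult_left')
    moreover have "((\<lambda>n. a n * ((if n = k then 1/2 else 0) + (if n = - k then 1/2 else 0))) has_sum a k) UNIV"
    \<comment> \<open>For k = 0 the two halves fall on the same index and add up to 1.\<close>
    proof (rule has_sum_finite_neutralI[of "{k, - k}"])
      have "a (- k) = a k" by (simp add: a_def)
      thus "a k = (\<Sum>n\<in>{k, - k}. a n * ((if n = k then 1/2 else 0) + (if n = - k then 1/2 else 0)))"
        by (cases "k = 0") auto
    qed auto
    ultimately show ?thesis by (rule has_sum_unique)
  qed
  have "F x - D x / sqrt t = 0"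
  proof (rule cosine_fourier_unique[OF _ _ _ x])
    show "continuous_on {0..1} (\<lambda>x. F x - D x / sqrt t)"
      using t by (intro continuous_intros contF contD) auto
    show "F (1 - x) - D (1 - x) / sqrt t = F x - D x / sqrt t" for x
    proof -
      have "F (1 - x) = F x" unfolding F_def
        by (rule infsum_reindex_bij_witness[of _ "\<lambda>n. - 1 - n" "\<lambda>n. - 1 - n"])
           (auto simp: g_def power2_eq_square algebra_simps)
      moreover have "cos (2 * pi * of_int n * (1 - x)) = cos (2 * pi * of_int n * x)" for n
        using cos_int_2pin[of n] sin_int_2pin[of n] by (simp add: right_diff_distrib cos_diff)
      hence "D (1 - x) = D x" unfolding D_def by simp
      ultimately show ?thesis by simp
    qed
    show "integral {0..1} (\<lambda>x. (F x - D x / sqrt t) * cos (2 * pi * of_int k * x)) = 0" for k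
    proof -
      have "(\<lambda>x. (F x - D x / sqrt t) * cos (2 * pi * of_int k * x)) =
        (\<lambda>x. F x * cos (2 * pi * of_int k * x) - 1 / sqrt t * (D x * cos (2 * pi * of_int k * x)))"
        by (auto simp: algebra_simps)
      moreover have "(\<lambda>x. F x * cos (2 * pi * of_int k * x)) integrable_on {0..1}"
        "(\<lambda>x. 1 / sqrt t * (D x * cos (2 * pi * of_int k * x))) integrable_on {0..1}"
        using t by (intro integrable_continuous_real continuous_intros contF contD; simp)+
      ultimately show ?thesis
        by (simp only: Henstock_Kurzweil_Integration.integral_diff integral_mult_right coeffF coeffD) simp
    qed
  qed
  thus ?thesis unfolding F_def D_def g_def a_def by simp
qed

text \<open>\<open>eta_im s\<close> is \<open>\<eta>(i s)\<close>; below, \<open>eta_tw s\<close> is \<open>\<eta>((1 + i s) / 2)\<close> up to a root of unity.\<close>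

definition eta_im :: "real \<Rightarrow> real" where
  "eta_im s = exp (- pi * s / 12) * theta_f (- exp (- 2 * pi * s))"

lemma pent_div: "m * (3 * m - 1) div 2 = pent m"
  using pent_eq[of m] by simp

lemma pent_nonneg: "pent m \<ge> 0"
proof -
  have "m * (3 * m - 1) \<ge> 0"
    by (cases "m \<ge> 1") (auto intro: mult_nonneg_nonneg mult_nonpos_nonpos)
  thus ?thesis using pent_eq[of m] by linarith
qed

text \<open>Completing the square: 1/12 + m (3 m - 1) = (6 m - 1)^2 / 12. This is the Gaussian form
  needed for Poisson summation.\<close>

lemma eta_im_sum: "eta_im s = (\<Sum>\<^sub>\<infinity>m::int. (-1) powi m * exp (- pi * s * (6 * of_int m - 1)\<^sup>2 / 12))"
proof -
  have "exp (- pi * s / 12) * ((-1) powi m * (- (- exp (- 2 * pi * s))) ^ nat (m * (3 * m - 1) div 2)) =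
     (-1) powi m * exp (- pi * s * (6 * of_int m - 1)\<^sup>2 / 12)" for m :: int
  proof -
    have n: "real (nat (pent m)) = of_int m * (3 * of_int m - 1) / 2"
      using pent_nonneg[of m] arg_cong[OF pent_eq[of m], of real_of_int] by simp
    have "exp (- pi * s / 12) * exp (- 2 * pi * s) ^ nat (pent m) = exp (- pi * s / 12 + of_int m * (3 * of_int m - 1) / 2 * (- 2 * pi * s))"
      unfolding exp_of_nat_mult[symmetric] exp_add[symmetric] n ..
    also have "- pi * s / 12 + of_int m * (3 * of_int m - 1) / 2 * (- 2 * pi * s) = - pi * s * (6 * of_int m - 1)\<^sup>2 / 12"
      by (simp add: power2_eq_square field_simps)
    finally show ?thesis by (simp add: pent_div)
  qed
  thus ?thesis unfolding eta_im_def theta_f_def infsum_cmult_right'[symmetric] by (simp only:)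
qed

lemma infsum_even_odd:
  fixes f :: "int \<Rightarrow> real"
  assumes f: "f summable_on UNIV"
  shows "infsum f UNIV = (\<Sum>\<^sub>\<infinity>j. f (2 * j)) + (\<Sum>\<^sub>\<infinity>j. f (2 * j + 1))"
proof -
  have s: "f summable_on A" for A by (rule summable_on_subset_banach[OF f]) auto
  have "infsum f UNIV = infsum f ({n. even n} \<union> {n. odd n})" by (rule arg_cong[where f = "infsum f"]) auto
  also have "\<dots> = infsum f {n. even n} + infsum f {n. odd n}"
    by (rule infsum_Un_disjoint[OF s s]) auto
  also have "infsum f {n. even n} = (\<Sum>\<^sub>\<infinity>j. f (2 * j))"
    by (rule infsum_reindex_bij_witness[of _ "\<lambda>j. 2 * j" "\<lambda>n. n div 2"]) auto
  also have "infsum f {n. odd n} = (\<Sum>\<^sub>\<infinity>j. f (2 * j + 1))"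
    by (rule infsum_reindex_bij_witness[of _ "\<lambda>j. 2 * j + 1" "\<lambda>n. n div 2"]) auto
  finally show ?thesis .
qed

text \<open>Even and odd m give two Gaussian sums with shifts 1/12 and 5/12 and t = 12 s. After
  Poisson summation frequency n carries the factor \<open>c n\<close>, which is sqrt 3 times the
  quadratic character modulo 12, and this restores the series at 1 / s. The constant is 2 sqrt 3 /
  sqrt(12 s) = 1 / sqrt s.\<close>

theorem eta_im_inverse:
  assumes s: "s > 0"
  shows "eta_im (1 / s) = sqrt s * eta_im s"
proof -
  define a where "a n = exp (- pi * (of_int n)\<^sup>2 / (12 * s))" for n :: int
  define c where "c n = cos (2 * pi * of_int n * (1/12)) - cos (2 * pi * of_int n * (5/12))" for n :: int
  have sum6: "(\<lambda>m::int. f (6 * m - 1)) summable_on UNIV" if "f summable_on UNIV" for f :: "int \<Rightarrow> real"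
  proof -
    have "f summable_on (range (\<lambda>m. 6 * m - 1))" by (rule summable_on_subset_banach[OF that]) auto
    thus ?thesis by (subst (asm) summable_on_reindex) (auto simp: inj_on_def o_def)
  qed
  have as: "a summable_on UNIV"
    using gaussian_summable[of "1 / (12 * s)"] s unfolding a_def by simp
  have sgn: "(\<lambda>m. (-1) powi m * f m) summable_on UNIV" if "f summable_on UNIV" for f :: "int \<Rightarrow> real"
  proof -
    have "\<bar>(-1) powi m * f m\<bar> = \<bar>f m\<bar>" for m by (simp add: minus_one_powi)
    thus ?thesis using that unfolding summable_on_iff_abs_summable_on_real[of f UNIV]
      summable_on_iff_abs_summable_on_real[of "\<lambda>m. (-1) powi m * f m" UNIV] by simp
  qed
  define S where "S = eta_im (1 / s)"
  have S: "S = (\<Sum>\<^sub>\<infinity>m. (-1) powi m * a (6 * m - 1))"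
    unfolding S_def eta_im_sum a_def by (simp add: mult.commute)
  hence hS: "((\<lambda>m. (-1) powi m * a (6 * m - 1)) has_sum S) UNIV"
    using has_sum_infsum[OF sgn[OF sum6[OF as]]] by simp
  have c_parity: "c n = (if even n then 0 else 2 * cos (pi * of_int n / 6))" for n
  proof -
    have "2 * pi * of_int n * (5/12) = pi * of_int n - pi * of_int n / 6" by simp
    hence "cos (2 * pi * of_int n * (5/12)) = cos (pi * of_int n) * cos (pi * of_int n / 6) + sin (pi * of_int n) * sin (pi * of_int n / 6)"
      by (simp only: cos_diff)
    moreover have "2 * pi * of_int n * (1/12) = pi * of_int n / 6" by simp
    ultimately show ?thesis unfolding c_def by (simp only: cos_npi_int sin_npi_int) simp
  qed
  have c_even: "c n = 0" if "even n" for n using c_parity[of n] that by simp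
  have c_odd: "c n = 2 * cos (pi * of_int n / 6)" if "odd n" for n using c_parity[of n] that by simp
  have c6: "cos (pi * of_int (6 * m + r) / 6) = (-1) powi m * cos (pi * of_int r / 6)" for m r
  proof -
    have "pi * of_int (6 * m + r) / 6 = pi * of_int m + pi * of_int r / 6" by (simp add: field_simps)
    thus ?thesis by (simp only: cos_add cos_npi_int sin_npi_int minus_one_powi mult_zero_left diff_0_right)
  qed
  have c1: "c (6 * m + 1) = (-1) powi m * sqrt 3" for m
    using c_odd[of "6 * m + 1"] c6[of m 1] by (simp add: cos_30)
  have c5: "c (6 * m - 1) = (-1) powi m * sqrt 3" for m
    using c_odd[of "6 * m - 1"] c6[of m "-1"] by (simp add: cos_30)
  have c3: "c (6 * m + 3) = 0" for m
    using c_odd[of "6 * m + 3"] c6[of m 3] by simp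
  have h5: "((\<lambda>n. a n * c n) has_sum sqrt 3 * S) {n. n mod 6 = 5}"
  proof -
    have "((\<lambda>n. a n * c n) has_sum sqrt 3 * S) {n. n mod 6 = 5} \<longleftrightarrow> ((\<lambda>m. sqrt 3 * ((-1) powi m * a (6 * m - 1))) has_sum sqrt 3 * S) UNIV"
    proof (rule has_sum_reindex_bij_witness[of _ "\<lambda>m. 6 * m - 1" "\<lambda>n. (n + 1) div 6"])
      fix n :: int assume "n \<in> {n. n mod 6 = 5}"
      hence "n = 6 * ((n + 1) div 6) - 1" by simp presburger
      then obtain m where n: "n = 6 * m - 1" by blast
      thus "sqrt 3 * ((-1) powi ((n + 1) div 6) * a (6 * ((n + 1) div 6) - 1)) = a n * c n" "6 * ((n + 1) div 6) - 1 = n"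
        using c5[of m] by simp_all
    qed (auto; presburger)+
    thus ?thesis using has_sum_cmult_right[OF hS] by blast
  qed
  \<comment> \<open>The frequencies congruent to 1 modulo 6 are the negatives of those congruent to
    5, and \<open>a\<close> is even, so both classes contribute the same sum.\<close>
  have h1: "((\<lambda>n. a n * c n) has_sum sqrt 3 * S) {n. n mod 6 = 1}"
  proof -
    have "((\<lambda>n. a n * c n) has_sum sqrt 3 * S) {n. n mod 6 = 1} \<longleftrightarrow> ((\<lambda>m. sqrt 3 * ((-1) powi m * a (6 * m - 1))) has_sum sqrt 3 * S) UNIV"
    proof (rule has_sum_reindex_bij_witness[of _ "\<lambda>m. 1 - 6 * m" "\<lambda>n. (1 - n) div 6"])
      fix n :: int assume "n \<in> {n. n mod 6 = 1}"
      hence "n = 1 - 6 * ((1 - n) div 6)" by simp presburger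
      then obtain m where n: "n = 1 - 6 * m" by blast
      have "a (1 - 6 * m) = a (6 * m - 1)" by (simp add: a_def power2_commute)
      thus "sqrt 3 * ((-1) powi ((1 - n) div 6) * a (6 * ((1 - n) div 6) - 1)) = a n * c n" "1 - 6 * ((1 - n) div 6) = n"
        using c1[of "- m"] by (simp_all add: n minus_one_powi)
    qed (auto; presburger)+
    thus ?thesis using has_sum_cmult_right[OF hS] by blast
  qed
  have "((\<lambda>n. a n * c n) has_sum (sqrt 3 * S + sqrt 3 * S)) ({n. n mod 6 = 5} \<union> {n. n mod 6 = 1})"
    by (rule has_sum_Un_disjoint[OF h5 h1]) auto
  also have "?this \<longleftrightarrow> ((\<lambda>n. a n * c n) has_sum (sqrt 3 * S + sqrt 3 * S)) UNIV"
  proof (rule has_sum_cong_neutral)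
    fix n :: int assume "n \<in> UNIV - ({n. n mod 6 = 5} \<union> {n. n mod 6 = 1})"
    hence "even n \<or> n mod 6 = 3" by simp presburger
    hence "even n \<or> n = 6 * (n div 6) + 3" by presburger
    thus "a n * c n = 0" using c_even c3 by (metis mult_zero_right)
  qed auto
  finally have sumc: "(\<Sum>\<^sub>\<infinity>n. a n * c n) = 2 * sqrt 3 * S" using infsumI by fastforce
  have ac: "(\<lambda>n. a n * cos (2 * pi * of_int n * x)) summable_on UNIV" for x
    by (rule abs_summable_summable, rule Infinite_Sum.abs_summable_on_comparison_test'[OF as])
       (simp add: abs_mult a_def mult_left_le)
  have P: "(\<Sum>\<^sub>\<infinity>n::int. exp (- pi * (12 * s) * (of_int n + x)\<^sup>2)) =
         (\<Sum>\<^sub>\<infinity>n::int. a n * cos (2 * pi * of_int n * x)) / sqrt (12 * s)" if "x \<in> {0..1}" for x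
    unfolding a_def using poisson_gaussian[of "12 * s" x] s that by simp
  define b where "b m = (-1) powi m * exp (- pi * s * (6 * of_int m - 1)\<^sup>2 / 12)" for m :: int
  have bs: "b summable_on UNIV"
    using sgn[OF sum6[OF gaussian_summable[of "s / 12"]]] s unfolding b_def by simp
  have "eta_im s = infsum b UNIV" unfolding eta_im_sum b_def ..
  also have "\<dots> = (\<Sum>\<^sub>\<infinity>j. b (2 * j)) + (\<Sum>\<^sub>\<infinity>j. b (2 * j + 1))" by (rule infsum_even_odd[OF bs])
  also have "(\<Sum>\<^sub>\<infinity>j. b (2 * j)) = (\<Sum>\<^sub>\<infinity>n::int. exp (- pi * (12 * s) * (of_int n + 1/12)\<^sup>2))"
    by (rule infsum_reindex_bij_witness[of _ "\<lambda>j. - j" "\<lambda>j. - j"])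
       (auto simp: b_def minus_one_powi power2_eq_square field_simps)
  also have "(\<Sum>\<^sub>\<infinity>j. b (2 * j + 1)) = (\<Sum>\<^sub>\<infinity>n::int. - exp (- pi * (12 * s) * (of_int n + 5/12)\<^sup>2))"
    by (intro infsum_cong) (auto simp: b_def minus_one_powi power2_eq_square field_simps)
  also have "\<dots> = - (\<Sum>\<^sub>\<infinity>n::int. exp (- pi * (12 * s) * (of_int n + 5/12)\<^sup>2))" by (rule infsum_uminus)
  also have "(\<Sum>\<^sub>\<infinity>n::int. exp (- pi * (12 * s) * (of_int n + 1/12)\<^sup>2)) + - (\<Sum>\<^sub>\<infinity>n::int. exp (- pi * (12 * s) * (of_int n + 5/12)\<^sup>2))
     = (\<Sum>\<^sub>\<infinity>n. a n * c n) / sqrt (12 * s)"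
  proof -
    have "(\<lambda>n. a n * c n) = (\<lambda>n. a n * cos (2 * pi * of_int n * (1/12)) + - (a n * cos (2 * pi * of_int n * (5/12))))"
      by (simp add: c_def right_diff_distrib)
    hence "(\<Sum>\<^sub>\<infinity>n. a n * c n) =
        (\<Sum>\<^sub>\<infinity>n. a n * cos (2 * pi * of_int n * (1/12))) + - (\<Sum>\<^sub>\<infinity>n. a n * cos (2 * pi * of_int n * (5/12)))"
      by (simp only: infsum_add[OF ac summable_on_uminus[THEN iffD2, OF ac]] infsum_uminus)
    moreover have "1/12 \<in> {0..1::real}" "5/12 \<in> {0..1::real}" by simp_all
    ultimately show ?thesis by (simp only: P add_divide_distrib minus_divide_left)
  qed
  also have "\<dots> = S / sqrt s"
  proof -
    have "sqrt (12 * s) = 2 * sqrt 3 * sqrt s"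
      using real_sqrt_mult[of 4 "3 * s"] by (simp add: real_sqrt_mult)
    thus ?thesis unfolding sumc by simp
  qed
  finally show ?thesis using s by (simp add: S_def field_simps)
qed

section \<open>Real eta quotient identities\<close>

text \<open>The bridge from the real series to the complex product, by the pentagonal number
  theorem. Negative \<open>x\<close> is allowed, which covers f(x) as well as f(-x).\<close>

lemma of_real_theta_f:
  assumes "x \<noteq> 0" "\<bar>x\<bar> < 1"
  shows "complex_of_real (theta_f (- x)) = eul (of_real x)"
proof -
  have q: "norm (complex_of_real x) < 1" "complex_of_real x \<noteq> 0" using assms by auto
  have e: "(-1) powi m * (- (- x)) ^ nat (m * (3 * m - 1) div 2) = (-1) powi m * x powi pent m" for m
    using pent_nonneg[of m] by (simp add: pent_div power_int_def)
  have 1: "((\<lambda>m. complex_of_real ((-1) powi m * x powi pent m)) has_sum eul (of_real x)) UNIV"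
    using eul_pent(1)[OF q] by (simp add: of_real_power_int)
  have "(\<lambda>m. norm (complex_of_real ((-1) powi m * x powi pent m))) summable_on UNIV"
    using eul_pent(2)[OF q] by (simp add: of_real_power_int)
  hence "(\<lambda>m. norm ((-1) powi m * x powi pent m)) summable_on UNIV" by (simp only: norm_of_real real_norm_def)
  hence "(\<lambda>m. (-1) powi m * x powi pent m) summable_on UNIV" by (rule abs_summable_summable)
  hence "((\<lambda>m. (-1) powi m * x powi pent m) has_sum theta_f (- x)) UNIV"
    unfolding theta_f_def e by (rule has_sum_infsum)
  hence "((\<lambda>m. complex_of_real ((-1) powi m * x powi pent m)) has_sum of_real (theta_f (- x))) UNIV"
    by (rule has_sum_of_real)
  thus ?thesis using 1 by (rule has_sum_unique)
qed

lemma of_real_theta_f':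
  assumes "x \<noteq> 0" "\<bar>x\<bar> < 1"
  shows "complex_of_real (theta_f x) = eul (- of_real x)"
  using of_real_theta_f[of "- x"] assms by simp

lemma pow_lt_1: "\<bar>x\<bar> < 1 \<Longrightarrow> n > 0 \<Longrightarrow> \<bar>x ^ n\<bar> < (1::real)"
  using power_less_one_iff[of "\<bar>x\<bar>" n] by (simp add: power_abs)

lemma pow_lt_1': "\<bar>x\<bar> < 1 \<Longrightarrow> n > 0 \<Longrightarrow> x ^ n < (1::real)"
  using pow_lt_1[of x n] by simp

lemma theta_f_product:
  assumes q: "q \<noteq> 0" "\<bar>q\<bar> < 1"
  shows "theta_f (- q) * theta_f q * theta_f (- (q ^ 4)) = theta_f (- (q\<^sup>2)) ^ 3"
proof -
  have "complex_of_real (theta_f (- q) * theta_f q * theta_f (- (q ^ 4))) = complex_of_real (theta_f (- (q\<^sup>2)) ^ 3)"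
    using eul_minus[of "of_real q"] q
    by (simp add: of_real_theta_f of_real_theta_f' pow_lt_1 pow_lt_1')
  thus ?thesis by (simp only: of_real_eq_iff)
qed

lemma theta_f_level9:
  assumes q: "q \<noteq> 0" "\<bar>q\<bar> < 1"
  shows "theta_f (- (q ^ 3)) ^ 12 = theta_f (- (q ^ 9)) ^ 3 *
     ((theta_f (- q) ^ 3 + 3 * q * theta_f (- (q ^ 9)) ^ 3) ^ 3 - 27 * q ^ 3 * theta_f (- (q ^ 9)) ^ 9)"
proof -
  have "complex_of_real (theta_f (- (q ^ 3)) ^ 12) = complex_of_real (theta_f (- (q ^ 9)) ^ 3 *
     ((theta_f (- q) ^ 3 + 3 * q * theta_f (- (q ^ 9)) ^ 3) ^ 3 - 27 * q ^ 3 * theta_f (- (q ^ 9)) ^ 9))"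
    using eul_level9[of "of_real q"] q by (simp add: of_real_theta_f pow_lt_1 pow_lt_1')
  thus ?thesis by (simp only: of_real_eq_iff)
qed

lemma theta_f_septic:
  assumes q: "q \<noteq> 0" "\<bar>q\<bar> < 1"
  shows "theta_f q * theta_f (q ^ 7) - theta_f (- q) * theta_f (- (q ^ 7)) = 2 * q * theta_f (- (q ^ 4)) * theta_f (- (q ^ 28))"
proof -
  have "complex_of_real (theta_f q * theta_f (q ^ 7) - theta_f (- q) * theta_f (- (q ^ 7))) =
      complex_of_real (2 * q * theta_f (- (q ^ 4)) * theta_f (- (q ^ 28)))"
    using eul_septic[of "of_real q"] q by (simp add: of_real_theta_f of_real_theta_f' pow_lt_1 pow_lt_1')
  thus ?thesis by (simp only: of_real_eq_iff)
qed

text \<open>The products for phi and psi turn \<open>phi_psi_cubic\<close> into this form once the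
  common denominator eul(q^2) eul(q^6) is cancelled.\<close>

lemma theta_f_cubic:
  assumes q: "q \<noteq> 0" "\<bar>q\<bar> < 1"
  shows "(theta_f q * theta_f (q ^ 3))\<^sup>2 - (theta_f (- q) * theta_f (- (q ^ 3)))\<^sup>2 = 4 * q * (theta_f (- (q ^ 4)) * theta_f (- (q ^ 12)))\<^sup>2"
proof -
  define z where "z = complex_of_real q"
  have z: "norm z < 1" "z \<noteq> 0" using q by (auto simp: z_def)
  have zn: "norm (z ^ n) < 1" "z ^ n \<noteq> 0" if "n > 0" for n using power_lt_1[OF z(1) that] z(2) by auto
  note nz = eul_nz[OF zn(1)]
  have p: "phi w = eul (- w) ^ 2 / eul (w\<^sup>2)" "phi (- w) = eul w ^ 2 / eul (w\<^sup>2)" if "norm w < 1" "w \<noteq> 0" for w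
    using phi_minus_eul[of w] phi_minus_eul[of "- w"] that eul_nz[OF power_lt_1[OF that(1), of 2]]
    by (auto simp: field_simps)
  have s: "psi2 w = 2 * eul (w\<^sup>2) ^ 2 / eul w" if "norm w < 1" "w \<noteq> 0" for w
    using psi2_eul[OF that] eul_nz[OF that(1)] by (auto simp: field_simps)
  have "(eul (- z) * eul (- (z ^ 3)))\<^sup>2 / (eul (z\<^sup>2) * eul (z ^ 6)) - (eul z * eul (z ^ 3))\<^sup>2 / (eul (z\<^sup>2) * eul (z ^ 6)) =
     4 * z * (eul (z ^ 4) * eul (z ^ 12))\<^sup>2 / (eul (z\<^sup>2) * eul (z ^ 6))"
    using phi_psi_cubic[OF z] zn[of 3] zn[of 2] zn[of 6]
    by (simp add: p z s power_mult_distrib flip: power_mult)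
  hence "(eul (- z) * eul (- (z ^ 3)))\<^sup>2 - (eul z * eul (z ^ 3))\<^sup>2 = 4 * z * (eul (z ^ 4) * eul (z ^ 12))\<^sup>2"
    using nz[of 2] nz[of 6] by (simp add: diff_divide_distrib[symmetric])
  hence "complex_of_real ((theta_f q * theta_f (q ^ 3))\<^sup>2 - (theta_f (- q) * theta_f (- (q ^ 3)))\<^sup>2) =
    complex_of_real (4 * q * (theta_f (- (q ^ 4)) * theta_f (- (q ^ 12)))\<^sup>2)"
    unfolding z_def using q by (simp add: of_real_theta_f of_real_theta_f' pow_lt_1 pow_lt_1')
  thus ?thesis by (simp only: of_real_eq_iff)
qed

text \<open>Jacobi's aequatio identica satis abstrusa. The difference of the fourth powers of phi(q)
  and phi(-q) factors into difference, sum and sum of squares, which \<open>phi_dissect\<close> and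
  \<open>phi_parallelogram\<close> evaluate one by one.\<close>

lemma theta_f_quartic:
  assumes q: "q \<noteq> 0" "\<bar>q\<bar> < 1"
  shows "theta_f q ^ 8 - theta_f (- q) ^ 8 = 16 * q * theta_f (- (q ^ 4)) ^ 8"
proof -
  define z where "z = complex_of_real q"
  have z: "norm z < 1" "z \<noteq> 0" "norm (- z) < 1" "- z \<noteq> 0" using q by (auto simp: z_def)
  have zn: "norm (z ^ n) < 1" "z ^ n \<noteq> 0" if "n > 0" for n using power_lt_1[OF z(1) that] z(2) by auto
  note nz = eul_nz[OF zn(1)]
  have p: "phi w * eul (w\<^sup>2) = eul (- w) ^ 2" if "norm w < 1" "w \<noteq> 0" for w
    using phi_minus_eul[of "- w"] that by auto
  have pz: "phi z * eul (z\<^sup>2) = eul (- z) ^ 2" "phi (- z) * eul (z\<^sup>2) = eul z ^ 2"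
    using p[OF z(1,2)] p[OF z(3,4)] by simp_all
  have pprod: "phi w * (eul w * eul (w ^ 4))\<^sup>2 = eul (w\<^sup>2) ^ 5" if "norm w < 1" "w \<noteq> 0" for w
  proof -
    have n: "eul (w\<^sup>2) \<noteq> 0" by (rule eul_nz, rule power_lt_1[OF that(1)]) simp
    have "eul (w\<^sup>2) * (phi w * (eul w * eul (w ^ 4))\<^sup>2) = (eul w * eul (- w) * eul (w ^ 4))\<^sup>2"
      using p[OF that] by (simp add: power_mult_distrib mult_ac)
    also have "\<dots> = eul (w\<^sup>2) * eul (w\<^sup>2) ^ 5"
      unfolding eul_minus[OF that(1)] by (simp flip: power_mult power_Suc)
    finally show ?thesis using n by simp
  qed
  have p2: "phi (z\<^sup>2) * (eul (z\<^sup>2) * eul (z ^ 8))\<^sup>2 = eul (z ^ 4) ^ 5"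
    using pprod[OF zn[of 2]] by (simp flip: power_mult)
  have p4: "phi (z ^ 4) * (eul (z ^ 4) * eul (z ^ 16))\<^sup>2 = eul (z ^ 8) ^ 5"
    using pprod[OF zn[of 4]] by (simp flip: power_mult)
  have s8: "psi2 (z ^ 8) * eul (z ^ 8) = 2 * eul (z ^ 16) ^ 2"
    using psi2_eul[OF zn[of 8]] by (simp flip: power_mult)
  have d1: "phi z - phi (- z) = 2 * z * psi2 (z ^ 8)" and d2: "phi z + phi (- z) = 2 * phi (z ^ 4)"
    using phi_dissect[OF z(1,2)] phi_dissect[OF z(3,4)] by simp_all
  have "phi z ^ 4 - phi (- z) ^ 4 = (phi z - phi (- z)) * (phi z + phi (- z)) * (phi z ^ 2 + phi (- z) ^ 2)"
    by (simp add: algebra_simps eval_nat_numeral)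
  also have "\<dots> = 8 * z * psi2 (z ^ 8) * phi (z ^ 4) * phi (z\<^sup>2) ^ 2"
    unfolding d1 d2 phi_parallelogram[OF z(1,2)] by simp
  finally have main: "phi z ^ 4 - phi (- z) ^ 4 = 8 * z * psi2 (z ^ 8) * phi (z ^ 4) * phi (z\<^sup>2) ^ 2" .
  define e2 e4 e8 e16 where "e2 = eul (z\<^sup>2)" and "e4 = eul (z ^ 4)" and "e8 = eul (z ^ 8)" and "e16 = eul (z ^ 16)"
  have n: "e2 \<noteq> 0" "e4 \<noteq> 0" "e8 \<noteq> 0" "e16 \<noteq> 0" unfolding e2_def e4_def e8_def e16_def by (rule nz; simp)+
  have f: "phi (z\<^sup>2) = e4 ^ 5 / (e2 * e8)\<^sup>2" "phi (z ^ 4) = e8 ^ 5 / (e4 * e16)\<^sup>2" "psi2 (z ^ 8) = 2 * e16\<^sup>2 / e8"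
    using p2 p4 s8 n unfolding e2_def[symmetric] e4_def[symmetric] e8_def[symmetric] e16_def[symmetric]
    by (simp_all add: eq_divide_eq)
  have "8 * z * psi2 (z ^ 8) * phi (z ^ 4) * phi (z\<^sup>2) ^ 2 * e2 ^ 4 = 16 * z * e4 ^ 8"
    unfolding f using n by (simp add: divide_simps) (simp add: algebra_simps eval_nat_numeral)
  hence "(phi z * e2) ^ 4 - (phi (- z) * e2) ^ 4 = 16 * z * e4 ^ 8"
    using main by (simp add: power_mult_distrib left_diff_distrib[symmetric])
  hence "eul (- z) ^ 8 - eul z ^ 8 = 16 * z * eul (z ^ 4) ^ 8"
    unfolding e2_def pz e4_def by (simp flip: power_mult)
  hence "complex_of_real (theta_f q ^ 8 - theta_f (- q) ^ 8) = complex_of_real (16 * q * theta_f (- (q ^ 4)) ^ 8)"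
    unfolding z_def using q by (simp add: of_real_theta_f of_real_theta_f' pow_lt_1 pow_lt_1')
  thus ?thesis by (simp only: of_real_eq_iff)
qed

text \<open>The partial products lie between 0 and 1 and are at least 1 minus the partial geometric
  sum. These bounds feed the estimates that later separate the roots.\<close>

lemma theta_f_bounds:
  assumes q: "0 < q" "q < 1"
  shows "theta_f (- q) > 0" "theta_f (- q) \<le> 1" "1 - q / (1 - q) \<le> theta_f (- q)"
proof -
  define P where "P N = (\<Prod>k<N. 1 - q ^ Suc k)" for N
  have "complex_of_real (P N) = qpoch (of_real q) N" for N by (simp add: qpoch_def P_def)
  hence "(\<lambda>N. complex_of_real (P N)) \<longlonglongrightarrow> complex_of_real (theta_f (- q))"
    using qpoch_LIMSEQ[of "of_real q"] q by (simp add: of_real_theta_f)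
  hence lim: "P \<longlonglongrightarrow> theta_f (- q)" by (simp only: tendsto_of_real_iff)
  have le1: "q ^ k \<le> 1" for k using q by (simp add: power_le_one)
  have P01: "0 \<le> P N" "P N \<le> 1" for N
    unfolding P_def using q le1 by (auto intro!: prod_nonneg prod_le_1 simp del: power_Suc)
  have "theta_f (- q) \<ge> 0" by (rule LIMSEQ_le_const[OF lim]) (use P01 in auto)
  moreover have "theta_f (- q) \<noteq> 0"
    using of_real_theta_f[of q] eul_nz[of "of_real q"] q by auto
  ultimately show "theta_f (- q) > 0" by simp
  show "theta_f (- q) \<le> 1" by (rule LIMSEQ_le_const2[OF lim]) (use P01 in auto)
  have "1 - q / (1 - q) \<le> P N" for N
  proof -
    have geo: "(\<Sum>k<N. q ^ Suc k) \<le> q / (1 - q)" for N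
    proof -
      have "(\<Sum>k<N. q ^ Suc k) = q * ((1 - q ^ N) / (1 - q))"
        using q by (simp add: sum_distrib_left[symmetric] sum_gp_strict)
      also have "\<dots> \<le> q * (1 / (1 - q))"
        using q by (intro mult_left_mono divide_right_mono) auto
      finally show ?thesis by simp
    qed
    have "1 - (\<Sum>k<N. q ^ Suc k) \<le> P N"
    proof (induction N)
      case (Suc N)
      have "P (Suc N) = P N - P N * q ^ Suc N" by (simp add: P_def algebra_simps)
      moreover have "P N * q ^ Suc N \<le> 1 * q ^ Suc N" using P01 q by (intro mult_right_mono) auto
      ultimately show ?case using Suc.IH by (simp del: power_Suc)
    qed (simp add: P_def)
    thus ?thesis using geo[of N] by linarith
  qed
  thus "1 - q / (1 - q) \<le> theta_f (- q)" by (intro LIMSEQ_le_const[OF lim]) auto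
qed

text \<open>All other factors in \<open>theta_f_product\<close> are positive, which fixes the sign
  of f(q).\<close>

lemma theta_f_pos:
  assumes q: "0 < q" "q < 1"
  shows "theta_f q > 0"
proof -
  have p: "0 < q ^ n" "q ^ n < 1" if "n > 0" for n using q that by (auto simp: power_less_one_iff)
  have "theta_f (- q) * theta_f q * theta_f (- (q ^ 4)) > 0"
    using theta_f_product[of q] q theta_f_bounds(1)[OF p[of 2]] by simp
  thus ?thesis using theta_f_bounds(1)[OF q] theta_f_bounds(1)[OF p[of 4]]
    by (simp add: zero_less_mult_iff)
qed

section \<open>From theta functions to eta quotients\<close>

definition eta_tw :: "real \<Rightarrow> real" where
  "eta_tw s = exp (- pi * s / 24) * theta_f (exp (- pi * s))"

lemma eta_im_half: "eta_im (s / 2) = exp (- pi * s / 24) * theta_f (- exp (- pi * s))"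
  by (simp add: eta_im_def)

lemma eta_pos:
  assumes "s > 0"
  shows "eta_im s > 0" "eta_tw s > 0"
  using theta_f_bounds(1)[of "exp (- 2 * pi * s)"] theta_f_pos[of "exp (- pi * s)"] assms
  by (auto simp: eta_im_def eta_tw_def)

lemma exp_nat_mult: "exp (- pi * (real n * s)) = exp (- pi * s) ^ n"
  "exp (- pi * (real n * s) / 24) = exp (- pi * s / 24) ^ n"
  by (simp_all add: exp_of_nat_mult[symmetric] mult_ac)

text \<open>With e = exp(-pi s / 24) and q = e^24 every eta value at a multiple is a power of e
  times f at a power of q. An identity for f becomes homogeneous in eta after multiplication by a
  power of e.\<close>

lemma eta_im_nat: "eta_im (real n * s / 2) = exp (- pi * s / 24) ^ n * theta_f (- (exp (- pi * s) ^ n))"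
  unfolding eta_im_half exp_nat_mult ..

lemma eta_tw_nat: "eta_tw (real n * s) = exp (- pi * s / 24) ^ n * theta_f (exp (- pi * s) ^ n)"
  unfolding eta_tw_def exp_nat_mult ..

lemma nome24: "exp (- pi * s) = exp (- pi * s / 24) ^ 24"
  by (simp add: exp_of_nat_mult[symmetric])

lemma eta_product:
  assumes s: "s > 0"
  shows "eta_im (s / 2) * eta_tw s * eta_im (2 * s) = eta_im s ^ 3"
proof -
  define e q where "e = exp (- pi * s / 24)" and "q = exp (- pi * s)"
  have q: "q \<noteq> 0" "\<bar>q\<bar> < 1" using s by (auto simp: q_def)
  note n = eta_im_nat[of _ s, folded e_def q_def] eta_tw_nat[of _ s, folded e_def q_def]
  show ?thesis using n(1)[of 1] n(1)[of 2] n(1)[of 4] n(2)[of 1] theta_f_product[OF q]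
    by (simp add: power_mult_distrib flip: power_mult) (simp add: eval_nat_numeral mult_ac)
qed

lemma eta_quartic:
  assumes s: "s > 0"
  shows "eta_tw s ^ 8 = eta_im (s / 2) ^ 8 + 16 * eta_im (2 * s) ^ 8"
proof -
  define e q where "e = exp (- pi * s / 24)" and "q = exp (- pi * s)"
  have q: "q \<noteq> 0" "\<bar>q\<bar> < 1" using s by (auto simp: q_def)
  have qe: "q = e ^ 24" unfolding q_def e_def by (rule nome24)
  note n = eta_im_nat[of _ s, folded e_def q_def] eta_tw_nat[of _ s, folded e_def q_def]
  have "e ^ 8 * theta_f q ^ 8 = e ^ 8 * theta_f (- q) ^ 8 + 16 * (e ^ 8 * q * theta_f (- (q ^ 4)) ^ 8)"
    using theta_f_quartic[OF q] by (simp add: algebra_simps)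
  also have "e ^ 8 * q = e ^ 32" unfolding qe by (simp flip: power_add)
  finally show ?thesis using n(1)[of 1] n(1)[of 4] n(2)[of 1]
    by (simp add: power_mult_distrib flip: power_mult)
qed

lemma eta_cubic:
  assumes s: "s > 0"
  shows "(eta_tw s * eta_tw (3 * s))\<^sup>2 = (eta_im (s / 2) * eta_im (3 * s / 2))\<^sup>2 + 4 * (eta_im (2 * s) * eta_im (6 * s))\<^sup>2"
proof -
  define e q where "e = exp (- pi * s / 24)" and "q = exp (- pi * s)"
  have q: "q \<noteq> 0" "\<bar>q\<bar> < 1" using s by (auto simp: q_def)
  have qe: "q = e ^ 24" unfolding q_def e_def by (rule nome24)
  note n = eta_im_nat[of _ s, folded e_def q_def] eta_tw_nat[of _ s, folded e_def q_def]
  have "e ^ 8 * (theta_f q * theta_f (q ^ 3))\<^sup>2 = e ^ 8 * (theta_f (- q) * theta_f (- (q ^ 3)))\<^sup>2 +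
      4 * (e ^ 8 * q * (theta_f (- (q ^ 4)) * theta_f (- (q ^ 12)))\<^sup>2)"
    using theta_f_cubic[OF q] by (simp add: algebra_simps)
  also have "e ^ 8 * q = e ^ 32" unfolding qe by (simp flip: power_add)
  finally show ?thesis using n(1)[of 1] n(1)[of 4] n(2)[of 1] n(1)[of 3] n(2)[of 3] n(1)[of 12]
    by (simp add: power_mult_distrib mult_ac flip: power_mult)
qed

lemma eta_septic:
  assumes s: "s > 0"
  shows "eta_tw s * eta_tw (7 * s) = eta_im (s / 2) * eta_im (7 * s / 2) + 2 * eta_im (2 * s) * eta_im (14 * s)"
proof -
  define e q where "e = exp (- pi * s / 24)" and "q = exp (- pi * s)"
  have q: "q \<noteq> 0" "\<bar>q\<bar> < 1" using s by (auto simp: q_def)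
  have qe: "q = e ^ 24" unfolding q_def e_def by (rule nome24)
  note n = eta_im_nat[of _ s, folded e_def q_def] eta_tw_nat[of _ s, folded e_def q_def]
  have "e ^ 8 * (theta_f q * theta_f (q ^ 7)) = e ^ 8 * (theta_f (- q) * theta_f (- (q ^ 7))) +
      2 * (e ^ 8 * q * (theta_f (- (q ^ 4)) * theta_f (- (q ^ 28))))"
    using theta_f_septic[OF q] by (simp add: algebra_simps)
  also have "e ^ 8 * q = e ^ 4 * e ^ 28" unfolding qe by (simp flip: power_add)
  also have "e ^ 8 = e * e ^ 7" by (simp flip: power_Suc)
  finally show ?thesis using n(1)[of 1] n(1)[of 4] n(2)[of 1] n(1)[of 7] n(2)[of 7] n(1)[of 28]
    by (simp add: mult_ac)
qed

lemma eta_level9: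
  assumes s: "s > 0"
  shows "eta_im (3 * s) ^ 12 = eta_im (9 * s) ^ 3 * ((eta_im s ^ 3 + 3 * eta_im (9 * s) ^ 3) ^ 3 - 27 * eta_im (9 * s) ^ 9)"
proof -
  define e q where "e = exp (- pi * (2 * s) / 24)" and "q = exp (- pi * (2 * s))"
  have q: "q \<noteq> 0" "\<bar>q\<bar> < 1" using s by (auto simp: q_def)
  have qe: "q = e ^ 24" unfolding q_def e_def by (rule nome24)
  note n = eta_im_nat[of _ "2 * s", folded e_def q_def]
  define a b where "a = theta_f (- q)" and "b = theta_f (- (q ^ 9))"
  have "e ^ 36 * theta_f (- (q ^ 3)) ^ 12 = e ^ 36 * (b ^ 3 * ((a ^ 3 + 3 * q * b ^ 3) ^ 3 - 27 * q ^ 3 * b ^ 9))"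
    using theta_f_level9[OF q] by (simp add: a_def b_def)
  also have "\<dots> = (e ^ 9 * b) ^ 3 * (((e * a) ^ 3 + 3 * (e ^ 9 * b) ^ 3) ^ 3 - 27 * (e ^ 9 * b) ^ 9)"
    unfolding qe by (simp add: algebra_simps power_mult_distrib eval_nat_numeral)
  finally show ?thesis using n[of 1] n[of 3] n[of 9]
    by (simp add: power_mult_distrib a_def b_def flip: power_mult)
qed

text \<open>The level 9 identity for f at -q. Only odd powers of q occur as coefficients, whence the
  changed signs of 3 and 27.\<close>

lemma eta_tw_level9:
  assumes s: "s > 0"
  shows "eta_tw (3 * s) ^ 12 = eta_tw (9 * s) ^ 3 * ((eta_tw s ^ 3 - 3 * eta_tw (9 * s) ^ 3) ^ 3 + 27 * eta_tw (9 * s) ^ 9)"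
proof -
  define e q where "e = exp (- pi * s / 24)" and "q = exp (- pi * s)"
  have q: "- q \<noteq> 0" "\<bar>- q\<bar> < 1" using s by (auto simp: q_def)
  have qe: "q = e ^ 24" unfolding q_def e_def by (rule nome24)
  note n = eta_tw_nat[of _ s, folded e_def q_def]
  define a b where "a = theta_f q" and "b = theta_f (q ^ 9)"
  have "e ^ 36 * theta_f (q ^ 3) ^ 12 = e ^ 36 * (b ^ 3 * ((a ^ 3 - 3 * q * b ^ 3) ^ 3 + 27 * q ^ 3 * b ^ 9))"
    using theta_f_level9[OF q] by (simp add: a_def b_def)
  also have "\<dots> = (e ^ 9 * b) ^ 3 * (((e * a) ^ 3 - 3 * (e ^ 9 * b) ^ 3) ^ 3 + 27 * (e ^ 9 * b) ^ 9)"
    unfolding qe by (simp add: algebra_simps power_mult_distrib eval_nat_numeral)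
  finally show ?thesis using n[of 1] n[of 3] n[of 9]
    by (simp add: power_mult_distrib a_def b_def flip: power_mult)
qed

text \<open>In \<open>eta_product\<close> inversion is known for the three \<open>eta_im\<close>
  values, since it exchanges the roles of s / 2 and 2 s; hence it follows for the remaining
  factor.\<close>

lemma eta_tw_inverse:
  assumes s: "s > 0"
  shows "eta_tw (1 / s) = sqrt s * eta_tw s"
proof -
  have i: "eta_im (1 / s / 2) = sqrt (2 * s) * eta_im (2 * s)" "eta_im (2 * (1 / s)) = sqrt (s / 2) * eta_im (s / 2)"
    "eta_im (1 / s) = sqrt s * eta_im s"
    using eta_im_inverse[of "2 * s"] eta_im_inverse[of "s / 2"] eta_im_inverse[of s] s by (simp_all add: mult.commute)
  have ss: "sqrt (2 * s) * sqrt (s / 2) = s" using s by (simp add: real_sqrt_mult[symmetric])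
  have "(sqrt (2 * s) * sqrt (s / 2)) * (eta_im (2 * s) * eta_im (s / 2) * eta_tw (1 / s)) = sqrt s ^ 3 * eta_im s ^ 3"
    using eta_product[of "1 / s"] s unfolding i by (simp add: power_mult_distrib mult_ac)
  also have "sqrt s ^ 3 = s * sqrt s" using s by (simp add: power3_eq_cube)
  finally have "eta_im (2 * s) * eta_im (s / 2) * eta_tw (1 / s) = eta_im (2 * s) * eta_im (s / 2) * (sqrt s * eta_tw s)"
    unfolding ss eta_product[OF s, symmetric] using s by (simp add: mult_ac)
  thus ?thesis using eta_pos[of "2 * s"] eta_pos[of "s / 2"] s by simp
qed

section \<open>Solving the modular equations\<close>

text \<open>Here a, b belong to sqrt 7 and c, d, V to the second point. \<open>S\<close> follows
  from the sum and product of a c and b d, and swapping a and b turns it into \<open>T\<close>. So S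
  + T and S T are symmetric and known in terms of V, which is one condition too many and yields an
  equation for V.\<close>

lemma weber_quartic:
  fixes a b c d V w :: real
  assumes ab: "a * b = 1" "a ^ 4 + b ^ 4 = 16" and cd: "c * d * V = 2" "c ^ 4 + d ^ 4 = V ^ 4"
    and sum: "a * c + b * d = 2 * V" and w: "w > 0" "V ^ 3 = 8 * w\<^sup>2"
  shows "w ^ 4 - 8 * w ^ 3 + w + 1 = 0"
proof -
  define x y z where "x = a * c" and "y = b * d" and "z = V ^ 3"
  define S T where "S = x ^ 4 + y ^ 4" and "T = (a * d) ^ 4 + (b * c) ^ 4"
  have xyV: "x * y * V = 2"
  proof -
    have "x * y * V = (a * b) * (c * d * V)" by (simp add: x_def y_def mult_ac)
    thus ?thesis using ab cd by simp
  qed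
  have xy: "x + y = 2 * V" using sum by (simp add: x_def y_def)
  have "V\<^sup>2 * S = (V * (x + y)\<^sup>2 - 2 * (x * y * V))\<^sup>2 - 2 * (x * y * V)\<^sup>2"
    by (simp add: S_def algebra_simps eval_nat_numeral)
  also have "\<dots> = 16 * z\<^sup>2 - 32 * z + 8"
    unfolding xy xyV z_def by (simp add: algebra_simps eval_nat_numeral)
  finally have S: "V\<^sup>2 * S = 16 * z\<^sup>2 - 32 * z + 8" .
  have "S + T = (a ^ 4 + b ^ 4) * (c ^ 4 + d ^ 4)"
    by (simp add: S_def T_def x_def y_def power_mult_distrib algebra_simps)
  hence "S + T = 16 * V ^ 4" unfolding ab cd .
  hence "V\<^sup>2 * S + V\<^sup>2 * T = 16 * z\<^sup>2" unfolding z_def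
    by (simp add: distrib_left[symmetric] flip: power_mult power_add)
  hence T: "V\<^sup>2 * T = 32 * z - 8" using S by simp
  have "(V\<^sup>2 * S) * (V\<^sup>2 * T) = (c * d * V) ^ 4 * ((a ^ 4 + b ^ 4)\<^sup>2 - 2 * (a * b) ^ 4)
      + V ^ 4 * (a * b) ^ 4 * (c ^ 4 + d ^ 4)\<^sup>2 - 2 * (a * b) ^ 4 * (c * d * V) ^ 4"
    by (simp add: S_def T_def x_def y_def power_mult_distrib algebra_simps eval_nat_numeral)
  also have "\<dots> = z ^ 4 + 4032" unfolding ab cd z_def by (simp flip: power_mult power_add)
  finally have "z ^ 4 + 4032 = (16 * z\<^sup>2 - 32 * z + 8) * (32 * z - 8)" unfolding S T ..
  hence "z ^ 4 + 4032 - (16 * z\<^sup>2 - 32 * z + 8) * (32 * z - 8) = 0" by simp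
  \<comment> \<open>With z = 8 w^2 the polynomial is even in \<open>w\<close>; it splits into the
    quartic and its image under w -> -w, which is positive for w > 0.\<close>
  moreover have "z ^ 4 + 4032 - (16 * z\<^sup>2 - 32 * z + 8) * (32 * z - 8)
      = 4096 * ((w ^ 4 - 8 * w ^ 3 + w + 1) * (w ^ 4 + 8 * w ^ 3 - w + 1))"
    unfolding z_def w by (simp add: algebra_simps eval_nat_numeral)
  ultimately have "(w ^ 4 - 8 * w ^ 3 + w + 1) * (w ^ 4 + 8 * w ^ 3 - w + 1) = 0" by simp
  moreover have "w ^ 4 + 8 * w ^ 3 - w + 1 > 0"
  proof (cases "w \<le> 1")
    case True
    have "w ^ 4 + 8 * w ^ 3 > 0" using w by (intro add_pos_pos) auto
    thus ?thesis using True by linarith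
  next
    case False
    have "w ^ 4 + 7 * w ^ 3 > 0" using w by (intro add_pos_pos) auto
    moreover have "w ^ 1 \<le> w ^ 3" using False by (intro power_increasing) auto
    ultimately show ?thesis by simp
  qed
  ultimately show ?thesis by simp
qed

text \<open>Modulo g^2 = 21 the quartic is a product of two quadratics. The second has positive
  coefficients because 4 < g < 5; \<open>D\<close> is the root of the discriminant (4 + g)^2 - 2 (5
  + g) of the first.\<close>

lemma weber_roots:
  fixes w g D :: real
  assumes g: "g * g = 21" "g > 4" and D: "D * D = 27 + 6 * g"
    and w: "w > 0" "w ^ 4 - 8 * w ^ 3 + w + 1 = 0" and g5: "g < 5"
  shows "w = (4 + g + D) / 2 \<or> w = (4 + g - D) / 2"
proof -
  have "w ^ 4 - 8 * w ^ 3 + w + 1 = (w\<^sup>2 - (4 + g) * w + (5 + g) / 2) * (w\<^sup>2 + (g - 4) * w + (5 - g) / 2)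
      + (g * g - 21) * (w\<^sup>2 - w + 1/4)"
    by (simp add: field_simps eval_nat_numeral)
  hence "(w\<^sup>2 - (4 + g) * w + (5 + g) / 2) * (w\<^sup>2 + (g - 4) * w + (5 - g) / 2) = 0"
    using w g by simp
  moreover have "w\<^sup>2 + (g - 4) * w + (5 - g) / 2 > 0"
    using w g g5 by (intro add_pos_pos mult_pos_pos) auto
  ultimately have "w\<^sup>2 - (4 + g) * w + (5 + g) / 2 = 0" by simp
  moreover have "(w - (4 + g + D) / 2) * (w - (4 + g - D) / 2) =
      w\<^sup>2 - (4 + g) * w + (5 + g) / 2 + (27 + 6 * g - D * D) / 4 + (g * g - 21) / 4"
    by (simp add: field_simps power2_eq_square)
  ultimately have "(w - (4 + g + D) / 2) * (w - (4 + g - D) / 2) = 0" using g D by simp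
  thus ?thesis by auto
qed

lemma sqrt21_bounds:
  fixes g D :: real
  defines "g \<equiv> sqrt 21" and "D \<equiv> sqrt (27 + 6 * g)"
  shows "g * g = 21" "D * D = 27 + 6 * g" "4.58 < g" "g < 4.6" "7.38 < D" "D < 7.4"
proof -
  show gg: "g * g = 21" by (simp add: g_def)
  show g1: "4.58 < g" unfolding g_def by (rule real_less_rsqrt) (simp add: power2_eq_square)
  show g2: "g < 4.6" unfolding g_def by (rule real_less_lsqrt) (simp_all add: power2_eq_square)
  show "D * D = 27 + 6 * g" using g1 by (simp add: D_def)
  show "7.38 < D" unfolding D_def using g1 by (intro real_less_rsqrt) (simp add: power2_eq_square)
  show "D < 7.4" unfolding D_def using g1 g2 by (intro real_less_lsqrt) (simp_all add: power2_eq_square)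
qed

text \<open>The base is sqrt 3 times the claimed value of r_{7,9}, denested. Its powers are written
  in the basis 1, g, D, g D.\<close>

lemma rho_powers:
  fixes g D :: real
  defines "g \<equiv> sqrt 21" and "D \<equiv> sqrt (27 + 6 * g)"
  shows "((9 + g + (g - 3) * D) / 4) ^ 2 = 39/4 + 9/4 * g - 3/4 * D + 3/4 * (g * D)"
    and "((9 + g + (g - 3) * D) / 4) ^ 3 = 243/4 + 57/4 * g + 27/4 * D + 9/4 * (g * D)"
proof -
  note b = sqrt21_bounds[folded g_def, folded D_def]
  have kk: "g * (g * x) = 21 * x" "D * (D * x) = (27 + 6 * g) * x" for x
    using b(1,2) by (simp_all flip: mult.assoc)
  define r where "r = (9 + g + (g - 3) * D) / 4"
  have 2: "r ^ 2 = 39/4 + 9/4 * g - 3/4 * D + 3/4 * (g * D)"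
    unfolding r_def by (simp add: power2_eq_square algebra_simps kk b(1,2) add_divide_distrib diff_divide_distrib)
  have "r ^ 3 = r * r ^ 2" by (simp add: power3_eq_cube power2_eq_square)
  also have "\<dots> = 243/4 + 57/4 * g + 27/4 * D + 9/4 * (g * D)"
    unfolding 2 unfolding r_def by (simp add: algebra_simps kk b(1,2) add_divide_distrib diff_divide_distrib)
  finally have 3: "r ^ 3 = 243/4 + 57/4 * g + 27/4 * D + 9/4 * (g * D)" .
  show "((9 + g + (g - 3) * D) / 4) ^ 2 = 39/4 + 9/4 * g - 3/4 * D + 3/4 * (g * D)" using 2 by (simp only: r_def)
  show "((9 + g + (g - 3) * D) / 4) ^ 3 = 243/4 + 57/4 * g + 27/4 * D + 9/4 * (g * D)" using 3 by (simp only: r_def)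
qed

text \<open>
  After division by \<open>X\<close> the last assumption is a quadratic equation over the field generated by \<open>g\<close> and \<open>D\<close>;
  its other root is about 45, so the lower bound on \<open>X\<close> excludes it.
\<close>

lemma level9_solve:
  fixes g D w w' X :: real
  defines "g \<equiv> sqrt 21" and "D \<equiv> sqrt (27 + 6 * g)"
  assumes w: "w > 1" "w ^ 4 - 8 * w ^ 3 + w + 1 = 0" and w': "w' > 0" "w' ^ 4 - 8 * w' ^ 3 + w' + 1 = 0"
    and X: "X \<ge> 64"
    and eq: "(X * (w' / w) - 3) ^ 3 + 27 = ((X + 3) ^ 3 - 27) / w ^ 4"
  shows "w = (4 + g + D) / 2" "w' = (4 + g - D) / 2" "X = ((9 + g + (g - 3) * D) / 4) ^ 3"
proof -
  note b = sqrt21_bounds[folded g_def, folded D_def]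
  have kk: "g * (g * x) = 21 * x" "D * (D * x) = (27 + 6 * g) * x" for x
    using b(1,2) by (simp_all flip: mult.assoc)
  have w': "w' > 0" "w' = (4 + g + D) / 2 \<or> w' = (4 + g - D) / 2"
    using weber_roots[of g D w'] w' b by auto
  show wval: "w = (4 + g + D) / 2"
    using weber_roots[of g D w] w b by auto
  have X0: "X \<noteq> 0" "w \<noteq> 0" using X w by auto
  have "X * (w' * w * (X\<^sup>2 * w'\<^sup>2 - 9 * X * (w * w') + 27 * w\<^sup>2)) = w ^ 4 * ((X * (w' / w) - 3) ^ 3 + 27)"
    using X0 by (simp add: field_simps eval_nat_numeral)
  also have "\<dots> = X * (X\<^sup>2 + 9 * X + 27)"
  proof -
    have "w ^ 4 * (Y / w ^ 4) = Y" for Y using X0 by simp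
    thus ?thesis unfolding eq by (simp only:) (simp add: algebra_simps eval_nat_numeral)
  qed
  finally have E: "w' * w * (X\<^sup>2 * w'\<^sup>2 - 9 * X * (w * w') + 27 * w\<^sup>2) = X\<^sup>2 + 9 * X + 27"
    using X0 by simp
  show w'val: "w' = (4 + g - D) / 2"
  proof (rule ccontr)
    assume "w' \<noteq> (4 + g - D) / 2"
    \<comment> \<open>Equal roots would put the factor w^4 >= 16 in front of X^2 - 9 X + 27, too
      much for X >= 64.\<close>
    hence "w' = w" using w' wval by auto
    hence "w ^ 4 * (X\<^sup>2 - 9 * X + 27) = X\<^sup>2 + 9 * X + 27"
      using E by (simp add: algebra_simps eval_nat_numeral)
    moreover have "w \<ge> 2" using wval b by simp
    hence "2 ^ 4 \<le> w ^ 4" by (intro power_mono) auto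
    moreover have p: "X\<^sup>2 - 9 * X + 27 > 0"
    proof -
      have "X * (X - 9) \<ge> 0" using X by (intro mult_nonneg_nonneg) auto
      thus ?thesis by (simp add: power2_eq_square algebra_simps)
    qed
    ultimately have "16 * (X\<^sup>2 - 9 * X + 27) \<le> X\<^sup>2 + 9 * X + 27"
      using mult_right_mono[of "2 ^ 4" "w ^ 4" "X\<^sup>2 - 9 * X + 27"] by simp
    moreover have "64 * X \<le> X\<^sup>2" using X by (simp add: power2_eq_square)
    ultimately show False using X by simp
  qed
  define m where "m = (5 + g) / 2"
  have m: "w * w' = m" unfolding wval w'val m_def using b by (simp add: field_simps)
  \<comment> \<open>The expected root, in the basis 1, g, D, g D. Verifying it and splitting off X -
    R avoids taking a square root over this field.\<close>
  define R where "R = 243/4 + 57/4 * g + 27/4 * D + 9/4 * (g * D)"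
  have R: "R = ((9 + g + (g - 3) * D) / 4) ^ 3"
    using rho_powers(2) unfolding R_def g_def D_def by simp
  have RR: "R * R = 63531/4 + 13851/4 * g + 8667/4 * D + 1863/4 * (g * D)"
    unfolding R_def by (simp add: algebra_simps kk b(1,2) add_divide_distrib diff_divide_distrib)
  have c1: "m * w'\<^sup>2 = 307/4 + 67/4 * g - 41/4 * D - 9/4 * (g * D)"
    unfolding m_def w'val by (simp add: power2_eq_square algebra_simps kk b(1,2) add_divide_distrib diff_divide_distrib)
  have c2: "m * w\<^sup>2 = 307/4 + 67/4 * g + 41/4 * D + 9/4 * (g * D)"
    unfolding m_def wval by (simp add: power2_eq_square algebra_simps kk b(1,2) add_divide_distrib diff_divide_distrib)
  have c3: "m * m + 1 = 25/2 + 5/2 * g"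
    unfolding m_def by (simp add: algebra_simps kk b(1,2) add_divide_distrib)
  have Q: "(m * w'\<^sup>2 - 1) * Y\<^sup>2 - 9 * (m * m + 1) * Y + 27 * (m * w\<^sup>2 - 1) =
     (w' * w * (Y\<^sup>2 * w'\<^sup>2 - 9 * Y * (w * w') + 27 * w\<^sup>2)) - (Y\<^sup>2 + 9 * Y + 27)" for Y
    unfolding m mult.commute[of w' w] by (simp add: algebra_simps)
  have QX: "(m * w'\<^sup>2 - 1) * X\<^sup>2 - 9 * (m * m + 1) * X + 27 * (m * w\<^sup>2 - 1) = 0"
    unfolding Q E by simp
  have QR: "(m * w'\<^sup>2 - 1) * (R * R) - 9 * (m * m + 1) * R + 27 * (m * w\<^sup>2 - 1) = 0"
    unfolding RR c1 c2 c3 R_def by (simp add: algebra_simps kk b(1,2) add_divide_distrib diff_divide_distrib)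
  have "(X - R) * ((m * w'\<^sup>2 - 1) * (X + R) - 9 * (m * m + 1)) = 0"
    using QX QR by (simp add: algebra_simps power2_eq_square)
  \<comment> \<open>This factor would vanish if \<open>X\<close> were the other root; the bounds
    give more than 227 against less than 217.\<close>
  moreover have "(m * w'\<^sup>2 - 1) * (X + R) - 9 * (m * m + 1) > 0"
  proof -
    \<comment> \<open>The separate bounds on \<open>g\<close> and \<open>D\<close> give only 0.59,
      too weak for the estimate below; comparing D with 2.8 + g gives 0.6.\<close>
    have "w' \<ge> 0.6"
    proof -
      have "D \<le> 2.8 + g"
        by (rule power2_le_imp_le) (use b in \<open>auto simp: power2_eq_square algebra_simps\<close>)
      thus ?thesis unfolding w'val by simp
    qed
    hence "0.36 \<le> w'\<^sup>2" using power_mono[of "0.6" w' 2] by (simp add: power2_eq_square)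
    hence "4.79 * 0.36 \<le> m * w'\<^sup>2" using b by (intro mult_mono) (auto simp: m_def)
    hence 1: "0.7244 \<le> m * w'\<^sup>2 - 1" by simp
    have "1.58 * 7.38 \<le> (g - 3) * D" using b by (intro mult_mono) auto
    hence "6.3 \<le> (9 + g + (g - 3) * D) / 4" using b by simp
    hence "6.3 ^ 3 \<le> R" unfolding R by (intro power_mono) auto
    hence 2: "314 \<le> X + R" using X by (simp add: power3_eq_cube)
    have "0.7244 * 314 \<le> (m * w'\<^sup>2 - 1) * (X + R)" using 1 2 by (intro mult_mono) auto
    moreover have "9 * (m * m + 1) < 217" unfolding c3 using b by simp
    ultimately show ?thesis by simp
  qed
  ultimately show "X = ((9 + g + (g - 3) * D) / 4) ^ 3" unfolding R[symmetric] by simp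
qed

text \<open>The squares of Weber's functions \<open>f\<^sub>1\<close>, \<open>f\<^sub>2\<close> and \<open>f\<close> at \<open>i s\<close>.\<close>

definition weber_f1 :: "real \<Rightarrow> real" where "weber_f1 s = (eta_im (s / 2) / eta_im s)\<^sup>2"
definition weber_f2 :: "real \<Rightarrow> real" where "weber_f2 s = 2 * (eta_im (2 * s) / eta_im s)\<^sup>2"
definition weber_f :: "real \<Rightarrow> real" where "weber_f s = (eta_tw s / eta_im s)\<^sup>2"

text \<open>Weber's classical relations and his modular equation of degree 3. The factor 2 in
  \<open>weber_f2\<close> absorbs the constants 16 and 4 of the eta identities.\<close>

lemma weber_relations:
  assumes s: "s > 0"
  shows "weber_f1 s * weber_f2 s * weber_f s = 2" "weber_f1 s ^ 4 + weber_f2 s ^ 4 = weber_f s ^ 4"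
    "weber_f1 s * weber_f1 (3 * s) + weber_f2 s * weber_f2 (3 * s) = weber_f s * weber_f (3 * s)"
proof -
  have p: "eta_im s > 0" "eta_im (3 * s) > 0" using eta_pos(1)[of s] eta_pos(1)[of "3 * s"] s by auto
  have "weber_f1 s * weber_f2 s * weber_f s = 2 * ((eta_im (s / 2) * eta_tw s * eta_im (2 * s)) / eta_im s ^ 3)\<^sup>2"
    by (simp add: weber_f1_def weber_f2_def weber_f_def power_divide power_mult_distrib flip: power_mult)
  thus "weber_f1 s * weber_f2 s * weber_f s = 2" unfolding eta_product[OF s] using p by simp
  have "weber_f1 s ^ 4 + weber_f2 s ^ 4 = (eta_im (s / 2) ^ 8 + 16 * eta_im (2 * s) ^ 8) / eta_im s ^ 8"
    by (simp add: weber_f1_def weber_f2_def power_divide power_mult_distrib add_divide_distrib flip: power_mult)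
  thus "weber_f1 s ^ 4 + weber_f2 s ^ 4 = weber_f s ^ 4"
    unfolding eta_quartic[OF s, symmetric] by (simp add: weber_f_def power_divide flip: power_mult)
  have "weber_f1 s * weber_f1 (3 * s) + weber_f2 s * weber_f2 (3 * s) =
     ((eta_im (s / 2) * eta_im (3 * s / 2))\<^sup>2 + 4 * (eta_im (2 * s) * eta_im (6 * s))\<^sup>2) / (eta_im s * eta_im (3 * s))\<^sup>2"
    by (simp add: weber_f1_def weber_f2_def power_divide power_mult_distrib add_divide_distrib)
  thus "weber_f1 s * weber_f1 (3 * s) + weber_f2 s * weber_f2 (3 * s) = weber_f s * weber_f (3 * s)"
    unfolding eta_cubic[OF s, symmetric] by (simp add: weber_f_def power_divide power_mult_distrib)
qed

text \<open>In \<open>eta_septic\<close> at 1 / sqrt 7 inversion makes both terms on the right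
  multiples of eta(sqrt 7 / 2) eta(2 sqrt 7). One more factor \<open>T\<close> completes the product
  in \<open>eta_product\<close> and leaves an equation between cubes.\<close>

lemma eta_tw_sqrt7: "eta_tw (sqrt 7) = sqrt 2 * eta_im (sqrt 7)"
proof -
  define s where "s = sqrt (7 :: real)"
  have s: "s > 0" "7 * (1 / s) = s" "7 * (1 / s) / 2 = s / 2" "14 * (1 / s) = 2 * s"
    by (auto simp: s_def field_simps)
  define H T a b where "H = eta_im s" and "T = eta_tw s" and "a = eta_im (s / 2)" and "b = eta_im (2 * s)"
  have pos: "H > 0" "T > 0" "a > 0" "b > 0"
    unfolding H_def T_def a_def b_def using s by (auto intro!: eta_pos)
  have i: "eta_tw (1 / s) = sqrt s * T" "eta_im (1 / s / 2) = sqrt (2 * s) * b" "eta_im (2 * (1 / s)) = sqrt (s / 2) * a"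
    using eta_tw_inverse[of s] eta_im_inverse[of "2 * s"] eta_im_inverse[of "s / 2"] s
    by (simp_all add: mult.commute T_def b_def a_def)
  have "sqrt s * T * T = sqrt (2 * s) * b * a + 2 * (sqrt (s / 2) * a) * b"
    using eta_septic[of "1 / s"] s(1) unfolding i s(2,3,4) by (simp add: T_def a_def b_def)
  also have "sqrt (2 * s) = sqrt 2 * sqrt s" by (simp add: real_sqrt_mult)
  also have "sqrt (s / 2) = sqrt s / sqrt 2" by (simp add: real_sqrt_divide)
  also have "sqrt 2 * sqrt s * b * a + 2 * (sqrt s / sqrt 2 * a) * b = sqrt s * (2 * sqrt 2 * (a * b))"
    by (simp add: field_simps)
  finally have "T * T = 2 * sqrt 2 * (a * b)" using s(1) by simp
  hence "T ^ 3 = 2 * sqrt 2 * (a * T * b)" by (simp add: power3_eq_cube)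
  also have "a * T * b = H ^ 3" using eta_product[OF s(1)] by (simp add: a_def T_def b_def H_def)
  also have "2 * sqrt 2 * H ^ 3 = (sqrt 2 * H) ^ 3" by (simp add: power_mult_distrib) (simp add: power3_eq_cube)
  finally have "T = sqrt 2 * H" by (rule power_eq_imp_eq_base) (use pos in auto)
  thus ?thesis by (simp add: T_def H_def s_def)
qed

section \<open>The evaluations\<close>

text \<open>The power of q in the definition is exactly the quotient of the exponential prefactors
  of the two eta values.\<close>

lemma ram_r_eta:
  assumes "k > 0" "n > 0"
  shows "ram_r k n = eta_im (sqrt (n / k)) / (k powr (1/4) * eta_im (k * sqrt (n / k)))"
proof -
  define \<sigma> where "\<sigma> = sqrt (n / k)"
  define q where "q = exp (- 2 * pi * \<sigma>)"
  have qk: "q powr k = exp (- 2 * pi * (k * \<sigma>))" by (simp add: q_def exp_powr_real mult_ac)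
  have "exp (- pi * (k * \<sigma>) / 12) = exp (- pi * \<sigma> / 12) * q powr ((k - 1) / 24)"
    unfolding q_def exp_powr_real exp_add[symmetric] by (simp add: field_simps)
  hence "eta_im (k * \<sigma>) = exp (- pi * \<sigma> / 12) * (q powr ((k - 1) / 24) * theta_f (- (q powr k)))"
    unfolding eta_im_def qk by (simp add: mult_ac)
  moreover have "eta_im \<sigma> = exp (- pi * \<sigma> / 12) * theta_f (- q)" by (simp add: eta_im_def q_def)
  ultimately show ?thesis
    unfolding ram_r_def Let_def \<sigma>_def[symmetric] q_def[symmetric] by (simp add: mult_ac)
qed

lemma ram_r'_eta:
  assumes "k > 0" "n > 0"
  shows "ram_r' k n = eta_tw (sqrt (n / k)) / (k powr (1/4) * eta_tw (k * sqrt (n / k)))"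
proof -
  define \<sigma> where "\<sigma> = sqrt (n / k)"
  define q where "q = exp (- pi * \<sigma>)"
  have qk: "q powr k = exp (- pi * (k * \<sigma>))" by (simp add: q_def exp_powr_real mult_ac)
  have "exp (- pi * (k * \<sigma>) / 24) = exp (- pi * \<sigma> / 24) * q powr ((k - 1) / 24)"
    unfolding q_def exp_powr_real exp_add[symmetric] by (simp add: field_simps)
  hence "eta_tw (k * \<sigma>) = exp (- pi * \<sigma> / 24) * (q powr ((k - 1) / 24) * theta_f (q powr k))"
    unfolding eta_tw_def qk by (simp add: mult_ac)
  moreover have "eta_tw \<sigma> = exp (- pi * \<sigma> / 24) * theta_f q" by (simp add: eta_tw_def q_def)
  ultimately show ?thesis
    unfolding ram_r'_def Let_def \<sigma>_def[symmetric] q_def[symmetric] by (simp add: mult_ac)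
qed

section \<open>Numerical lower bounds\<close>

lemma exp_minus_le: "x \<ge> 0 \<Longrightarrow> exp (- x) \<le> 1 / (1 + x)" for x :: real
  using exp_ge_add_one_self[of x] by (simp add: exp_minus field_simps)

lemma theta_f_lower:
  assumes "0 < q" "q \<le> 1 / n" "n > 1"
  shows "1 - 1 / (n - 1) \<le> theta_f (- q)"
proof -
  have "1 / n < 1" using assms by simp
  hence q1: "q < 1" using assms by linarith
  have "q / (1 - q) \<le> 1 / (n - 1)" using assms q1 by (simp add: field_simps)
  thus ?thesis using theta_f_bounds(3)[of q] assms q1 by linarith
qed

text \<open>Used at 3 sqrt 7 to get \<open>w > 1\<close>. By \<open>eta_quartic\<close> the value
  \<open>eta_tw s\<close> is at least \<open>eta_im (s / 2)\<close>, whose quotient by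
  \<open>eta_im s\<close> is about exp(pi s / 24).\<close>

lemma weber_f_lower:
  assumes s: "s \<ge> 6"
  shows "weber_f s > 2"
proof -
  define q where "q = exp (- pi * s)"
  have ps: "pi * s \<ge> 18" using pi_gt3 s mult_mono[of 3 pi 6 s] by simp
  have q: "0 < q" "q < 1" "0 < q\<^sup>2" "q\<^sup>2 < 1" using s by (auto simp: q_def power_less_one_iff)
  have q19: "q \<le> 1 / 19"
  proof -
    have "q = exp (- (pi * s))" by (simp add: q_def)
    also have "\<dots> \<le> 1 / (1 + pi * s)" using ps by (intro exp_minus_le) auto
    also have "\<dots> \<le> 1 / 19" using ps by (intro frac_le) auto
    finally show ?thesis .
  qed
  have e: "eta_im (s / 2) = exp (- pi * s / 24) * theta_f (- q)" "eta_im s = exp (- pi * s / 12) * theta_f (- (q\<^sup>2))"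
    by (simp_all add: eta_im_def q_def power2_eq_square exp_add[symmetric] mult.assoc)
  have pos: "eta_im s > 0" "eta_tw s > 0" "eta_im (s / 2) > 0" using s by (auto intro!: eta_pos)
  have "eta_im (s / 2) ^ 8 \<le> eta_tw s ^ 8" using eta_quartic[of s] s by simp
  hence tw: "eta_im (s / 2) \<le> eta_tw s"
    using pos power_mono_iff[of "eta_im (s / 2)" "eta_tw s" 8] by simp
  have "(3 / 2) * eta_im s \<le> (3 / 2) * exp (- pi * s / 12)"
    unfolding e using theta_f_bounds(2)[OF q(3,4)] by simp
  also have "3 / 2 \<le> exp (pi * s / 24) * theta_f (- q)"
  proof -
    have "7 / 4 \<le> exp (pi * s / 24)" using exp_ge_add_one_self[of "pi * s / 24"] ps by linarith
    moreover have "17 / 18 \<le> theta_f (- q)" using theta_f_lower[of q 19] q q19 by simp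
    ultimately have "(7 / 4) * (17 / 18) \<le> exp (pi * s / 24) * theta_f (- q)" by (intro mult_mono) auto
    thus ?thesis by simp
  qed
  hence "(3 / 2) * exp (- pi * s / 12) \<le> (exp (pi * s / 24) * theta_f (- q)) * exp (- pi * s / 12)"
    by (intro mult_right_mono) auto
  also have "\<dots> = (exp (pi * s / 24) * exp (- pi * s / 12)) * theta_f (- q)" by simp
  also have "exp (pi * s / 24) * exp (- pi * s / 12) = exp (- pi * s / 24)" by (simp add: exp_add[symmetric])
  also have "\<dots> * theta_f (- q) = eta_im (s / 2)" using e by simp
  finally have "3 / 2 \<le> eta_tw s / eta_im s" using tw pos by (simp add: field_simps)
  hence "(3 / 2) ^ 2 \<le> weber_f s" unfolding weber_f_def by (intro power_mono) auto
  thus ?thesis by (simp add: power2_eq_square)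
qed

text \<open>Used at sqrt 7 / 3, just above 0.88; the cube of 4 exceeds the unwanted root of the
  level 9 quadratic. The prefactors have quotient exp(2 pi s / 3), for which the linear bound on exp
  would give only 2.76.\<close>

lemma eta_ratio_lower:
  assumes s: "s \<ge> 0.88"
  shows "4 \<le> eta_im s / eta_im (9 * s)"
proof -
  define y where "y = exp (2 * pi * s / 3)"
  define q where "q = exp (- 2 * pi * s)"
  have ps: "2 * pi * s / 3 \<ge> 1.76" using pi_gt3 s mult_mono[of 3 pi "0.88" s] by simp
  have "(1.76::real) * 1.76 \<le> (2 * pi * s / 3) * (2 * pi * s / 3)" using ps by (intro mult_mono) auto
  hence y: "y \<ge> 4.3"
    using exp_lower_Taylor_quadratic[of "2 * pi * s / 3"] ps by (simp add: y_def power2_eq_square)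
  have q: "0 < q" "q < 1" "0 < q ^ 9" "q ^ 9 < 1" using s by (auto simp: q_def power_less_one_iff)
  have "q = 1 / y ^ 3" unfolding q_def y_def exp_of_nat_mult[symmetric] by (simp add: exp_minus field_simps)
  moreover have "4.3 ^ 3 \<le> y ^ 3" using y by (intro power_mono) auto
  ultimately have "q \<le> 1 / 64" using frac_le[of 1 1 64 "y ^ 3"] by (simp add: power3_eq_cube)
  hence th: "62 / 63 \<le> theta_f (- q)" using theta_f_lower[of q 64] q by simp
  have pos: "eta_im s > 0" "eta_im (9 * s) > 0" using s by (auto intro!: eta_pos)
  have "4 * eta_im (9 * s) \<le> 4 * exp (- pi * (9 * s) / 12)"
  proof -
    have "exp (- 2 * pi * (9 * s)) = q ^ 9" by (simp add: q_def exp_of_nat_mult[symmetric])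
    thus ?thesis unfolding eta_im_def using theta_f_bounds(2)[OF q(3,4)] by simp
  qed
  also have "4 \<le> y * theta_f (- q)"
  proof -
    have "4.3 * (62 / 63) \<le> y * theta_f (- q)" using y th by (intro mult_mono) auto
    thus ?thesis by simp
  qed
  hence "4 * exp (- pi * (9 * s) / 12) \<le> (y * theta_f (- q)) * exp (- pi * (9 * s) / 12)"
    by (intro mult_right_mono) auto
  also have "\<dots> = (y * exp (- pi * (9 * s) / 12)) * theta_f (- q)" by simp
  also have "y * exp (- pi * (9 * s) / 12) = exp (- pi * s / 12)"
    by (simp add: y_def exp_add[symmetric] field_simps)
  also have "\<dots> * theta_f (- q) = eta_im s" by (simp add: eta_im_def q_def)
  finally show ?thesis using pos by (simp add: field_simps)
qed

lemma powr_nat_power: "x > 0 \<Longrightarrow> (x powr y) ^ n = x powr (y * real n)" for x :: real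
  by (simp add: powr_power mult.commute)

lemma sqrt_eqI: "y * y = x \<Longrightarrow> y \<ge> 0 \<Longrightarrow> sqrt x = (y::real)"
  by auto

theorem theorem4p3:
  fixes a :: real
  assumes a_def: "a = (100 * sqrt 7 + 200 * sqrt 3) powr (1/6) * (342 + 78 * sqrt 21) powr (1/12)"
  shows "ram_r 3 21 = 20 powr (-1/2)
           * (sqrt (358 + 78 * sqrt 21) + sqrt (342 + 78 * sqrt 21)) powr (1/4) * a
     \<and> ram_r 3 (3/7) = 20 powr (-1/2)
           * (sqrt (358 + 78 * sqrt 21) - sqrt (342 + 78 * sqrt 21)) powr (1/4) * a
     \<and> ram_r' 3 21 = 2 powr (-11/24) * 3 powr (1/8) * (sqrt 7 + sqrt 3) powr (1/12)
           * (sqrt (11 + sqrt 21) + sqrt (3 + sqrt 21)) powr (1/4)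
     \<and> ram_r' 3 (3/7) = 2 powr (-11/24) * 3 powr (1/8) * (sqrt 7 + sqrt 3) powr (1/12)
           * (sqrt (11 + sqrt 21) - sqrt (3 + sqrt 21)) powr (1/4)
     \<and> ram_r 7 9 = (sqrt (34 + 6 * sqrt 21) + sqrt (18 + 6 * sqrt 21)) / 4
     \<and> ram_r' 7 9 = 2 powr (-3/4)
           * (sqrt (11 + sqrt 21) + sqrt (3 + sqrt 21)) powr (1/2)"
proof -
  define g D where "g = sqrt 21" and "D = sqrt (27 + 6 * g)"
  note b = sqrt21_bounds[folded g_def, folded D_def]
  \<comment> \<open>With these rules \<open>K\<close> reduces every product to the basis 1, g, D, g
    D, where coefficients can be compared.\<close>
  have kk: "g * (g * x) = 21 * x" "D * (D * x) = (27 + 6 * g) * x" for x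
    using b(1,2) by (simp_all flip: mult.assoc)
  note K = algebra_simps kk b(1,2) add_divide_distrib diff_divide_distrib
  define s where "s = sqrt (7 :: real)"
  have "s > 2.64" unfolding s_def by (rule real_less_rsqrt) (simp add: power2_eq_square)
  hence s: "s > 0" "s * s = 7" "s > 2.64" by (auto simp: s_def)
  define H H3 Hi T T3 Ti where "H = eta_im s" and "H3 = eta_im (3 * s)" and "Hi = eta_im (s / 3)"
    and "T = eta_tw s" and "T3 = eta_tw (3 * s)" and "Ti = eta_tw (s / 3)"
  have pos: "H > 0" "H3 > 0" "Hi > 0" "T > 0" "T3 > 0" "Ti > 0"
    unfolding H_def H3_def Hi_def T_def T3_def Ti_def using s by (auto intro!: eta_pos)
  have TH: "T = sqrt 2 * H" using eta_tw_sqrt7 by (simp add: T_def H_def s_def)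

  \<comment> \<open>The quartic for w and w'\<close>
  define w w' where "w = (T3 / H3) ^ 3 / (2 * sqrt 2)" and "w' = (Ti / Hi) ^ 3 / (2 * sqrt 2)"
  have wpos: "w > 0" "w' > 0" using pos by (auto simp: w_def w'_def)
  have w2: "weber_f (3 * s) ^ 3 = 8 * w\<^sup>2" "weber_f (s / 3) ^ 3 = 8 * w'\<^sup>2"
    by (simp_all add: weber_f_def w_def w'_def T3_def H3_def Ti_def Hi_def power_divide power_mult_distrib flip: power_mult)
  have v: "weber_f s = 2" using pos TH by (simp add: weber_f_def T_def[symmetric] H_def[symmetric])
  have ab: "weber_f1 s * weber_f2 s = 1" "weber_f1 s ^ 4 + weber_f2 s ^ 4 = 16" using weber_relations(1,2)[OF s(1)] v by simp_all
  have w: "w ^ 4 - 8 * w ^ 3 + w + 1 = 0"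
    using weber_quartic[OF ab weber_relations(1,2)[of "3 * s"] _ wpos(1) w2(1)] weber_relations(3)[OF s(1)] s v by simp
  have w': "w' ^ 4 - 8 * w' ^ 3 + w' + 1 = 0"
    using weber_quartic[OF ab weber_relations(1,2)[of "s / 3"] _ wpos(2) w2(2)] weber_relations(3)[of "s / 3"] s v
    by (simp add: mult.commute)
  have w1: "w > 1"
  proof -
    have "2 ^ 3 < weber_f (3 * s) ^ 3" using weber_f_lower[of "3 * s"] s by (intro power_strict_mono) auto
    hence "1\<^sup>2 < w\<^sup>2" using w2 by simp
    thus ?thesis using wpos by (intro power2_less_imp_less[of 1 w]) auto
  qed

  \<comment> \<open>The level 9 relation\<close>
  define X where "X = (Hi / H3) ^ 3"
  have X64: "X \<ge> 64"
  proof -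
    have "4 \<le> Hi / H3" using eta_ratio_lower[of "s / 3"] s by (simp add: Hi_def H3_def)
    hence "4 ^ 3 \<le> X" unfolding X_def by (intro power_mono) auto
    thus ?thesis by simp
  qed
  have t: "(H / H3) ^ 12 = (X + 3) ^ 3 - 27"
  proof -
    have "H ^ 12 = H3 ^ 3 * ((Hi ^ 3 + 3 * H3 ^ 3) ^ 3 - 27 * H3 ^ 9)"
      using eta_level9[of "s / 3"] s by (simp add: H_def H3_def Hi_def)
    also have "Hi ^ 3 = X * H3 ^ 3" using pos by (simp add: X_def power_divide)
    also have "H3 ^ 3 * ((X * H3 ^ 3 + 3 * H3 ^ 3) ^ 3 - 27 * H3 ^ 9) = ((X + 3) ^ 3 - 27) * H3 ^ 12"
      by (simp add: algebra_simps eval_nat_numeral)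
    finally show ?thesis using pos by (simp add: power_divide)
  qed
  \<comment> \<open>The quotient \<open>w' / w\<close> compares the cubes of \<eta>' / \<eta> at the
    two points, so the twin identity brings no new unknown.\<close>
  have X': "(Ti / T3) ^ 3 = X * (w' / w)"
    using pos by (simp add: X_def w_def w'_def power_divide)
  have t': "(T / T3) ^ 12 = (X * (w' / w) - 3) ^ 3 + 27"
  proof -
    have "T ^ 12 = T3 ^ 3 * ((Ti ^ 3 - 3 * T3 ^ 3) ^ 3 + 27 * T3 ^ 9)"
      using eta_tw_level9[of "s / 3"] s by (simp add: T_def T3_def Ti_def)
    also have "Ti ^ 3 = (X * (w' / w)) * T3 ^ 3" unfolding X'[symmetric] using pos by (simp add: power_divide)
    also have "T3 ^ 3 * (((X * (w' / w)) * T3 ^ 3 - 3 * T3 ^ 3) ^ 3 + 27 * T3 ^ 9) = ((X * (w' / w) - 3) ^ 3 + 27) * T3 ^ 12"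
      by (simp add: algebra_simps eval_nat_numeral)
    finally show ?thesis using pos by (simp add: power_divide)
  qed
  \<comment> \<open>The 12th power of sqrt 2 from \<open>TH\<close> and (2 sqrt 2)^4 from
    \<open>w\<close> are both 64 and cancel.\<close>
  have tt': "(T / T3) ^ 12 = (H / H3) ^ 12 / w ^ 4"
  proof -
    have "sqrt 2 ^ 12 = ((sqrt 2)\<^sup>2) ^ 6" by (simp only: power_mult[symmetric]) simp
    hence s12: "sqrt 2 ^ 12 = (64::real)" by simp
    have "sqrt 2 ^ 4 = ((sqrt 2)\<^sup>2)\<^sup>2" by (simp only: power_mult[symmetric]) simp
    hence "sqrt 2 ^ 4 = (4::real)" by simp
    hence s4: "(2 * sqrt 2) ^ 4 = (64::real)" by (simp add: power_mult_distrib)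
    have "w ^ 4 = (T3 / H3) ^ 12 / 64" unfolding w_def power_divide s4 by (simp flip: power_mult)
    thus ?thesis unfolding TH using pos by (simp add: power_divide power_mult_distrib s12)
  qed
  note sol = level9_solve[folded g_def, folded D_def, OF w1 w wpos(2) w' X64 t'[unfolded tt' t, symmetric]]
  define \<rho> where "\<rho> = (9 + g + (g - 3) * D) / 4"
  have \<rho>2: "\<rho>\<^sup>2 = 39/4 + 9/4 * g - 3/4 * D + 3/4 * (g * D)"
    and \<rho>3: "\<rho> ^ 3 = 243/4 + 57/4 * g + 27/4 * D + 9/4 * (g * D)"
    using rho_powers[folded g_def, folded D_def] by (simp_all only: \<rho>_def)
  have \<rho>pos: "\<rho> > 0" using b by (simp add: \<rho>_def add_pos_nonneg)
  have HiH3: "Hi / H3 = \<rho>"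
    by (rule power_eq_imp_eq_base[of _ 3]) (use sol(3) pos \<rho>pos in \<open>auto simp: X_def \<rho>_def\<close>)
  have Xval: "X = 243/4 + 57/4 * g + 27/4 * D + 9/4 * (g * D)" unfolding X_def HiH3 \<rho>3 ..

  define Y where "Y = X * (w' / w)"
  \<comment> \<open>The quotient \<open>w' / w\<close> with rationalised denominator, certified by
    multiplying back.\<close>
  define c where "c = 13/4 + 3/4 * g + 1/4 * D - 1/4 * (g * D)"
  have "c * w = w'" unfolding c_def sol by (simp add: K)
  hence wc: "w' / w = c" using w1 by (simp add: field_simps)
  have Yval: "Y = 27/4 + 3/4 * g - 9/4 * D + 3/4 * (g * D)"
    unfolding Y_def Xval wc c_def by (simp add: K)
  have Y2: "Y * Y = 351/4 + 81/4 * g - 27/4 * D + 27/4 * (g * D)"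
    unfolding Yval by (simp add: K)
  have Y4: "(Y * Y) * (Y * Y) = 127575/4 + 28431/4 * g + 18225/4 * D + 3645/4 * (g * D)"
    unfolding Y2 by (simp add: K)

  \<comment> \<open>Denesting the radicals of the statement\<close>
  define E F p n where "E = sqrt (358 + 78 * g)" and "F = sqrt (342 + 78 * g)"
    and "p = sqrt (11 + g)" and "n = sqrt (3 + g)"
  have E: "E = 13 + 3 * g" unfolding E_def by (rule sqrt_eqI) (use b in \<open>simp_all add: K\<close>)
  have F: "F = (g - 1) * D" unfolding F_def by (rule sqrt_eqI) (use b in \<open>simp_all add: K\<close>)
  \<comment> \<open>With r^2 = (E + F) / 4, shown below, this makes r^4 the quotient of E + F by E -
    F, so the case 3/7 follows from the case 21 by division.\<close>
  have EF: "(E + F) * (E - F) = 16" unfolding E F by (simp add: K)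
  have EFpos: "E + F > 0" using b unfolding E F by (intro add_pos_pos mult_pos_pos) auto
  have EmFpos: "E - F > 0" using EF EFpos by (metis zero_less_mult_pos zero_less_numeral)
  have pn: "(p + n) * (p - n) = 8" using b by (simp add: p_def n_def algebra_simps)
  have pnpos: "p + n > 0" using b by (simp add: p_def n_def add_pos_pos)
  have pmnpos: "p - n > 0" using pn pnpos by (metis zero_less_mult_pos zero_less_numeral)
  have pn': "p * n = (9 - g) * D / 3"
  proof -
    have "p * n = sqrt ((11 + g) * (3 + g))" by (simp add: p_def n_def real_sqrt_mult)
    also have "\<dots> = (9 - g) * D / 3" by (rule sqrt_eqI) (use b in \<open>simp_all add: K\<close>)
    finally show ?thesis .
  qed
  \<comment> \<open>The fourth power of the claimed value of r'_{7,9}.\<close>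
  define \<kappa> where "\<kappa> = (p + n)\<^sup>2 / 8"
  have \<kappa>: "\<kappa> = 7/4 + 1/4 * g + 3/4 * D - 1/12 * (g * D)"
  proof -
    have "(p + n)\<^sup>2 = (11 + g) + (3 + g) + 2 * (p * n)"
      using b by (simp add: p_def n_def power2_eq_square algebra_simps)
    thus ?thesis unfolding \<kappa>_def pn' by (simp add: K)
  qed
  have \<kappa>2: "\<kappa> * \<kappa> = 31/4 + 7/4 * g + 7/4 * D + 1/12 * (g * D)" unfolding \<kappa> by (simp add: K)
  have \<kappa>3: "\<kappa> ^ 3 = 175/4 + 39/4 * g + 25/4 * D + 5/4 * (g * D)"
    unfolding power3_eq_cube mult.assoc \<kappa>2 unfolding \<kappa> by (simp add: K)

  \<comment> \<open>The six values as eta quotients\<close>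
  define A B A' B' r r' where "A = ram_r 3 21" and "B = ram_r 3 (3/7)" and "A' = ram_r' 3 21"
    and "B' = ram_r' 3 (3/7)" and "r = ram_r 7 9" and "r' = ram_r' 7 9"
  have sq: "sqrt ((3/7) / 3) = 1 / s" "3 * (1 / s) = 1 / (s / 3)" "sqrt (9 / 7) = 1 / (s / 3)" "7 * (1 / (s / 3)) = 3 * s"
    using s by (simp_all add: s_def real_sqrt_divide field_simps)
  have p7: "7 powr (1/4) = sqrt s" by (simp add: s_def powr_half_sqrt[symmetric] powr_powr)
  have ss: "sqrt (s / 3) = sqrt s / sqrt 3" by (simp add: real_sqrt_divide)
  have A: "A = H / (3 powr (1/4) * H3)" unfolding A_def by (simp add: ram_r_eta H_def H3_def s_def)
  have A': "A' = T / (3 powr (1/4) * T3)" unfolding A'_def by (simp add: ram_r'_eta T_def T3_def s_def)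
  have inv: "eta_im (1 / (s / 3)) = sqrt s / sqrt 3 * Hi" "eta_tw (1 / (s / 3)) = sqrt s / sqrt 3 * Ti"
    "eta_im (1 / s) = sqrt s * H" "eta_tw (1 / s) = sqrt s * T"
    using eta_im_inverse[of "s / 3"] eta_tw_inverse[of "s / 3"] eta_im_inverse[of s] eta_tw_inverse[of s] s(1)
    unfolding Hi_def Ti_def H_def T_def ss by simp_all
  have "r = (sqrt s / sqrt 3 * Hi) / (sqrt s * H3)"
    using ram_r_eta[of 7 9] unfolding r_def sq inv p7 H3_def by simp
  hence r: "r = Hi / (sqrt 3 * H3)" using s(1) by simp
  have "r' = (sqrt s / sqrt 3 * Ti) / (sqrt s * T3)"
    using ram_r'_eta[of 7 9] unfolding r'_def sq inv p7 T3_def by simp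
  hence r': "r' = Ti / (sqrt 3 * T3)" using s(1) by simp
  \<comment> \<open>After inversion the three values are, up to constants, the pairwise quotients of
    \<open>H\<close>, \<open>H3\<close> and \<open>Hi\<close>, so two of them determine the
    third.\<close>
  have B: "B = A / r"
  proof -
    have "B = (sqrt s * H) / (3 powr (1/4) * (sqrt s / sqrt 3 * Hi))"
      using ram_r_eta[of 3 "3/7"] unfolding B_def sq inv by simp
    also have "\<dots> = H / (3 powr (1/4) * H3) / (Hi / (sqrt 3 * H3))" using pos s(1) by simp
    finally show ?thesis unfolding A r .
  qed
  have B': "B' = A' / r'"
  proof -
    have "B' = (sqrt s * T) / (3 powr (1/4) * (sqrt s / sqrt 3 * Ti))"
      using ram_r'_eta[of 3 "3/7"] unfolding B'_def sq inv by simp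
    also have "\<dots> = T / (3 powr (1/4) * T3) / (Ti / (sqrt 3 * T3))" using pos s(1) by simp
    finally show ?thesis unfolding A' r' .
  qed
  have rpos: "A > 0" "A' > 0" "r > 0" "r' > 0" unfolding A A' r r' using pos by auto

  have r_rho: "r = \<rho> / sqrt 3" unfolding r using HiH3 by (simp add: field_simps)
  have c5: "r = (sqrt (34 + 6 * g) + sqrt (18 + 6 * g)) / 4"
  proof -
    have "sqrt (34 + 6 * g) * sqrt 3 = 9 + g"
      unfolding real_sqrt_mult[symmetric] by (rule sqrt_eqI) (use b in \<open>simp_all add: K\<close>)
    moreover have "sqrt (18 + 6 * g) * sqrt 3 = (g - 3) * D"
      unfolding real_sqrt_mult[symmetric] by (rule sqrt_eqI) (use b in \<open>simp_all add: K\<close>)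
    ultimately have "(sqrt (34 + 6 * g) + sqrt (18 + 6 * g)) / 4 * sqrt 3 = \<rho>"
      unfolding \<rho>_def by (simp add: algebra_simps add_divide_distrib)
    thus ?thesis unfolding r_rho by (simp add: field_simps)
  qed
  have r2: "r\<^sup>2 = (E + F) / 4"
    unfolding r_rho power_divide \<rho>2 E F by (simp add: K)
  \<comment> \<open>The level 9 relation yields only the cube of \<open>Ti / T3\<close>, so the
    comparison is made between third powers.\<close>
  have r'4: "r' ^ 4 = \<kappa>"
  proof (rule power_eq_imp_eq_base[of _ 3])
    have "sqrt 3 ^ 12 = ((sqrt 3)\<^sup>2) ^ 6" by (simp only: power_mult[symmetric]) simp
    hence s12: "sqrt 3 ^ 12 = (729::real)" by simp
    have "(r' ^ 4) ^ 3 = ((Ti / T3) ^ 3) ^ 4 / 729"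
      unfolding r' by (simp add: power_divide power_mult_distrib s12 flip: power_mult)
    also have "\<dots> = ((Y * Y) * (Y * Y)) / 729" unfolding X' Y_def[symmetric] by (simp add: eval_nat_numeral)
    also have "\<dots> = \<kappa> ^ 3" unfolding Y4 \<kappa>3 by (simp add: K)
    finally show "(r' ^ 4) ^ 3 = \<kappa> ^ 3" .
  qed (auto simp: \<kappa>_def)
  have c6: "r' = 2 powr (-3/4) * (p + n) powr (1/2)"
  proof (rule power_eq_imp_eq_base[of _ 4])
    have "(2 powr (-3/4)) ^ 4 = 2 powr (- 3 :: real)" by (subst powr_nat_power) auto
    also have "\<dots> = 1 / 8" by (simp add: powr_minus powr_numeral)
    finally have 2: "(2 powr (-3/4)) ^ 4 = (1 / 8 :: real)" .
    have "((p + n) powr (1/2)) ^ 4 = (p + n) powr 2" using pnpos by (subst powr_nat_power) auto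
    also have "\<dots> = (p + n)\<^sup>2" using pnpos by (simp add: powr_numeral)
    finally show "r' ^ 4 = (2 powr (-3/4) * (p + n) powr (1/2)) ^ 4"
      unfolding power_mult_distrib 2 r'4 \<kappa>_def by simp
  qed (use rpos in auto)

  have p12: "(x powr (1/4)) ^ 12 = x ^ 3" if "x > 0" for x :: real
    using that by (subst powr_nat_power) (auto simp: powr_numeral)
  have t_val: "(H / H3) ^ 12 = 16580619/4 + 3618189/4 * g + 2246049/4 * D + 490131/4 * (g * D)"
  proof -
    have "(X + 3) ^ 3 - 27 = X * (X * X + 9 * X + 27)" by (simp add: algebra_simps eval_nat_numeral)
    moreover have "X * X + 9 * X + 27 = 65826/4 + 14364/4 * g + 8910/4 * D + 1944/4 * (g * D)"
      unfolding Xval by (simp add: K)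
    ultimately show ?thesis unfolding t Xval by (simp add: K)
  qed
  have c1: "A = 20 powr (-1/2) * (E + F) powr (1/4) * a"
  \<comment> \<open>The 12th power clears the exponents 1/4, 1/6 and 1/12 and is the power of
    \<open>H / H3\<close> that the level 9 relation gives.\<close>
  proof (rule power_eq_imp_eq_base[of _ 12])
    have s73: "sqrt 7 * sqrt 3 = g" by (simp add: g_def real_sqrt_mult[symmetric])
    have "a ^ 12 = ((100 * sqrt 7 + 200 * sqrt 3) powr (1/6)) ^ 12 * ((342 + 78 * g) powr (1/12)) ^ 12"
      unfolding a_def g_def by (simp add: power_mult_distrib)
    also have "((100 * sqrt 7 + 200 * sqrt 3) powr (1/6)) ^ 12 = (100 * sqrt 7 + 200 * sqrt 3)\<^sup>2"
      by (subst powr_nat_power) (auto simp: powr_numeral add_pos_pos)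
    also have "\<dots> = 10000 * (19 + 4 * g)"
      by (simp add: power2_sum power_mult_distrib s73[symmetric])
    also have "((342 + 78 * g) powr (1/12)) ^ 12 = 342 + 78 * g"
      using b by (subst powr_nat_power) (auto simp: add_pos_pos)
    also have "10000 * (19 + 4 * g) * (342 + 78 * g) = 10000 * (13050 + 2850 * g)"
      by (simp add: K)
    finally have a12: "a ^ 12 = 10000 * (13050 + 2850 * g)" .
    have "(20 powr (-1/2)) ^ 12 = 20 powr (- 6 :: real)" by (subst powr_nat_power) auto
    also have "\<dots> = 1 / 64000000" by (simp add: powr_minus powr_numeral)
    finally have 20: "(20 powr (-1/2)) ^ 12 = (1 / 64000000 :: real)" .
    have EF2: "(E + F) * (E + F) = 700 + 156 * g + 100 * D + 20 * (g * D)"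
      unfolding E F by (simp add: K)
    have EF3: "(E + F) ^ 3 = 37648 + 8208 * g + 5136 * D + 1104 * (g * D)"
      unfolding power3_eq_cube mult.assoc EF2 unfolding E F by (simp add: K)
    have "A ^ 12 = (H / H3) ^ 12 / 27"
      unfolding A by (simp add: power_divide power_mult_distrib p12)
    also have "\<dots> = (20 powr (-1/2) * (E + F) powr (1/4) * a) ^ 12"
      unfolding power_mult_distrib 20 p12[OF EFpos] EF3 a12 t_val by (simp add: K)
    finally show "A ^ 12 = (20 powr (-1/2) * (E + F) powr (1/4) * a) ^ 12" .
  qed (use rpos in \<open>auto simp: a_def\<close>)
  have c3: "A' = 2 powr (-11/24) * 3 powr (1/8) * (sqrt 7 + sqrt 3) powr (1/12) * (p + n) powr (1/4)"
  \<comment> \<open>The exponents 11/24 and 1/8 need the 24th power, obtained by squaring the known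
    12th power.\<close>
  proof (rule power_eq_imp_eq_base[of _ 24])
    have tp: "(T / T3) ^ 12 = 4131/4 + 891/4 * g + 729/4 * D + 81/4 * (g * D)"
    proof -
      have "(Y - 3) ^ 3 + 27 = Y * (Y * Y - 9 * Y + 27)" by (simp add: algebra_simps eval_nat_numeral)
      moreover have "Y * Y - 9 * Y + 27 = 216/4 + 54/4 * g + 54/4 * D"
        unfolding Y2 unfolding Yval by (simp add: K)
      ultimately show ?thesis unfolding t' Y_def[symmetric] by (simp only:) (simp add: Yval K)
    qed
    have s73: "sqrt 7 * sqrt 3 = g" by (simp add: g_def real_sqrt_mult[symmetric])
    have "(2 powr (-11/24)) ^ 24 = 2 powr (- 11 :: real)" by (subst powr_nat_power) auto
    also have "\<dots> = 1 / 2048" by (simp add: powr_minus powr_numeral)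
    finally have 2: "(2 powr (-11/24)) ^ 24 = (1 / 2048 :: real)" .
    have 3: "(3 powr (1/8)) ^ 24 = (27 :: real)" by (subst powr_nat_power) (auto simp: powr_numeral)
    have "((sqrt 7 + sqrt 3) powr (1/12)) ^ 24 = (sqrt 7 + sqrt 3)\<^sup>2"
      by (subst powr_nat_power) (auto simp: powr_numeral add_pos_pos)
    also have "\<dots> = 10 + 2 * g" by (simp add: power2_sum power_mult_distrib s73[symmetric])
    finally have 73: "((sqrt 7 + sqrt 3) powr (1/12)) ^ 24 = 10 + 2 * g" .
    have "((p + n) powr (1/4)) ^ 24 = (p + n) powr 6" using pnpos by (subst powr_nat_power) auto
    also have "\<dots> = (8 * \<kappa>) ^ 3" using pnpos by (simp add: powr_numeral \<kappa>_def flip: power_mult)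
    finally have pn6: "((p + n) powr (1/4)) ^ 24 = 512 * \<kappa> ^ 3" by (simp add: power_mult_distrib)
    have A'12: "A' ^ 12 = (T / T3) ^ 12 / 27"
      unfolding A' by (simp add: power_divide power_mult_distrib p12)
    have sq27: "(u / 27) * (u / 27) = u * u / 729" for u :: real by simp
    have "A' ^ 24 = A' ^ 12 * A' ^ 12" by (simp flip: power_add)
    also have "\<dots> = ((T / T3) ^ 12 * (T / T3) ^ 12) / 729" unfolding A'12 by (rule sq27)
    also have "\<dots> = (2 powr (-11/24) * 3 powr (1/8) * (sqrt 7 + sqrt 3) powr (1/12) * (p + n) powr (1/4)) ^ 24"
      unfolding power_mult_distrib 2 3 73 pn6 \<kappa>3 tp by (simp add: K)
    finally show "A' ^ 24 = (2 powr (-11/24) * 3 powr (1/8) * (sqrt 7 + sqrt 3) powr (1/12) * (p + n) powr (1/4)) ^ 24" .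
  qed (use rpos in auto)
  \<comment> \<open>Changing the sign of \<open>y\<close> divides the fourth root by
    \<open>z\<close> when z^4 is the quotient of x + y by x - y; used with \<open>r\<close> and
    \<open>r'\<close>.\<close>
  have quarter: "(x - y) powr (1/4) = (x + y) powr (1/4) / z"
    if "x + y > 0" "x - y > 0" "z > 0" "z ^ 4 * (x - y) = x + y" for x y z :: real
  proof -
    have "(x + y) powr (1/4) = (z ^ 4) powr (1/4) * (x - y) powr (1/4)"
      using that powr_mult[of "z ^ 4" "x - y" "1/4"] by simp
    also have "(z ^ 4) powr (1/4) = (z powr 4) powr (1/4)" using that by (simp add: powr_numeral)
    also have "\<dots> = z" using that by (subst powr_powr) simp
    finally show ?thesis using that by simp
  qed
  have "r ^ 4 = r\<^sup>2 * r\<^sup>2" by (simp flip: power_add)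
  hence "r ^ 4 * (E - F) = ((E + F) * (E - F)) * (E + F) / 16" unfolding r2 by simp
  hence "(E - F) powr (1/4) = (E + F) powr (1/4) / r"
    unfolding EF by (intro quarter EFpos EmFpos rpos) simp
  hence c2: "B = 20 powr (-1/2) * (E - F) powr (1/4) * a" unfolding B c1 by simp
  have "r' ^ 4 * (p - n) = ((p + n) * (p - n)) * (p + n) / 8"
    unfolding r'4 \<kappa>_def by (simp add: power2_eq_square)
  hence "(p - n) powr (1/4) = (p + n) powr (1/4) / r'"
    unfolding pn by (intro quarter pnpos pmnpos rpos) simp
  hence c4: "B' = 2 powr (-11/24) * 3 powr (1/8) * (sqrt 7 + sqrt 3) powr (1/12) * (p - n) powr (1/4)"
    unfolding B' c3 by simp
  show ?thesis
    using c1 c2 c3 c4 c5 c6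
    unfolding A_def B_def A'_def B'_def r_def r'_def E_def F_def p_def n_def g_def by blast
qed

end
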